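(* The approximate Killing spinor equation $L(\kappa_{CD})=0$ is the Euler-Lagrange equation of the functional $$J=\int_{\mathcal{S}}\nabla_{(AB}\kappa_{CD)}\widehat{\nabla^{AB}\kappa^{CD}}\,d\mu$$ on symmetric valence-2 spinor fields $\kappa_{AB}$ on $\mathcal S$.
   Context: Spinor conventions are those of Penrose and Rindler; round brackets on indices denote symmetrisation. $(\mathcal S,h_{ab},K_{ab})$ is a smooth vacuum initial data set, regarded as a spacelike hypersurface of its vacuum development of signature $(+,-,-,-)$; $h_{ab}$ is negative definite with Levi-Civita connection $D_a$ and volume form $d\mu$. The normal $\tau^\mu$ is normalised by $\tau_\mu\tau^\mu=2$, $h_{\mu\nu}=g_{\mu\nu}-\frac12\tau_\mu\tau_\nu$, and the symmetric tensor $K_{ab}$ is the pull-back of $K_{\mu\nu}=-h_\mu{}^\lambda h_\nu{}^\rho\nabla_\lambda\tau_\rho$. Spatial tensors become spinors by contraction with the spatial solder form $\sigma^\mu{}_{AB}=\tau_{(B}{}^{A'}\sigma^\mu{}_{A)A'}$ ($K_{ABCD}$, $D_{AB}=\sigma^a{}_{AB}D_a$). The Sen connection is $\nabla_{AB}=\tau^{A'}{}_{(A}\nabla_{B)A'}$; on $\mathcal S$, $\nabla_{AB}\pi_C=D_{AB}\pi_C+\frac12K_{ABC}{}^D\pi_D$, extended to higher valence as usual. $\Omega_{ABCD}=K_{(ABCD)}$. Hermitian conjugation is $\hat\pi_A=\tau_A{}^{E'}\bar\pi_{E'}$, extended to higher valence. For symmetric spinors, $\Phi(\kappa)_{ABCD}=\nabla_{(AB}\kappa_{CD)}$,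 with formal adjoint $\Phi^*(\zeta)_{CD}=\nabla^{AB}\zeta_{ABCD}-2\Omega^{ABF}{}_{(C}\zeta_{D)ABF}$ with respect to the inner products $\int_{\mathcal S}\zeta_{ABCD}\hat\chi^{ABCD}d\mu$ and $\int_{\mathcal S}\zeta_{AB}\hat\chi^{AB}d\mu$. The approximate Killing spinor operator is $L=\Phi^*\circ\Phi$. *)

theory Defs
  imports "HOL-Analysis.Analysis" "HOL-Combinatorics.Permutations"
begin

section \<open>Smooth 3-manifolds\<close>

fun Ck_on :: "nat \<Rightarrow> (real^3) set \<Rightarrow> (real^3 \<Rightarrow> 'b::real_normed_vector) \<Rightarrow> bool" where
  "Ck_on 0 U f \<longleftrightarrow> continuous_on U f"
| "Ck_on (Suc k) U f \<longleftrightarrow>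
     (\<forall>x\<in>U. f differentiable at x) \<and>
     (\<forall>i. Ck_on k U (\<lambda>x. frechet_derivative f (at x) (axis i 1)))"

definition smooth_on :: "(real^3) set \<Rightarrow> (real^3 \<Rightarrow> 'b::real_normed_vector) \<Rightarrow> bool" where
  "smooth_on U f \<longleftrightarrow> (\<forall>k. Ck_on k U f)"

text \<open>A chart is a pair of a domain and a coordinate map. The manifold is the whole type
  \<open>'a\<close>, which carries a second countable Hausdorff topology.\<close>

type_synonym 'a chart = "'a set \<times> ('a \<Rightarrow> real^3)"

definition chart_inv :: "'a chart \<Rightarrow> real^3 \<Rightarrow> 'a" where
  "chart_inv c = inv_into (fst c) (snd c)"

definition smooth_in_chart :: "'a chart \<Rightarrow> ('a \<Rightarrow> 'b::real_normed_vector) \<Rightarrow> bool" where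
  "smooth_in_chart c f \<longleftrightarrow> smooth_on (snd c ` fst c) (f \<circ> chart_inv c)"

definition smooth_atlas :: "'a::topological_space chart set \<Rightarrow> bool" where
  "smooth_atlas A \<longleftrightarrow>
     (\<Union>c\<in>A. fst c) = UNIV \<and>
     (\<forall>c\<in>A. open (fst c) \<and> open (snd c ` fst c) \<and>
        homeomorphism (fst c) (snd c ` fst c) (snd c) (chart_inv c)) \<and>
     (\<forall>c\<in>A. \<forall>c'\<in>A. smooth_on (snd c ` (fst c \<inter> fst c')) (snd c' \<circ> chart_inv c))"

definition chart_deriv :: "'a chart \<Rightarrow> 3 \<Rightarrow> ('a \<Rightarrow> 'b::real_normed_vector) \<Rightarrow> 'a \<Rightarrow> 'b" where
  "chart_deriv c i f p = frechet_derivative (f \<circ> chart_inv c) (at (snd c p)) (axis i 1)"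

text \<open>\<open>jac c c' p k i\<close> is the derivative of the \<open>k\<close>-th coordinate of \<open>c\<close> along the
  \<open>i\<close>-th coordinate of \<open>c'\<close>. Tensor fields are given by their components in each chart
  of the atlas, subject to the tensorial transformation law.\<close>

definition jac :: "'a chart \<Rightarrow> 'a chart \<Rightarrow> 'a \<Rightarrow> 3 \<Rightarrow> 3 \<Rightarrow> real" where
  "jac c c' p k i = chart_deriv c' i (\<lambda>q. snd c q $ k) p"

definition covariant_2_tensor :: "'a chart set \<Rightarrow> ('a chart \<Rightarrow> 'a \<Rightarrow> real^3^3) \<Rightarrow> bool" where
  "covariant_2_tensor A T \<longleftrightarrow>
     (\<forall>c\<in>A. smooth_in_chart c (T c)) \<and>
     (\<forall>c\<in>A. \<forall>c'\<in>A. \<forall>p\<in>fst c \<inter> fst c'. \<forall>i j.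
        T c' p $ i $ j =
          (\<Sum>k\<in>UNIV. \<Sum>l\<in>UNIV. jac c c' p k i * jac c c' p l j * T c p $ k $ l))"

definition complex_vector_field :: "'a chart set \<Rightarrow> ('a chart \<Rightarrow> 'a \<Rightarrow> 3 \<Rightarrow> complex) \<Rightarrow> bool" where
  "complex_vector_field A v \<longleftrightarrow>
     (\<forall>c\<in>A. \<forall>a. smooth_in_chart c (\<lambda>p. v c p a)) \<and>
     (\<forall>c\<in>A. \<forall>c'\<in>A. \<forall>p\<in>fst c \<inter> fst c'. \<forall>a.
        v c p a = (\<Sum>b\<in>UNIV. of_real (jac c c' p a b) * v c' p b))"

definition complex_covector_field :: "'a chart set \<Rightarrow> ('a chart \<Rightarrow> 'a \<Rightarrow> 3 \<Rightarrow> complex) \<Rightarrow> bool" where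
  "complex_covector_field A w \<longleftrightarrow>
     (\<forall>c\<in>A. \<forall>a. smooth_in_chart c (\<lambda>p. w c p a)) \<and>
     (\<forall>c\<in>A. \<forall>c'\<in>A. \<forall>p\<in>fst c \<inter> fst c'. \<forall>a.
        w c' p a = (\<Sum>b\<in>UNIV. of_real (jac c c' p b a) * w c p b))"

section \<open>Initial data with spinors\<close>

text \<open>Spinors are referred to a global spin dyad of unit symplectic norm: the elements \<open>1\<close> and
  \<open>2\<close> of the index type \<open>2\<close> stand for the dyad labels 0 and 1 of Penrose and Rindler.
  The dyad is otherwise arbitrary; in particular it is not tied to the normal.

  \<^item> \<open>metric\<close>, \<open>extr\<close>: the tensors $h_{ab}$ and $K_{ab}$.
  \<^item> \<open>vol\<close>: the Riemannian measure $d\mu$.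
  \<^item> \<open>normal S p A A'\<close>: the spinor $\tau_{AA'}$ of the normal.
  \<^item> \<open>ivdw S c p a A A'\<close>: the tangential projection $\sigma^a{}_{AA'}$ of the space-time
    solder form $\sigma^\mu{}_{AA'}$.
  \<^item> \<open>conn S c p a C Q\<close>: the coefficients $\gamma_{aC}{}^Q$ of the Levi-Civita connection
    on spinors, $D_a\pi_C = \partial_a\pi_C - \gamma_{aC}{}^Q\pi_Q$.\<close>

record 'a spin_data =
  atlas :: "'a chart set"
  metric :: "'a chart \<Rightarrow> 'a \<Rightarrow> real^3^3"
  extr :: "'a chart \<Rightarrow> 'a \<Rightarrow> real^3^3"
  vol :: "'a measure"
  normal :: "'a \<Rightarrow> 2 \<Rightarrow> 2 \<Rightarrow> complex"
  ivdw :: "'a chart \<Rightarrow> 'a \<Rightarrow> 3 \<Rightarrow> 2 \<Rightarrow> 2 \<Rightarrow> complex"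
  conn :: "'a chart \<Rightarrow> 'a \<Rightarrow> 3 \<Rightarrow> 2 \<Rightarrow> 2 \<Rightarrow> complex"

definition inv_metric :: "'a spin_data \<Rightarrow> 'a chart \<Rightarrow> 'a \<Rightarrow> real^3^3" where
  "inv_metric S c p = matrix_inv (metric S c p)"

text \<open>\<open>christoffel S c p a i j\<close> is $\Gamma^a{}_{ij}$.\<close>

definition christoffel :: "'a spin_data \<Rightarrow> 'a chart \<Rightarrow> 'a \<Rightarrow> 3 \<Rightarrow> 3 \<Rightarrow> 3 \<Rightarrow> real" where
  "christoffel S c p a i j =
     (\<Sum>b\<in>UNIV. inv_metric S c p $ a $ b *
        (chart_deriv c i (\<lambda>q. metric S c q $ b $ j) p
         + chart_deriv c j (\<lambda>q. metric S c q $ b $ i) p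
         - chart_deriv c b (\<lambda>q. metric S c q $ i $ j) p)) / 2"

definition ricci :: "'a spin_data \<Rightarrow> 'a chart \<Rightarrow> 'a \<Rightarrow> 3 \<Rightarrow> 3 \<Rightarrow> real" where
  "ricci S c p i j =
     (\<Sum>l\<in>UNIV. chart_deriv c l (\<lambda>q. christoffel S c q l i j) p
            - chart_deriv c j (\<lambda>q. christoffel S c q l i l) p)
     + (\<Sum>l\<in>UNIV. \<Sum>m\<in>UNIV.
            christoffel S c p l l m * christoffel S c p m i j
            - christoffel S c p l j m * christoffel S c p m i l)"

definition scalar_curvature :: "'a spin_data \<Rightarrow> 'a chart \<Rightarrow> 'a \<Rightarrow> real" where
  "scalar_curvature S c p = (\<Sum>i\<in>UNIV. \<Sum>j\<in>UNIV. inv_metric S c p $ i $ j * ricci S c p i j)"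

definition tr_extr :: "'a spin_data \<Rightarrow> 'a chart \<Rightarrow> 'a \<Rightarrow> real" where
  "tr_extr S c p = (\<Sum>i\<in>UNIV. \<Sum>j\<in>UNIV. inv_metric S c p $ i $ j * extr S c p $ i $ j)"

definition sq_extr :: "'a spin_data \<Rightarrow> 'a chart \<Rightarrow> 'a \<Rightarrow> real" where
  "sq_extr S c p = (\<Sum>i\<in>UNIV. \<Sum>j\<in>UNIV. \<Sum>k\<in>UNIV. \<Sum>l\<in>UNIV.
     inv_metric S c p $ i $ k * inv_metric S c p $ j $ l * extr S c p $ i $ j * extr S c p $ k $ l)"

text \<open>\<open>D_extr S c p a i j\<close> is $D_aK_{ij}$.\<close>

definition D_extr :: "'a spin_data \<Rightarrow> 'a chart \<Rightarrow> 'a \<Rightarrow> 3 \<Rightarrow> 3 \<Rightarrow> 3 \<Rightarrow> real" where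
  "D_extr S c p a i j =
     chart_deriv c a (\<lambda>q. extr S c q $ i $ j) p
     - (\<Sum>d\<in>UNIV. christoffel S c p d a i * extr S c p $ d $ j)
     - (\<Sum>d\<in>UNIV. christoffel S c p d a j * extr S c p $ i $ d)"

text \<open>The vacuum Gauss and Codazzi constraints. Since $\tau_\mu\tau^\mu=2$, the tensor $K_{ab}$ is
  $\sqrt 2$ times the usual extrinsic curvature up to sign, and the scalar curvature of the negative
  definite $h_{ab}$ is minus that of $-h_{ab}$.\<close>

definition vacuum_constraints :: "'a spin_data \<Rightarrow> bool" where
  "vacuum_constraints S \<longleftrightarrow> (\<forall>c\<in>atlas S. \<forall>p\<in>fst c.
     2 * scalar_curvature S c p - (tr_extr S c p)\<^sup>2 + sq_extr S c p = 0 \<and>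
     (\<forall>j. (\<Sum>a\<in>UNIV. \<Sum>i\<in>UNIV. inv_metric S c p $ a $ i * D_extr S c p a i j)
          - chart_deriv c j (tr_extr S c) p = 0))"

definition riemannian_measure :: "'a::topological_space spin_data \<Rightarrow> bool" where
  "riemannian_measure S \<longleftrightarrow> sets (vol S) = sets borel \<and>
     (\<forall>c\<in>atlas S. \<forall>B\<in>sets borel. B \<subseteq> fst c \<longrightarrow>
        emeasure (vol S) B =
          (\<integral>\<^sup>+x\<in>snd c ` B. ennreal (sqrt \<bar>det (metric S c (chart_inv c x))\<bar>) \<partial>lborel))"

definition initial_data_set :: "'a::topological_space spin_data \<Rightarrow> bool" where
  "initial_data_set S \<longleftrightarrow>
     smooth_atlas (atlas S) \<and>
     covariant_2_tensor (atlas S) (metric S) \<and>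
     covariant_2_tensor (atlas S) (extr S) \<and>
     (\<forall>c\<in>atlas S. \<forall>p\<in>fst c.
        transpose (metric S c p) = metric S c p \<and>
        (\<forall>v. v \<noteq> 0 \<longrightarrow> v \<bullet> (metric S c p *v v) < 0) \<and>
        transpose (extr S c p) = extr S c p) \<and>
     riemannian_measure S \<and>
     vacuum_constraints S"

subsection \<open>Spinor algebra\<close>

text \<open>\<open>eps\<close> gives the components of each of $\epsilon_{AB}$, $\epsilon^{AB}$ and their complex
  conjugates. Indices are moved by $\xi^A=\epsilon^{AB}\xi_B$, $\xi_B=\xi^A\epsilon_{AB}$.\<close>

definition eps :: "2 \<Rightarrow> 2 \<Rightarrow> complex" where
  "eps A B = (if A = 1 \<and> B = 2 then 1 else if A = 2 \<and> B = 1 then -1 else 0)"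

text \<open>A spinor field with \<open>n\<close> covariant unprimed indices is given by its components on index lists
  of length \<open>n\<close>; the values on other lists are irrelevant.\<close>

type_synonym 'a spinor_field = "2 list \<Rightarrow> 'a \<Rightarrow> complex"

definition smooth_spinor_field :: "'a spin_data \<Rightarrow> nat \<Rightarrow> 'a spinor_field \<Rightarrow> bool" where
  "smooth_spinor_field S n \<phi> \<longleftrightarrow>
     (\<forall>xs. length xs = n \<longrightarrow> (\<forall>c\<in>atlas S. smooth_in_chart c (\<phi> xs)))"

definition symmetric_spinor_field :: "'a spin_data \<Rightarrow> nat \<Rightarrow> 'a spinor_field \<Rightarrow> bool" where
  "symmetric_spinor_field S n \<phi> \<longleftrightarrow> smooth_spinor_field S n \<phi> \<and>
     (\<forall>xs ys. length xs = n \<and> mset ys = mset xs \<longrightarrow> \<phi> ys = \<phi> xs)"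

definition symmetrise :: "'a spinor_field \<Rightarrow> 'a spinor_field" where
  "symmetrise \<phi> xs p =
     (\<Sum>\<pi> | \<pi> permutes {..<length xs}. \<phi> (permute_list \<pi> xs) p) / fact (length xs)"

text \<open>\<open>raise n \<phi>\<close> has the first \<open>n\<close> indices of \<open>\<phi>\<close> raised.\<close>

definition raise :: "nat \<Rightarrow> 'a spinor_field \<Rightarrow> 'a spinor_field" where
  "raise n \<phi> xs p =
     (\<Sum>ys | length ys = n. (\<Prod>k<n. eps (xs ! k) (ys ! k)) * \<phi> (ys @ drop n xs) p)"

text \<open>\<open>normal_up S p A E\<close> is $\tau_A{}^{E'}$.\<close>

definition normal_up :: "'a spin_data \<Rightarrow> 'a \<Rightarrow> 2 \<Rightarrow> 2 \<Rightarrow> complex" where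
  "normal_up S p A E = (\<Sum>F\<in>UNIV. eps E F * normal S p A F)"

definition hat :: "'a spin_data \<Rightarrow> 'a spinor_field \<Rightarrow> 'a spinor_field" where
  "hat S \<phi> xs p =
     (\<Sum>ys | length ys = length xs.
        (\<Prod>k<length xs. normal_up S p (xs ! k) (ys ! k)) * cnj (\<phi> ys p))"

text \<open>\<open>solder S c p a A B\<close> is $\sigma^a{}_{AB}=\tau_{(B}{}^{A'}\sigma^a{}_{A)A'}$.\<close>

definition solder :: "'a spin_data \<Rightarrow> 'a chart \<Rightarrow> 'a \<Rightarrow> 3 \<Rightarrow> 2 \<Rightarrow> 2 \<Rightarrow> complex" where
  "solder S c p a A B =
     (\<Sum>E\<in>UNIV. normal_up S p B E * ivdw S c p a A E + normal_up S p A E * ivdw S c p a B E) / 2"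

text \<open>The last clause is $g_{\mu\nu}\sigma^\mu{}_{AA'}\sigma^\nu{}_{BB'}=
  \epsilon_{AB}\epsilon_{A'B'}$ with $g_{\mu\nu}=h_{\mu\nu}+\frac12\tau_\mu\tau_\nu$.\<close>

definition spinor_structure :: "'a spin_data \<Rightarrow> bool" where
  "spinor_structure S \<longleftrightarrow>
     (\<forall>c\<in>atlas S. \<forall>A E. smooth_in_chart c (\<lambda>p. normal S p A E)) \<and>
     (\<forall>p A E. cnj (normal S p A E) = normal S p E A) \<and>
     (\<forall>p. 0 < Re (normal S p 1 1)) \<and>
     (\<forall>p. (\<Sum>A\<in>UNIV. \<Sum>E\<in>UNIV. \<Sum>B\<in>UNIV. \<Sum>F\<in>UNIV.
        normal S p A E * eps A B * eps E F * normal S p B F) = 2) \<and>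
     (\<forall>A E. complex_vector_field (atlas S) (\<lambda>c p a. ivdw S c p a A E)) \<and>
     (\<forall>c\<in>atlas S. \<forall>p\<in>fst c. \<forall>a A E. cnj (ivdw S c p a A E) = ivdw S c p a E A) \<and>
     (\<forall>c\<in>atlas S. \<forall>p\<in>fst c. \<forall>A E B F.
        (\<Sum>a\<in>UNIV. \<Sum>b\<in>UNIV.
           of_real (metric S c p $ a $ b) * ivdw S c p a A E * ivdw S c p b B F)
        + normal S p A E * normal S p B F / 2 = eps A B * eps E F)"

subsection \<open>Connections\<close>

text \<open>\<open>cov_deriv S c a \<phi> xs p\<close> is the component of $D_a\phi$ in the chart \<open>c\<close>.\<close>

definition cov_deriv :: "'a spin_data \<Rightarrow> 'a chart \<Rightarrow> 3 \<Rightarrow> 'a spinor_field \<Rightarrow> 'a spinor_field" where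
  "cov_deriv S c a \<phi> xs p =
     chart_deriv c a (\<phi> xs) p
     - (\<Sum>k<length xs. \<Sum>Q\<in>UNIV. conn S c p a (xs ! k) Q * \<phi> (xs[k := Q]) p)"

text \<open>The extension of the Levi-Civita connection to spinors is the unique one with
  $D_a\epsilon_{AB}=0$ and $D_b\sigma^a{}_{AB}=0$.\<close>

definition spinor_connection :: "'a spin_data \<Rightarrow> bool" where
  "spinor_connection S \<longleftrightarrow>
     (\<forall>C Q. complex_covector_field (atlas S) (\<lambda>c p a. conn S c p a C Q)) \<and>
     (\<forall>c\<in>atlas S. \<forall>p\<in>fst c. \<forall>a A B.
        cov_deriv S c a (\<lambda>xs q. eps (xs ! 0) (xs ! 1)) [A, B] p = 0) \<and>
     (\<forall>c\<in>atlas S. \<forall>p\<in>fst c. \<forall>a b A B.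
        chart_deriv c b (\<lambda>q. solder S c q a A B) p
        + (\<Sum>d\<in>UNIV. of_real (christoffel S c p a b d) * solder S c p d A B)
        - (\<Sum>Q\<in>UNIV. conn S c p b A Q * solder S c p a Q B)
        - (\<Sum>Q\<in>UNIV. conn S c p b B Q * solder S c p a A Q) = 0)"

definition vacuum_spin_data :: "'a::topological_space spin_data \<Rightarrow> bool" where
  "vacuum_spin_data S \<longleftrightarrow> initial_data_set S \<and> spinor_structure S \<and> spinor_connection S"

text \<open>The scalar-valued contractions below do not depend on the chart, so any one can be used.\<close>

definition chart_at :: "'a spin_data \<Rightarrow> 'a \<Rightarrow> 'a chart" where
  "chart_at S p = (SOME c. c \<in> atlas S \<and> p \<in> fst c)"

text \<open>$K_{ABCD}$ and $\Omega_{ABCD}=K_{(ABCD)}$; only lists of length 4 are meaningful.\<close>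

definition K_spinor :: "'a spin_data \<Rightarrow> 'a spinor_field" where
  "K_spinor S xs p = (let c = chart_at S p in
     \<Sum>a\<in>UNIV. \<Sum>b\<in>UNIV. solder S c p a (xs ! 0) (xs ! 1) * solder S c p b (xs ! 2) (xs ! 3)
       * of_real (extr S c p $ a $ b))"

definition Omega :: "'a spin_data \<Rightarrow> 'a spinor_field" where
  "Omega S = symmetrise (K_spinor S)"

text \<open>\<open>sen S \<phi> (A # B # xs)\<close> is $\nabla_{AB}\phi$, that is, $D_{AB}\phi$ plus one term
  $\frac12K_{ABC}{}^Q\phi_{\dots Q\dots}$ for each index $C$ of $\phi$, where
  $K_{ABC}{}^Q=\epsilon^{QR}K_{ABCR}$.\<close>

fun sen :: "'a spin_data \<Rightarrow> 'a spinor_field \<Rightarrow> 'a spinor_field" where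
  "sen S \<phi> (A # B # xs) p =
     (let c = chart_at S p in \<Sum>a\<in>UNIV. solder S c p a A B * cov_deriv S c a \<phi> xs p)
     + (\<Sum>k<length xs. \<Sum>Q\<in>UNIV. \<Sum>R\<in>UNIV.
          eps Q R * K_spinor S [A, B, xs ! k, R] p * \<phi> (xs[k := Q]) p) / 2"
| "sen S \<phi> _ p = 0"

section \<open>The approximate Killing spinor operator and its functional\<close>

definition Phi :: "'a spin_data \<Rightarrow> 'a spinor_field \<Rightarrow> 'a spinor_field" where
  "Phi S \<kappa> = symmetrise (sen S \<kappa>)"

definition Phi_adj :: "'a spin_data \<Rightarrow> 'a spinor_field \<Rightarrow> 'a spinor_field" where
  "Phi_adj S \<zeta> xs p =
     (\<Sum>A\<in>UNIV. \<Sum>B\<in>UNIV. raise 2 (sen S \<zeta>) (A # B # A # B # xs) p)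
     - 2 * symmetrise
         (\<lambda>ys q. \<Sum>A\<in>UNIV. \<Sum>B\<in>UNIV. \<Sum>F\<in>UNIV.
            raise 3 (Omega S) [A, B, F, ys ! 0] q * \<zeta> [ys ! 1, A, B, F] q) xs p"

definition approx_killing :: "'a spin_data \<Rightarrow> 'a spinor_field \<Rightarrow> 'a spinor_field" where
  "approx_killing S \<kappa> = Phi_adj S (Phi S \<kappa>)"

definition J_density :: "'a spin_data \<Rightarrow> 'a spinor_field \<Rightarrow> 'a \<Rightarrow> complex" where
  "J_density S \<kappa> p =
     (\<Sum>xs | length xs = 4. symmetrise (sen S \<kappa>) xs p * raise 4 (hat S (sen S \<kappa>)) xs p)"

definition J_on :: "'a spin_data \<Rightarrow> 'a set \<Rightarrow> 'a spinor_field \<Rightarrow> complex" where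
  "J_on S W \<kappa> = (LINT p:W|vol S. J_density S \<kappa> p)"

definition J :: "'a spin_data \<Rightarrow> 'a spinor_field \<Rightarrow> complex" where
  "J S \<kappa> = (LINT p|vol S. J_density S \<kappa> p)"

definition J_finite :: "'a spin_data \<Rightarrow> 'a spinor_field \<Rightarrow> bool" where
  "J_finite S \<kappa> \<longleftrightarrow> integrable (vol S) (J_density S \<kappa>)"

definition supported_in :: "'a spinor_field \<Rightarrow> nat \<Rightarrow> 'a set \<Rightarrow> bool" where
  "supported_in \<eta> n C \<longleftrightarrow> (\<forall>xs p. length xs = n \<and> p \<notin> C \<longrightarrow> \<eta> xs p = 0)"

definition vary :: "'a spinor_field \<Rightarrow> 'a spinor_field \<Rightarrow> real \<Rightarrow> 'a spinor_field" where
  "vary \<kappa> \<eta> t = (\<lambda>xs p. \<kappa> xs p + of_real t * \<eta> xs p)"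

text \<open>The manifold need not be compact, so the integral over all of it can diverge. As usual for
  Euler-Lagrange equations, stationarity under compactly supported variations is then
  understood by integrating over any compact set that contains the support of the variation;
  when the integral converges one can use the functional itself.\<close>

definition locally_stationary :: "'a::topological_space spin_data \<Rightarrow> 'a spinor_field \<Rightarrow> bool" where
  "locally_stationary S \<kappa> \<longleftrightarrow>
     (\<forall>\<eta> C. symmetric_spinor_field S 2 \<eta> \<and> compact C \<and> supported_in \<eta> 2 C \<longrightarrow>
        ((\<lambda>t. J_on S C (vary \<kappa> \<eta> t)) has_vector_derivative 0) (at 0))"

definition stationary :: "'a::topological_space spin_data \<Rightarrow> 'a spinor_field \<Rightarrow> bool" where
  "stationary S \<kappa> \<longleftrightarrow>
     (\<forall>\<eta> C. symmetric_spinor_field S 2 \<eta> \<and> compact C \<and> supported_in \<eta> 2 C \<longrightarrow>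
        ((\<lambda>t. J S (vary \<kappa> \<eta> t)) has_vector_derivative 0) (at 0))"

end

(* The first variation of J in the direction eta is 2 Re of the integral of <Phi eta, Phi kappa>, since
   total symmetrisation is self-adjoint for the Hermitian inner product. The difference
   <Phi eta, zeta> - <eta, Phi* zeta> is the divergence of the vector field
   sigma^a_{AB} eta_{CD} hat(zeta)^{ABCD}: the connection terms cancel because D commutes with
   Hermitian conjugation, and because sigma^a_{AB} is anti-Hermitian and K_{ABCD} Hermitian the
   remaining terms combine to Phi*. Hence the first variation is 2 Re of the integral of
   <eta, L kappa>. If L kappa does not vanish at a point, a bump function times a constant spinor
   gives a direction in which this is positive. *)

theory Submission
  imports Defs
begin

section \<open>Calculus of smooth maps\<close>

text \<open>The spin connection is pinned down only by the constancy of eps and of the solder form.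
  That it also annihilates the normal spinor, so that D commutes with Hermitian conjugation, has to
  be derived from the anti-Hermiticity of the solder form. \<open>K_spinor\<close> and
  \<open>sen\<close> are computed in a chart picked at each point with no regularity in the point,
  so chart independence comes before any differentiation of them. The measure is likewise known only
  on Borel subsets of chart domains: the divergence theorem holds first for fields supported in one
  chart, and a general variation is cut up by finitely many bump functions. The trace of K drops out
  against symmetric fields, which is why Omega may stand for K in the adjoint. The coefficient 2
  there arises because the Sen divergence brings the K term with sign plus where the adjunction asks
  for sign minus. The parameter t is real, so stationarity controls only a real part. This loses
  nothing, as the test spinor can be built from the complex conjugate of the value that is to be
  excluded.\<close>

lemma frechet_derivative_cong_open:
  assumes "open U" "x \<in> U" "\<And>y. y \<in> U \<Longrightarrow> f y = g y"
  shows "frechet_derivative f (at x) = frechet_derivative g (at x)"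
proof -
  have "(f has_derivative D) (at x) \<longleftrightarrow> (g has_derivative D) (at x)" for D
    using assms has_derivative_transform_within_open[of f D x UNIV U g]
      has_derivative_transform_within_open[of g D x UNIV U f] by auto
  then show ?thesis by (simp add: frechet_derivative_def)
qed

lemma differentiable_cong_open:
  assumes "open U" "x \<in> U" "\<And>y. y \<in> U \<Longrightarrow> f y = g y" "f differentiable at x"
  shows "g differentiable at x"
  using assms has_derivative_transform_within_open[of f _ x UNIV U g]
  by (auto simp: differentiable_def)

lemma Ck_on_cong:
  assumes "open U" "\<And>x. x \<in> U \<Longrightarrow> f x = g x" "Ck_on k U f"
  shows "Ck_on k U g"
  using assms(2,3)
proof (induction k arbitrary: f g)
  case 0
  then show ?case by (simp cong: continuous_on_cong)
next
  case (Suc k)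
  have "g differentiable at x" if "x \<in> U" for x
    using Suc.prems differentiable_cong_open[OF assms(1) that, of f g] that by auto
  moreover have "Ck_on k U (\<lambda>x. frechet_derivative g (at x) (axis i 1))" for i
  proof (rule Suc.IH)
    show "Ck_on k U (\<lambda>x. frechet_derivative f (at x) (axis i 1))"
      using Suc.prems by auto
    show "frechet_derivative f (at x) (axis i 1) = frechet_derivative g (at x) (axis i 1)"
      if "x \<in> U" for x
      using frechet_derivative_cong_open[OF assms(1) that, of f g] Suc.prems by auto
  qed
  ultimately show ?case by simp
qed

lemma Ck_on_subset: "Ck_on k U f \<Longrightarrow> V \<subseteq> U \<Longrightarrow> Ck_on k V f"
  by (induction k arbitrary: f) (auto intro: continuous_on_subset)

lemma Ck_on_continuous: "Ck_on k U f \<Longrightarrow> continuous_on U f"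
  by (cases k) (auto intro!: continuous_at_imp_continuous_on differentiable_imp_continuous_within)

lemma Ck_on_SucD: "Ck_on (Suc k) U f \<Longrightarrow> Ck_on k U f"
proof (induction k arbitrary: f)
  case 0
  show ?case using Ck_on_continuous[OF 0] by simp
next
  case (Suc k)
  have "Ck_on k U (\<lambda>x. frechet_derivative f (at x) (axis i 1))" for i
    using Suc.prems by (intro Suc.IH) (simp add: Ck_on.simps(2)[of "Suc k"] del: Ck_on.simps)
  then show ?case using Suc.prems by simp
qed

text \<open>Serves to glue: a field extended by zero is smooth near its support and off its support
  for different reasons.\<close>

lemma Ck_on_local:
  assumes "\<And>x. x \<in> U \<Longrightarrow> \<exists>V. open V \<and> x \<in> V \<and> Ck_on k V f"
  shows "Ck_on k U f"
  using assms
proof (induction k arbitrary: f)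
  case 0
  have "isCont f x" if "x \<in> U" for x
    using 0[OF that] by (auto simp: continuous_on_eq_continuous_at)
  then show ?case by (simp add: continuous_at_imp_continuous_on)
next
  case (Suc k)
  have "f differentiable at x" if "x \<in> U" for x
    using Suc.prems[OF that] by auto
  moreover have "Ck_on k U (\<lambda>x. frechet_derivative f (at x) (axis i 1))" for i
  proof (rule Suc.IH)
    fix x assume "x \<in> U"
    then show "\<exists>V. open V \<and> x \<in> V \<and> Ck_on k V (\<lambda>x. frechet_derivative f (at x) (axis i 1))"
      using Suc.prems[of x] by auto
  qed
  ultimately show ?case by simp
qed

lemma Ck_on_const [simp]: "Ck_on k U (\<lambda>x. c)"
  by (induction k arbitrary: c) auto

lemma Ck_on_bounded_linear:
  assumes "open U" "bounded_linear L" "Ck_on k U f"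
  shows "Ck_on k U (\<lambda>x. L (f x))"
  using assms(3)
proof (induction k arbitrary: f)
  case 0
  then show ?case
    using bounded_linear.continuous_on[OF assms(2)] by simp
next
  case (Suc k)
  have d: "((\<lambda>x. L (f x)) has_derivative (\<lambda>v. L (frechet_derivative f (at x) v))) (at x)"
    if "x \<in> U" for x
    using Suc.prems that
    by (intro bounded_linear.has_derivative[OF assms(2)]) (auto simp: frechet_derivative_works)
  have "Ck_on k U (\<lambda>x. frechet_derivative (\<lambda>x. L (f x)) (at x) (axis i 1))" for i
  proof (rule Ck_on_cong[OF assms(1)])
    show "Ck_on k U (\<lambda>x. L (frechet_derivative f (at x) (axis i 1)))"
      using Suc by auto
    show "L (frechet_derivative f (at x) (axis i 1))
        = frechet_derivative (\<lambda>x. L (f x)) (at x) (axis i 1)" if "x \<in> U" for x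
      by (rule fun_cong[OF frechet_derivative_at[OF d[OF that]], of "axis i 1"])
  qed
  moreover have "(\<lambda>x. L (f x)) differentiable at x" if "x \<in> U" for x
    using d[OF that] by (auto simp: differentiable_def)
  ultimately show ?case by simp
qed

lemma Ck_on_add:
  assumes "open U" "Ck_on k U f" "Ck_on k U g"
  shows "Ck_on k U (\<lambda>x. f x + g x)"
  using assms(2,3)
proof (induction k arbitrary: f g)
  case 0
  then show ?case by (simp add: continuous_on_add)
next
  case (Suc k)
  have d: "((\<lambda>x. f x + g x) has_derivative
      (\<lambda>v. frechet_derivative f (at x) v + frechet_derivative g (at x) v)) (at x)"
    if "x \<in> U" for x
    using Suc.prems that
    by (intro has_derivative_add) (auto simp: frechet_derivative_works)
  have "Ck_on k U (\<lambda>x. frechet_derivative (\<lambda>x. f x + g x) (at x) (axis i 1))" for i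
  proof (rule Ck_on_cong[OF assms(1)])
    show "Ck_on k U (\<lambda>x. frechet_derivative f (at x) (axis i 1) + frechet_derivative g (at x) (axis i 1))"
      using Suc by auto
    show "frechet_derivative f (at x) (axis i 1) + frechet_derivative g (at x) (axis i 1)
        = frechet_derivative (\<lambda>x. f x + g x) (at x) (axis i 1)" if "x \<in> U" for x
      by (rule fun_cong[OF frechet_derivative_at[OF d[OF that]], of "axis i 1"])
  qed
  moreover have "(\<lambda>x. f x + g x) differentiable at x" if "x \<in> U" for x
    using d[OF that] by (auto simp: differentiable_def)
  ultimately show ?case by simp
qed

lemma Ck_on_bilinear:
  assumes "open U" "bounded_bilinear B" "Ck_on k U f" "Ck_on k U g"
  shows "Ck_on k U (\<lambda>x. B (f x) (g x))"
  using assms(3,4)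
proof (induction k arbitrary: f g)
  case 0
  then show ?case using bounded_bilinear.continuous_on[OF assms(2)] by simp
next
  case (Suc k)
  have d: "((\<lambda>x. B (f x) (g x)) has_derivative
      (\<lambda>v. B (f x) (frechet_derivative g (at x) v) + B (frechet_derivative f (at x) v) (g x))) (at x)"
    if "x \<in> U" for x
    using Suc.prems that
    by (intro bounded_bilinear.FDERIV[OF assms(2)]) (auto simp: frechet_derivative_works)
  have "Ck_on k U (\<lambda>x. frechet_derivative (\<lambda>x. B (f x) (g x)) (at x) (axis i 1))" for i
  proof (rule Ck_on_cong[OF assms(1)])
    have "Ck_on k U f" "Ck_on k U g"
      using Suc.prems by (auto intro: Ck_on_SucD)
    then show "Ck_on k U (\<lambda>x. B (f x) (frechet_derivative g (at x) (axis i 1))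
        + B (frechet_derivative f (at x) (axis i 1)) (g x))"
      using Suc by (intro Ck_on_add assms(1) Suc.IH) auto
    show "B (f x) (frechet_derivative g (at x) (axis i 1))
        + B (frechet_derivative f (at x) (axis i 1)) (g x)
        = frechet_derivative (\<lambda>x. B (f x) (g x)) (at x) (axis i 1)" if "x \<in> U" for x
      by (rule fun_cong[OF frechet_derivative_at[OF d[OF that]], of "axis i 1"])
  qed
  moreover have "(\<lambda>x. B (f x) (g x)) differentiable at x" if "x \<in> U" for x
    using d[OF that] by (auto simp: differentiable_def)
  ultimately show ?case by simp
qed

text \<open>One induction step on k, shared by inverse, square root and the flat exponentials. Their
  derivatives are expressible through the functions themselves, so order k of the composite with
  phi' is at hand when order k + 1 of the composite with phi is sought.\<close>

lemma Ck_on_real_comp: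
  fixes f :: "real^3 \<Rightarrow> real"
  assumes "open U" "\<And>x. x \<in> U \<Longrightarrow> (\<phi> has_real_derivative \<phi>' (f x)) (at (f x))"
    and "Ck_on (Suc k) U f" "Ck_on k U (\<lambda>x. \<phi>' (f x))"
  shows "Ck_on (Suc k) U (\<lambda>x. \<phi> (f x))"
proof -
  have d: "((\<lambda>x. \<phi> (f x)) has_derivative (\<lambda>v. \<phi>' (f x) * frechet_derivative f (at x) v)) (at x)"
    if "x \<in> U" for x
  proof -
    have "(f has_derivative frechet_derivative f (at x)) (at x)"
      using assms(3) that by (auto simp: frechet_derivative_works)
    from has_derivative_compose[OF this, of \<phi> "(*) (\<phi>' (f x))"] assms(2)[OF that]
    show ?thesis by (simp add: has_field_derivative_def)
  qed
  have "Ck_on k U (\<lambda>x. frechet_derivative (\<lambda>x. \<phi> (f x)) (at x) (axis i 1))" for i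
  proof (rule Ck_on_cong[OF assms(1)])
    show "Ck_on k U (\<lambda>x. \<phi>' (f x) * frechet_derivative f (at x) (axis i 1))"
      using assms(3) by (intro Ck_on_bilinear[OF assms(1) bounded_bilinear_mult assms(4)]) simp
    show "\<phi>' (f x) * frechet_derivative f (at x) (axis i 1)
        = frechet_derivative (\<lambda>x. \<phi> (f x)) (at x) (axis i 1)" if "x \<in> U" for x
      by (rule fun_cong[OF frechet_derivative_at[OF d[OF that]], of "axis i 1"])
  qed
  moreover have "(\<lambda>x. \<phi> (f x)) differentiable at x" if "x \<in> U" for x
    using d[OF that] by (auto simp: differentiable_def)
  ultimately show ?thesis by simp
qed

section \<open>Closure properties of smooth maps on open sets\<close>

lemma smooth_onD: "smooth_on U f \<Longrightarrow> Ck_on k U f"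
  by (simp add: smooth_on_def)

lemma smooth_on_continuous: "smooth_on U f \<Longrightarrow> continuous_on U f"
  using smooth_onD[of U f 0] by simp

lemma smooth_on_differentiable: "smooth_on U f \<Longrightarrow> x \<in> U \<Longrightarrow> f differentiable at x"
  using smooth_onD[of U f 1] by simp

lemma smooth_on_partial:
  "smooth_on U f \<Longrightarrow> smooth_on U (\<lambda>x. frechet_derivative f (at x) (axis i 1))"
  unfolding smooth_on_def by (metis Ck_on.simps(2))

lemma smooth_on_subset: "smooth_on U f \<Longrightarrow> V \<subseteq> U \<Longrightarrow> smooth_on V f"
  by (auto simp: smooth_on_def intro: Ck_on_subset)

lemma smooth_on_cong:
  "open U \<Longrightarrow> (\<And>x. x \<in> U \<Longrightarrow> f x = g x) \<Longrightarrow> smooth_on U f \<Longrightarrow> smooth_on U g"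
  unfolding smooth_on_def by (metis Ck_on_cong)

lemma smooth_on_local:
  "(\<And>x. x \<in> U \<Longrightarrow> \<exists>V. open V \<and> x \<in> V \<and> smooth_on V f) \<Longrightarrow> smooth_on U f"
  unfolding smooth_on_def by (meson Ck_on_local)

lemma smooth_on_const [simp]: "smooth_on U (\<lambda>x. c)"
  by (simp add: smooth_on_def)

lemma smooth_on_bounded_linear:
  "open U \<Longrightarrow> bounded_linear L \<Longrightarrow> smooth_on U f \<Longrightarrow> smooth_on U (\<lambda>x. L (f x))"
  by (simp add: smooth_on_def Ck_on_bounded_linear)

lemma smooth_on_add:
  "open U \<Longrightarrow> smooth_on U f \<Longrightarrow> smooth_on U g \<Longrightarrow> smooth_on U (\<lambda>x. f x + g x)"
  by (simp add: smooth_on_def Ck_on_add)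

lemma smooth_on_mult:
  fixes f g :: "_ \<Rightarrow> 'b::real_normed_algebra"
  shows "open U \<Longrightarrow> smooth_on U f \<Longrightarrow> smooth_on U g \<Longrightarrow> smooth_on U (\<lambda>x. f x * g x)"
  by (simp add: smooth_on_def Ck_on_bilinear bounded_bilinear_mult)

lemma smooth_on_minus: "open U \<Longrightarrow> smooth_on U f \<Longrightarrow> smooth_on U (\<lambda>x. - f x)"
  using smooth_on_bounded_linear[of U uminus f] by (simp add: bounded_linear_minus bounded_linear_ident)

lemma smooth_on_diff:
  "open U \<Longrightarrow> smooth_on U f \<Longrightarrow> smooth_on U g \<Longrightarrow> smooth_on U (\<lambda>x. f x - g x)"
  using smooth_on_add[of U f "\<lambda>x. - g x"] by (simp add: smooth_on_minus)

lemma smooth_on_sum: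
  assumes "open U" "\<And>i. i \<in> I \<Longrightarrow> smooth_on U (f i)"
  shows "smooth_on U (\<lambda>x. \<Sum>i\<in>I. f i x)"
  using assms(2) by (induction I rule: infinite_finite_induct) (auto intro: smooth_on_add assms(1))

lemma smooth_on_prod:
  fixes f :: "_ \<Rightarrow> _ \<Rightarrow> 'b::real_normed_field"
  assumes "open U" "\<And>i. i \<in> I \<Longrightarrow> smooth_on U (f i)"
  shows "smooth_on U (\<lambda>x. \<Prod>i\<in>I. f i x)"
  using assms(2) by (induction I rule: infinite_finite_induct) (auto intro: smooth_on_mult assms(1))

lemma smooth_on_cnj: "open U \<Longrightarrow> smooth_on U f \<Longrightarrow> smooth_on U (\<lambda>x. cnj (f x))"
  using smooth_on_bounded_linear[of U cnj f] by (simp add: bounded_linear_cnj)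

lemma smooth_on_of_real:
  "open U \<Longrightarrow> smooth_on U f \<Longrightarrow> smooth_on U (\<lambda>x. of_real (f x) :: complex)"
  using smooth_on_bounded_linear[of U complex_of_real f] by (simp add: bounded_linear_of_real)

lemma smooth_on_nth: "open U \<Longrightarrow> smooth_on U f \<Longrightarrow> smooth_on U (\<lambda>x. f x $ i)"
  using smooth_on_bounded_linear[of U "\<lambda>v. v $ i" f] by (simp add: bounded_linear_vec_nth)

lemma smooth_on_inverse:
  fixes f :: "real^3 \<Rightarrow> real"
  assumes "open U" "smooth_on U f" "\<And>x. x \<in> U \<Longrightarrow> f x \<noteq> 0"
  shows "smooth_on U (\<lambda>x. inverse (f x))"
  unfolding smooth_on_def
proof
  fix k show "Ck_on k U (\<lambda>x. inverse (f x))"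
  proof (induction k)
    case 0
    then show ?case
      using smooth_on_continuous[OF assms(2)] assms(3) by (auto intro!: continuous_intros)
  next
    case (Suc k)
    show ?case
    proof (rule Ck_on_real_comp[OF assms(1), where \<phi> = inverse and f = f and \<phi>' = "\<lambda>y. - (inverse y * inverse y)"])
      show "(inverse has_real_derivative - (inverse (f x) * inverse (f x))) (at (f x))"
        if "x \<in> U" for x
        using DERIV_inverse[OF assms(3)[OF that]] by (simp add: power2_eq_square)
      show "Ck_on k U (\<lambda>x. - (inverse (f x) * inverse (f x)))"
        using Ck_on_bounded_linear[OF assms(1) bounded_linear_minus[OF bounded_linear_ident]
            Ck_on_bilinear[OF assms(1) bounded_bilinear_mult Suc Suc]] .
    qed (rule smooth_onD[OF assms(2)])
  qed
qed

lemma smooth_on_sqrt: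
  fixes f :: "real^3 \<Rightarrow> real"
  assumes "open U" "smooth_on U f" "\<And>x. x \<in> U \<Longrightarrow> f x > 0"
  shows "smooth_on U (\<lambda>x. sqrt (f x))"
  unfolding smooth_on_def
proof
  fix k show "Ck_on k U (\<lambda>x. sqrt (f x))"
  proof (induction k)
    case 0
    then show ?case
      using smooth_on_continuous[OF assms(2)] by (auto intro!: continuous_intros)
  next
    case (Suc k)
    show ?case
    \<comment> \<open>The derivative 1/(2 sqrt y) is rewritten as (1/y) sqrt y / 2, so that the
      induction hypothesis for the square root applies to it.\<close>
    proof (rule Ck_on_real_comp[OF assms(1), where \<phi> = sqrt and f = f and \<phi>' = "\<lambda>y. inverse y * sqrt y / 2"])
      show "(sqrt has_real_derivative inverse (f x) * sqrt (f x) / 2) (at (f x))"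
        if "x \<in> U" for x
      proof -
        have "inverse (f x) * sqrt (f x) = inverse (sqrt (f x))"
          using assms(3)[OF that] by (simp add: field_simps)
        then show ?thesis
          using DERIV_real_sqrt[OF assms(3)[OF that]] by simp
      qed
      have "smooth_on U (\<lambda>x. inverse (f x))"
        using assms by (intro smooth_on_inverse) (force dest: less_imp_neq)+
      then show "Ck_on k U (\<lambda>x. inverse (f x) * sqrt (f x) / 2)"
        by (intro Ck_on_bounded_linear[OF assms(1) bounded_linear_divide[of 2]]
            Ck_on_bilinear[OF assms(1) bounded_bilinear_mult] smooth_onD Suc)
    qed (rule smooth_onD[OF assms(2)])
  qed
qed

text \<open>The derivative is spelled out through the partial derivatives of f, because these are
  what \<open>Ck_on\<close> passes on to the next order.\<close>

lemma has_derivative_compose_partial: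
  fixes g :: "real^3 \<Rightarrow> real^3"
  assumes "f differentiable at (g x)" "g differentiable at x"
  shows "((\<lambda>x. f (g x)) has_derivative (\<lambda>v. \<Sum>j\<in>UNIV.
      (frechet_derivative g (at x) v $ j) *\<^sub>R frechet_derivative f (at (g x)) (axis j 1))) (at x)"
proof -
  let ?D = "frechet_derivative f (at (g x))"
  interpret L: bounded_linear ?D
    using assms(1) by (simp add: frechet_derivative_works has_derivative_bounded_linear)
  have e: "?D w = (\<Sum>j\<in>UNIV. (w $ j) *\<^sub>R ?D (axis j 1))" for w
  proof -
    have "?D w = ?D (\<Sum>j\<in>UNIV. (w $ j) *\<^sub>R axis j 1)"
      by (simp only: basis_expansion scalar_mult_eq_scaleR[symmetric])
    then show ?thesis by (simp only: L.sum L.scaleR)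
  qed
  have "((\<lambda>x. f (g x)) has_derivative (\<lambda>v. ?D (frechet_derivative g (at x) v))) (at x)"
    by (rule has_derivative_compose) (use assms in \<open>simp_all only: frechet_derivative_works\<close>)
  then show ?thesis by (subst e[symmetric])
qed

text \<open>Partial derivatives of the composite are sums of partials of g times partials of f
  composed with the same g. Hence the induction generalises over f while g stays fixed and fully
  smooth.\<close>

lemma Ck_on_compose:
  fixes g :: "real^3 \<Rightarrow> real^3"
  assumes "open U" "smooth_on U g" "g ` U \<subseteq> V" "Ck_on k V f"
  shows "Ck_on k U (\<lambda>x. f (g x))"
  using assms(4)
proof (induction k arbitrary: f)
  case 0
  then show ?case
    using continuous_on_compose2[of V f U g] smooth_on_continuous[OF assms(2)] assms(3) by simp
next
  case (Suc k)
  note d = has_derivative_compose_partial[of f g]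
  have diff: "f differentiable at (g x)" "g differentiable at x" if "x \<in> U" for x
    using Suc.prems assms(2,3) that smooth_on_differentiable by auto
  have "Ck_on k U (\<lambda>x. frechet_derivative (\<lambda>x. f (g x)) (at x) (axis i 1))" for i
  proof (rule Ck_on_cong[OF assms(1)])
    have *: "Ck_on k U (\<lambda>x. (frechet_derivative g (at x) (axis i 1) $ j)
        *\<^sub>R frechet_derivative f (at (g x)) (axis j 1))" for j
      using smooth_onD[OF smooth_on_nth[OF assms(1) smooth_on_partial[OF assms(2)]]]
        Suc.IH[of "\<lambda>y. frechet_derivative f (at y) (axis j 1)"] Suc.prems
      by (intro Ck_on_bilinear[OF assms(1) bounded_bilinear_scaleR]) auto
    show "Ck_on k U (\<lambda>x. \<Sum>j\<in>UNIV. (frechet_derivative g (at x) (axis i 1) $ j)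
        *\<^sub>R frechet_derivative f (at (g x)) (axis j 1))"
    proof -
      have "Ck_on k U (\<lambda>x. \<Sum>j\<in>J. (frechet_derivative g (at x) (axis i 1) $ j)
        *\<^sub>R frechet_derivative f (at (g x)) (axis j 1))" for J
        by (induction J rule: infinite_finite_induct) (auto intro!: Ck_on_add assms(1) *)
      then show ?thesis .
    qed
    show "(\<Sum>j\<in>UNIV. (frechet_derivative g (at x) (axis i 1) $ j)
        *\<^sub>R frechet_derivative f (at (g x)) (axis j 1))
        = frechet_derivative (\<lambda>x. f (g x)) (at x) (axis i 1)" if "x \<in> U" for x
      by (rule fun_cong[OF frechet_derivative_at[OF d[OF diff[OF that]]], of "axis i 1"])
  qed
  moreover have "(\<lambda>x. f (g x)) differentiable at x" if "x \<in> U" for x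
    using d[OF diff[OF that]] by (auto simp: differentiable_def)
  ultimately show ?case by simp
qed

lemma smooth_on_compose:
  fixes g :: "real^3 \<Rightarrow> real^3"
  shows "open U \<Longrightarrow> smooth_on U g \<Longrightarrow> g ` U \<subseteq> V \<Longrightarrow> smooth_on V f \<Longrightarrow> smooth_on U (\<lambda>x. f (g x))"
  by (auto simp: smooth_on_def[of _ f] smooth_on_def[of _ "\<lambda>x. f (g x)"] intro: Ck_on_compose)

subsection \<open>Bump functions\<close>

text \<open>The functions t^(-k) exp(-1/t), extended by zero, span a space closed under
  differentiation; k = 0 is the classical smooth function that is flat at the origin.\<close>

definition flat_exp :: "nat \<Rightarrow> real \<Rightarrow> real" where
  "flat_exp k t = (if t > 0 then inverse t ^ k * exp (- inverse t) else 0)"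

lemma tendsto_flat_exp: "(flat_exp k \<longlongrightarrow> 0) (at 0)"
proof -
  have "((\<lambda>t::real. inverse t ^ k * exp (- inverse t)) \<longlongrightarrow> 0) (at_right 0)"
  proof -
    have "((\<lambda>x::real. x ^ k / exp x) \<longlongrightarrow> 0) at_top"
      by (rule tendsto_power_div_exp_0)
    from filterlim_compose[OF this filterlim_inverse_at_top_right] show ?thesis
      by (simp add: exp_minus divide_inverse)
  qed
  then have "(flat_exp k \<longlongrightarrow> 0) (at_right 0)"
    by (rule Lim_transform_eventually)
      (auto simp: flat_exp_def eventually_at_filter)
  moreover have "(flat_exp k \<longlongrightarrow> 0) (at_left 0)"
    by (rule tendsto_eventually) (auto simp: flat_exp_def eventually_at_filter)
  ultimately show ?thesis
    by (simp add: filterlim_at_split)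
qed

lemma flat_exp_deriv:
  "(flat_exp k has_real_derivative flat_exp (k + 2) t - real k * flat_exp (k + 1) t) (at t)"
proof (cases t "0::real" rule: linorder_cases)
  case less
  have "((\<lambda>_. 0) has_real_derivative 0) (at t)" by simp
  then have "(flat_exp k has_real_derivative 0) (at t)"
    by (rule has_field_derivative_transform_within_open[where S = "{..<0}"])
      (use less in \<open>auto simp: flat_exp_def\<close>)
  then show ?thesis using less by (simp add: flat_exp_def)
next
  case equal
  \<comment> \<open>Away from 0, dividing \<open>flat_exp k h\<close> by h gives
    \<open>flat_exp (Suc k) h\<close>, so the difference quotient at the origin stays in the
    family.\<close>
  have "((\<lambda>h. flat_exp k h / h) \<longlongrightarrow> 0) (at 0)"
    by (rule Lim_transform_eventually[OF tendsto_flat_exp[of "Suc k"]])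
      (auto simp: flat_exp_def eventually_at_filter divide_inverse)
  then show ?thesis using equal
    by (simp add: flat_exp_def has_field_derivative_iff)
next
  case greater
  have "((\<lambda>t. inverse t ^ k * exp (- inverse t)) has_real_derivative
      inverse t ^ (k + 2) * exp (- inverse t) - real k * (inverse t ^ (k + 1) * exp (- inverse t))) (at t)"
    using greater
    by (cases k) (auto intro!: derivative_eq_intros simp: power2_eq_square field_simps,
        metis One_nat_def power_eq_if)
  then have "(flat_exp k has_real_derivative
      inverse t ^ (k + 2) * exp (- inverse t) - real k * (inverse t ^ (k + 1) * exp (- inverse t))) (at t)"
    by (rule has_field_derivative_transform_within_open[where S = "{0<..}"])
      (use greater in \<open>auto simp: flat_exp_def\<close>)
  then show ?thesis using greater by (simp add: flat_exp_def)
qed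

lemma smooth_on_flat_exp:
  assumes "open U" "smooth_on U f"
  shows "smooth_on U (\<lambda>x. flat_exp 0 (f x))"
proof -
  \<comment> \<open>Differentiation raises k, so k must stay arbitrary in the induction on
    n.\<close>
  have "Ck_on n U (\<lambda>x. flat_exp k (f x))" for n k
  proof (induction n arbitrary: k)
    case 0
    have "continuous_on UNIV (flat_exp k)"
      by (intro continuous_at_imp_continuous_on ballI DERIV_isCont[OF flat_exp_deriv])
    then show ?case
      using continuous_on_compose2[OF _ smooth_on_continuous[OF assms(2)], of UNIV "flat_exp k"] by simp
  next
    case (Suc n)
    show ?case
    proof (rule Ck_on_real_comp[OF assms(1) flat_exp_deriv smooth_onD[OF assms(2)]])
      have "Ck_on n U (\<lambda>x. flat_exp (k + 2) (f x) + (- real k) * flat_exp (k + 1) (f x))"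
        by (intro Ck_on_add Ck_on_bilinear[OF _ bounded_bilinear_mult] Suc.IH assms(1) Ck_on_const)
      then show "Ck_on n U (\<lambda>x. flat_exp (k + 2) (f x) - real k * flat_exp (k + 1) (f x))"
        by simp
    qed
  qed
  then show ?thesis by (simp add: smooth_on_def)
qed

lemma smooth_on_id: "smooth_on U (\<lambda>x. x)"
proof -
  have "Ck_on k U (\<lambda>x. x)" for k
    by (cases k) (auto simp: frechet_derivative_ident)
  then show ?thesis by (simp add: smooth_on_def)
qed

text \<open>The function exp(-1/(r^2 - |x - y|^2)) on the ball, zero outside. The squared distance
  is written as a polynomial in the coordinates, from which smoothness can be read off.\<close>

definition bump :: "real^3 \<Rightarrow> real \<Rightarrow> real^3 \<Rightarrow> real" where
  "bump y r x = flat_exp 0 (r\<^sup>2 - (\<Sum>i\<in>UNIV. (x $ i - y $ i) * (x $ i - y $ i)))"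

lemma smooth_on_bump: "smooth_on UNIV (bump y r)"
  unfolding bump_def
  by (intro smooth_on_flat_exp smooth_on_diff smooth_on_sum smooth_on_mult smooth_on_nth
      smooth_on_id smooth_on_const open_UNIV)

lemma bump_pos_iff:
  assumes "r > 0" shows "bump y r x > 0 \<longleftrightarrow> x \<in> ball y r"
proof -
  have "(\<Sum>i\<in>UNIV. (x $ i - y $ i) * (x $ i - y $ i)) = (dist y x)\<^sup>2"
    by (subst dist_commute) (simp add: dist_norm norm_eq_sqrt_inner inner_vec_def sum_nonneg)
  moreover have "dist y x < r \<longleftrightarrow> (dist y x)\<^sup>2 < r\<^sup>2"
    using assms by (metis abs_le_square_iff abs_of_nonneg abs_of_pos not_le zero_le_dist)
  ultimately show ?thesis
    by (simp add: bump_def flat_exp_def)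
qed

lemma bump_nonneg: "bump y r x \<ge> 0"
  by (simp add: bump_def flat_exp_def)

section \<open>Smooth functions in charts\<close>

locale vacuum_spin =
  fixes S :: "'a::{second_countable_topology, t2_space} spin_data"
  assumes vacuum: "vacuum_spin_data S"
begin

lemma initial_data: "initial_data_set S"
  and spin_structure: "spinor_structure S"
  and spin_connection: "spinor_connection S"
  using vacuum by (auto simp: vacuum_spin_data_def)

lemma atlas_smooth: "smooth_atlas (atlas S)"
  using initial_data by (simp add: initial_data_set_def)

lemma ex_chart: "\<exists>c\<in>atlas S. p \<in> fst c"
  using atlas_smooth by (auto simp: smooth_atlas_def)

lemma chart_at: "chart_at S p \<in> atlas S" "p \<in> fst (chart_at S p)"
proof -
  have "\<exists>c. c \<in> atlas S \<and> p \<in> fst c" using ex_chart by blast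
  from someI_ex[OF this] show "chart_at S p \<in> atlas S" "p \<in> fst (chart_at S p)"
    unfolding chart_at_def by blast+
qed

end

definition smooth_fun :: "'a spin_data \<Rightarrow> ('a \<Rightarrow> 'b::real_normed_vector) \<Rightarrow> bool" where
  "smooth_fun S f \<longleftrightarrow> (\<forall>c\<in>atlas S. smooth_in_chart c f)"

locale chart_of = vacuum_spin S for S :: "'a::{second_countable_topology, t2_space} spin_data" +
  fixes c :: "'a chart"
  assumes c_atlas: "c \<in> atlas S"
begin

abbreviation "U \<equiv> snd c ` fst c"

lemma open_dom: "open (fst c)" and open_U: "open U"
  and homeo: "homeomorphism (fst c) U (snd c) (chart_inv c)"
  using atlas_smooth c_atlas by (auto simp: smooth_atlas_def)

lemma inv_chart [simp]: "p \<in> fst c \<Longrightarrow> chart_inv c (snd c p) = p"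
  using homeo by (auto simp: homeomorphism_def)

lemma inv_in [simp]: "x \<in> U \<Longrightarrow> chart_inv c x \<in> fst c"
  using homeo by (auto simp: homeomorphism_def)

lemma open_image:
  assumes "open W" shows "open (snd c ` (W \<inter> fst c))"
proof -
  have "openin (top_of_set U) (snd c ` (W \<inter> fst c))"
    using assms by (intro homeomorphism_imp_open_map[OF homeo]) (auto simp: openin_open)
  then show ?thesis using open_U openin_open_trans by blast
qed

lemma smooth_cong:
  assumes "smooth_in_chart c f" "\<And>p. p \<in> fst c \<Longrightarrow> f p = g p"
  shows "smooth_in_chart c g"
  using assms unfolding smooth_in_chart_def
  by (elim smooth_on_cong[OF open_U, rotated]) (auto simp: o_def)

text \<open>The local model g may change with p. This suits functions extended by zero, whose
  defining formula is smooth on only a part of the chart.\<close>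

lemma smooth_local:
  assumes "\<And>p. p \<in> fst c \<Longrightarrow> \<exists>W g. open W \<and> p \<in> W \<and>
      smooth_on (snd c ` (W \<inter> fst c)) (g \<circ> chart_inv c) \<and> (\<forall>q\<in>W. f q = g q)"
  shows "smooth_in_chart c f"
  unfolding smooth_in_chart_def
proof (rule smooth_on_local)
  fix x assume "x \<in> U"
  then obtain p where p: "p \<in> fst c" "x = snd c p" by auto
  obtain W g where W: "open W" "p \<in> W" "smooth_on (snd c ` (W \<inter> fst c)) (g \<circ> chart_inv c)"
    "\<forall>q\<in>W. f q = g q" using assms[OF p(1)] by blast
  have "smooth_on (snd c ` (W \<inter> fst c)) (f \<circ> chart_inv c)"
    by (rule smooth_on_cong[OF open_image[OF W(1)] _ W(3)]) (use W(4) in auto)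
  then show "\<exists>V. open V \<and> x \<in> V \<and> smooth_on V (f \<circ> chart_inv c)"
    using open_image[OF W(1)] W(2) p by blast
qed

lemma smooth_restrict:
  "smooth_in_chart c g \<Longrightarrow> smooth_on (snd c ` (W \<inter> fst c)) (g \<circ> chart_inv c)"
  unfolding smooth_in_chart_def by (erule smooth_on_subset) auto

lemma smooth_const [simp]: "smooth_in_chart c (\<lambda>p. k)"
  by (simp add: smooth_in_chart_def o_def)

lemma smooth_add: "smooth_in_chart c f \<Longrightarrow> smooth_in_chart c g \<Longrightarrow> smooth_in_chart c (\<lambda>p. f p + g p)"
  and smooth_diff: "smooth_in_chart c f \<Longrightarrow> smooth_in_chart c g \<Longrightarrow> smooth_in_chart c (\<lambda>p. f p - g p)"
  and smooth_minus: "smooth_in_chart c f \<Longrightarrow> smooth_in_chart c (\<lambda>p. - f p)"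
  using smooth_on_add[OF open_U, of "f \<circ> chart_inv c" "g \<circ> chart_inv c"]
    smooth_on_diff[OF open_U, of "f \<circ> chart_inv c" "g \<circ> chart_inv c"]
    smooth_on_minus[OF open_U, of "f \<circ> chart_inv c"]
  by (auto simp: smooth_in_chart_def o_def)

lemma smooth_mult:
  fixes f g :: "'a \<Rightarrow> 'b::real_normed_algebra"
  shows "smooth_in_chart c f \<Longrightarrow> smooth_in_chart c g \<Longrightarrow> smooth_in_chart c (\<lambda>p. f p * g p)"
  using smooth_on_mult[OF open_U, of "f \<circ> chart_inv c" "g \<circ> chart_inv c"]
  by (simp add: smooth_in_chart_def o_def)

lemma smooth_divide_const:
  fixes f :: "'a \<Rightarrow> 'b::real_normed_field"
  shows "smooth_in_chart c f \<Longrightarrow> smooth_in_chart c (\<lambda>p. f p / k)"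
  using smooth_mult[of f "\<lambda>_. inverse k"] by (simp add: divide_inverse)

lemma smooth_sum: "(\<And>i. i \<in> I \<Longrightarrow> smooth_in_chart c (f i)) \<Longrightarrow> smooth_in_chart c (\<lambda>p. \<Sum>i\<in>I. f i p)"
  using smooth_on_sum[OF open_U, of I "\<lambda>i. f i \<circ> chart_inv c"] by (simp add: smooth_in_chart_def o_def)

lemma smooth_prod:
  fixes f :: "_ \<Rightarrow> 'a \<Rightarrow> 'b::real_normed_field"
  shows "(\<And>i. i \<in> I \<Longrightarrow> smooth_in_chart c (f i)) \<Longrightarrow> smooth_in_chart c (\<lambda>p. \<Prod>i\<in>I. f i p)"
  using smooth_on_prod[OF open_U, of I "\<lambda>i. f i \<circ> chart_inv c"] by (simp add: smooth_in_chart_def o_def)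

lemma smooth_cnj: "smooth_in_chart c f \<Longrightarrow> smooth_in_chart c (\<lambda>p. cnj (f p))"
  using smooth_on_cnj[OF open_U, of "f \<circ> chart_inv c"] by (simp add: smooth_in_chart_def o_def)

lemma smooth_of_real: "smooth_in_chart c f \<Longrightarrow> smooth_in_chart c (\<lambda>p. complex_of_real (f p))"
  using smooth_on_of_real[OF open_U, of "f \<circ> chart_inv c"] by (simp add: smooth_in_chart_def o_def)

lemma smooth_nth: "smooth_in_chart c f \<Longrightarrow> smooth_in_chart c (\<lambda>p. f p $ i)"
  using smooth_on_nth[OF open_U, of "f \<circ> chart_inv c"] by (simp add: smooth_in_chart_def o_def)

lemma smooth_sqrt:
  fixes f :: "'a \<Rightarrow> real"
  shows "smooth_in_chart c f \<Longrightarrow> (\<And>p. p \<in> fst c \<Longrightarrow> f p > 0) \<Longrightarrow> smooth_in_chart c (\<lambda>p. sqrt (f p))"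
  using smooth_on_sqrt[OF open_U, of "f \<circ> chart_inv c"] by (simp add: smooth_in_chart_def o_def)

lemma smooth_chart_deriv: "smooth_in_chart c f \<Longrightarrow> smooth_in_chart c (chart_deriv c i f)"
  unfolding smooth_in_chart_def
  by (rule smooth_on_cong[OF open_U _ smooth_on_partial[of U "f \<circ> chart_inv c" i]])
    (auto simp: chart_deriv_def)

lemma smooth_continuous: "smooth_in_chart c f \<Longrightarrow> continuous_on (fst c) f"
proof -
  assume "smooth_in_chart c f"
  then have "continuous_on U (f \<circ> chart_inv c)"
    by (simp only: smooth_in_chart_def smooth_on_continuous)
  then have "continuous_on (fst c) ((f \<circ> chart_inv c) \<circ> snd c)"
    by (rule continuous_on_compose[OF homeomorphism_cont1[OF homeo]])
  then show ?thesis by (rule continuous_on_eq) simp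
qed

section \<open>Calculus rules for coordinate derivatives\<close>

lemma chart_has_derivative:
  assumes "smooth_in_chart c f" "p \<in> fst c"
  shows "((\<lambda>x. f (chart_inv c x)) has_derivative
    frechet_derivative (f \<circ> chart_inv c) (at (snd c p))) (at (snd c p))"
  using assms smooth_on_differentiable[of U "f \<circ> chart_inv c" "snd c p"]
  by (simp add: smooth_in_chart_def frechet_derivative_works o_def)

lemma chart_deriv_eqI:
  "((\<lambda>x. f (chart_inv c x)) has_derivative D) (at (snd c p)) \<Longrightarrow> chart_deriv c i f p = D (axis i 1)"
  using frechet_derivative_at[of "f \<circ> chart_inv c" D "snd c p"] by (simp add: chart_deriv_def o_def)

lemma chart_deriv_cong:
  assumes "open W" "p \<in> W" "p \<in> fst c" "\<And>q. q \<in> W \<Longrightarrow> q \<in> fst c \<Longrightarrow> f q = g q"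
  shows "chart_deriv c i f p = chart_deriv c i g p"
proof -
  have "frechet_derivative (f \<circ> chart_inv c) (at (snd c p)) =
      frechet_derivative (g \<circ> chart_inv c) (at (snd c p))"
    by (rule frechet_derivative_cong_open[OF open_image[OF assms(1)]]) (use assms in auto)
  then show ?thesis by (simp add: chart_deriv_def)
qed

lemma chart_deriv_const: "chart_deriv c i (\<lambda>p. k) p = 0"
  using chart_deriv_eqI[of "\<lambda>p. k" "\<lambda>_. 0"] by simp

lemma chart_deriv_add:
  assumes "smooth_in_chart c f" "smooth_in_chart c g" "p \<in> fst c"
  shows "chart_deriv c i (\<lambda>q. f q + g q) p = chart_deriv c i f p + chart_deriv c i g p"
  using chart_deriv_eqI[of "\<lambda>q. f q + g q", OF
      has_derivative_add[OF chart_has_derivative[OF assms(1,3)] chart_has_derivative[OF assms(2,3)]]]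
  by (simp add: chart_deriv_def)

lemma chart_deriv_mult:
  fixes f g :: "'a \<Rightarrow> 'b::real_normed_algebra"
  assumes "smooth_in_chart c f" "smooth_in_chart c g" "p \<in> fst c"
  shows "chart_deriv c i (\<lambda>q. f q * g q) p = f p * chart_deriv c i g p + chart_deriv c i f p * g p"
  using chart_deriv_eqI[of "\<lambda>q. f q * g q", OF
      has_derivative_mult[OF chart_has_derivative[OF assms(1,3)] chart_has_derivative[OF assms(2,3)]]]
  by (simp add: chart_deriv_def assms)

lemma chart_deriv_bounded_linear:
  assumes "bounded_linear L" "smooth_in_chart c f" "p \<in> fst c"
  shows "chart_deriv c i (\<lambda>q. L (f q)) p = L (chart_deriv c i f p)"
  using chart_deriv_eqI[of "\<lambda>q. L (f q)", OF
      bounded_linear.has_derivative[OF assms(1) chart_has_derivative[OF assms(2,3)]]]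
  by (simp add: chart_deriv_def)

lemmas chart_deriv_minus = chart_deriv_bounded_linear[OF bounded_linear_minus[OF bounded_linear_ident]]
lemmas chart_deriv_cnj = chart_deriv_bounded_linear[OF bounded_linear_cnj]
lemmas chart_deriv_of_real = chart_deriv_bounded_linear[OF bounded_linear_of_real]

lemma chart_deriv_cmult:
  fixes f :: "'a \<Rightarrow> 'b::real_normed_algebra"
  shows "smooth_in_chart c f \<Longrightarrow> p \<in> fst c \<Longrightarrow>
    chart_deriv c i (\<lambda>q. k * f q) p = k * chart_deriv c i f p"
  using chart_deriv_bounded_linear[OF bounded_linear_mult_right[of k]] .

lemma chart_deriv_sum:
  assumes "\<And>j. j \<in> I \<Longrightarrow> smooth_in_chart c (f j)" "p \<in> fst c"
  shows "chart_deriv c i (\<lambda>q. \<Sum>j\<in>I. f j q) p = (\<Sum>j\<in>I. chart_deriv c i (f j) p)"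
  using assms(1)
  by (induction I rule: infinite_finite_induct)
    (auto simp: chart_deriv_const chart_deriv_add smooth_sum assms(2))

lemma chart_deriv_prod:
  fixes f :: "_ \<Rightarrow> 'a \<Rightarrow> 'b::real_normed_field"
  assumes "finite I" "\<And>j. j \<in> I \<Longrightarrow> smooth_in_chart c (f j)" "p \<in> fst c"
  shows "chart_deriv c i (\<lambda>q. \<Prod>j\<in>I. f j q) p =
    (\<Sum>j\<in>I. chart_deriv c i (f j) p * (\<Prod>k\<in>I - {j}. f k p))"
  using assms(1,2)
proof (induction I rule: finite_induct)
  case (insert j I)
  have "(\<Prod>k\<in>insert j I - {l}. f k p) = f j p * (\<Prod>k\<in>I - {l}. f k p)" if "l \<in> I" for l
    using insert that by (subst insert_Diff_if) (auto simp: insert_Diff_if)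
  then have "(\<Sum>l\<in>I. chart_deriv c i (f l) p * (\<Prod>k\<in>insert j I - {l}. f k p))
      = f j p * (\<Sum>l\<in>I. chart_deriv c i (f l) p * (\<Prod>k\<in>I - {l}. f k p))"
    by (simp add: sum_distrib_left mult_ac)
  moreover have "insert j I - {j} = I" using insert by auto
  ultimately show ?case
    using insert by (simp add: chart_deriv_mult smooth_prod assms(3) add.commute)
qed (simp add: chart_deriv_const)

end

locale two_charts = chart_of S c + c': chart_of S c' for S :: "'a::{second_countable_topology, t2_space} spin_data"
  and c c' :: "'a chart"
begin

lemma smooth_transition: "smooth_on (snd c' ` (fst c' \<inter> fst c)) (snd c \<circ> chart_inv c')"
  using atlas_smooth c_atlas c'.c_atlas by (simp add: smooth_atlas_def)

text \<open>The chain rule for the transition map, whose partial derivatives are the entries of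
  \<open>jac c c'\<close>.\<close>

lemma chart_deriv_change:
  assumes "smooth_in_chart c f" "p \<in> fst c" "p \<in> fst c'"
  shows "chart_deriv c' i f p = (\<Sum>k\<in>UNIV. jac c c' p k i *\<^sub>R chart_deriv c k f p)"
proof -
  let ?V = "snd c' ` (fst c \<inter> fst c')"
  let ?g = "snd c \<circ> chart_inv c'"
  have V: "open ?V" using c'.open_image[OF open_dom] .
  have x: "snd c' p \<in> ?V" using assms by auto
  have g: "?g differentiable at (snd c' p)"
    using smooth_on_differentiable[OF smooth_transition] x by (simp add: Int_commute)
  have gp: "?g (snd c' p) = snd c p" using assms by simp
  have f: "(f \<circ> chart_inv c) differentiable at (?g (snd c' p))"
    using chart_has_derivative[OF assms(1,2)] gp by (auto simp: differentiable_def o_def)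
  have D: "((\<lambda>x. (f \<circ> chart_inv c) (?g x)) has_derivative (\<lambda>v. \<Sum>j\<in>UNIV.
      (frechet_derivative ?g (at (snd c' p)) v $ j) *\<^sub>R
        frechet_derivative (f \<circ> chart_inv c) (at (?g (snd c' p))) (axis j 1))) (at (snd c' p))"
    by (rule has_derivative_compose_partial[OF f g])
  have "((\<lambda>x. f (chart_inv c' x)) has_derivative (\<lambda>v. \<Sum>j\<in>UNIV.
      (frechet_derivative ?g (at (snd c' p)) v $ j) *\<^sub>R
        frechet_derivative (f \<circ> chart_inv c) (at (?g (snd c' p))) (axis j 1))) (at (snd c' p))"
    by (rule has_derivative_transform_within_open[OF D V x]) auto
  from c'.chart_deriv_eqI[OF this]
  have "chart_deriv c' i f p = (\<Sum>j\<in>UNIV. (frechet_derivative ?g (at (snd c' p)) (axis i 1) $ j) *\<^sub>R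
        chart_deriv c j f p)"
    by (simp add: chart_deriv_def assms)
  moreover have "jac c c' p k i = frechet_derivative ?g (at (snd c' p)) (axis i 1) $ k" for k
  proof -
    have "(\<lambda>x. ?g x $ k) = (\<lambda>q. snd c q $ k) \<circ> chart_inv c'" by auto
    then show ?thesis
      using frechet_derivative_at[OF bounded_linear.has_derivative[OF bounded_linear_vec_nth[of k]
          g[unfolded frechet_derivative_works]]]
      unfolding jac_def chart_deriv_def by metis
  qed
  ultimately show ?thesis by simp
qed

end

context vacuum_spin
begin

lemma chart_of_atlas: "c \<in> atlas S \<Longrightarrow> chart_of S c"
  by (simp add: chart_of_def chart_of_axioms_def vacuum_spin_axioms)

lemma smooth_fun_continuous: "smooth_fun S f \<Longrightarrow> continuous_on UNIV f"
proof -
  assume f: "smooth_fun S f"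
  have "isCont f p" for p
  proof -
    interpret chart_of S "chart_at S p" by (rule chart_of_atlas[OF chart_at(1)])
    have "continuous_on (fst (chart_at S p)) f"
      using f c_atlas by (intro smooth_continuous) (auto simp: smooth_fun_def)
    then show ?thesis using open_dom chart_at by (simp add: continuous_on_eq_continuous_at)
  qed
  then show ?thesis by (simp add: continuous_at_imp_continuous_on)
qed

text \<open>A Euclidean bump is pulled back by the chart c and extended by zero. In another chart it
  is smooth at points of the domain of c through the transition map. At other points the complement
  of K is a neighbourhood where it vanishes: K is compact in a Hausdorff space, hence
  closed.\<close>

lemma bump_exists:
  assumes "open W" "p \<in> W" "c \<in> atlas S" "p \<in> fst c"
  shows "\<exists>(f::'a \<Rightarrow> real) K. smooth_fun S f \<and> (\<forall>q. f q \<ge> 0) \<and> f p > 0 \<and> compact K \<and>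
    K \<subseteq> W \<inter> fst c \<and> (\<forall>q. q \<notin> K \<longrightarrow> f q = 0)"
proof -
  interpret chart_of S c using assms(3) by (rule chart_of_atlas)
  obtain r where r: "r > 0" "cball (snd c p) r \<subseteq> snd c ` (W \<inter> fst c)"
    using open_image[OF assms(1)] assms unfolding open_contains_cball by (metis IntI imageI)
  define f where "f q = (if q \<in> fst c then bump (snd c p) r (snd c q) else 0)" for q
  define K where "K = chart_inv c ` cball (snd c p) r"
  have sub: "cball (snd c p) r \<subseteq> U" using r by auto
  have "compact K"
    unfolding K_def using homeo sub
    by (intro compact_continuous_image) (auto simp: homeomorphism_def intro: continuous_on_subset)
  have K: "K \<subseteq> W \<inter> fst c" using r(2) by (force simp: K_def)
  have f0: "f q = 0" if "q \<notin> K" for q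
  proof (cases "q \<in> fst c")
    case True
    have "snd c q \<notin> cball (snd c p) r"
      using that True inv_chart[OF True] unfolding K_def by (metis imageI)
    then have "\<not> bump (snd c p) r (snd c q) > 0" by (simp add: bump_pos_iff r(1))
    then show ?thesis using bump_nonneg[of "snd c p" r "snd c q"] by (simp add: f_def)
  qed (simp add: f_def)
  have "smooth_in_chart c' f" if c': "c' \<in> atlas S" for c'
  proof -
    interpret c': chart_of S c' using c' by (rule chart_of_atlas)
    interpret two_charts S c c' by unfold_locales
    show ?thesis
    proof (rule c'.smooth_local)
      fix q assume q: "q \<in> fst c'"
      show "\<exists>W g. open W \<and> q \<in> W \<and> smooth_on (snd c' ` (W \<inter> fst c')) (g \<circ> chart_inv c') \<and>
          (\<forall>q\<in>W. f q = g q)"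
      proof (cases "q \<in> fst c")
        case True
        have "smooth_on (snd c' ` (fst c \<inter> fst c'))
            (\<lambda>x. bump (snd c p) r ((snd c \<circ> chart_inv c') x))"
          using c'.open_image[OF open_dom] smooth_transition
          by (intro smooth_on_compose[OF _ _ _ smooth_on_bump]) (auto simp: Int_commute o_def)
        then have "smooth_on (snd c' ` (fst c \<inter> fst c'))
            ((\<lambda>q. bump (snd c p) r (snd c q)) \<circ> chart_inv c')"
          by (simp add: o_def)
        then show ?thesis using open_dom True by (auto simp: f_def)
      next
        case False
        then have "q \<in> - K" using K by auto
        moreover have "open (- K)" using \<open>compact K\<close> by (simp add: compact_imp_closed open_Compl)
        ultimately show ?thesis
          using f0 by (intro exI[of _ "- K"] exI[of _ "\<lambda>_. 0"]) (auto simp: o_def)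
      qed
    qed
  qed
  then have "smooth_fun S f" by (simp add: smooth_fun_def)
  moreover have "f p > 0" using assms r(1) by (simp add: f_def bump_pos_iff)
  moreover have "f q \<ge> 0" for q by (simp add: f_def bump_nonneg)
  ultimately show ?thesis using \<open>compact K\<close> K f0 by blast
qed

end

section \<open>Spinor algebra\<close>

lemma eps_simps [simp]: "eps 1 1 = 0" "eps 1 2 = 1" "eps 2 1 = -1" "eps 2 2 = 0"
  by (simp_all add: eps_def)

lemma cnj_eps [simp]: "cnj (eps A B) = eps A B"
  by (simp add: eps_def)

lemma eps_antisym: "eps B A = - eps A B"
  by (simp add: eps_def)

lemma finite_index_lists [simp]: "finite {xs :: 2 list. length xs = n}"
  using finite_lists_length_eq[of "UNIV :: 2 set" n] by simp

lemma sum_index_lists_0 [simp]: "(\<Sum>xs | length xs = 0. f xs) = f []"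
  by simp

lemma sum_index_lists_Suc:
  "(\<Sum>xs :: 2 list | length xs = Suc n. f xs) = (\<Sum>A\<in>UNIV. \<Sum>xs | length xs = n. f (A # xs))"
proof -
  have "(\<Sum>A\<in>UNIV. \<Sum>xs | length xs = n. f (A # xs))
      = (\<Sum>(A, xs)\<in>UNIV \<times> {xs :: 2 list. length xs = n}. f (A # xs))"
    by (simp add: sum.cartesian_product)
  also have "\<dots> = (\<Sum>xs :: 2 list | length xs = Suc n. f xs)"
    by (rule sum.reindex_bij_witness[where i = "\<lambda>xs. (hd xs, tl xs)" and j = "\<lambda>(A, xs). A # xs"])
      (auto simp: length_Suc_conv)
  finally show ?thesis by simp
qed

lemma sum_index_lists_2:
  "(\<Sum>xs :: 2 list | length xs = 2. f xs) = (\<Sum>A\<in>UNIV. \<Sum>B\<in>UNIV. f [A, B])"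
  by (simp add: numeral_2_eq_2 sum_index_lists_Suc del: length_0_conv)

lemma sum_index_lists_4:
  "(\<Sum>xs :: 2 list | length xs = 4. f xs)
    = (\<Sum>A\<in>UNIV. \<Sum>B\<in>UNIV. \<Sum>C\<in>UNIV. \<Sum>D\<in>UNIV. f [A, B, C, D])"
  by (simp add: numeral_eq_Suc sum_index_lists_Suc del: length_0_conv)

lemma sum_index_lists_prod:
  fixes g :: "nat \<Rightarrow> 2 \<Rightarrow> 'b::comm_semiring_1"
  shows "(\<Sum>ys | length ys = n. \<Prod>k<n. g k (ys ! k)) = (\<Prod>k<n. \<Sum>B\<in>UNIV. g k B)"
proof (induction n arbitrary: g)
  case (Suc n)
  have "(\<Sum>ys | length ys = Suc n. \<Prod>k<Suc n. g k (ys ! k))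
      = (\<Sum>A\<in>UNIV. g 0 A * (\<Sum>ys | length ys = n. \<Prod>k<n. g (Suc k) (ys ! k)))"
    by (simp only: sum_index_lists_Suc prod.lessThan_Suc_shift nth_Cons_0 nth_Cons_Suc sum_distrib_left)
  also have "\<dots> = (\<Prod>k<Suc n. \<Sum>B\<in>UNIV. g k B)"
    by (simp only: Suc.IH[of "\<lambda>k. g (Suc k)"] prod.lessThan_Suc_shift sum_distrib_right)
  finally show ?case .
qed simp

text \<open>Exchanging the k-th entry with the summed index Q is an involution on pairs of a list
  and an index. It turns a matrix acting on one index of t into its transpose acting on w, which is
  how connection terms cancel in a full contraction.\<close>

lemma sum_index_lists_transfer:
  fixes t w :: "2 list \<Rightarrow> complex"
  assumes "k < n"
  shows "(\<Sum>xs | length xs = n. (\<Sum>Q\<in>UNIV. g (xs ! k) Q * t (xs[k := Q])) * w xs)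
       = (\<Sum>xs | length xs = n. t xs * (\<Sum>Q\<in>UNIV. g Q (xs ! k) * w (xs[k := Q])))"
proof -
  have "(\<Sum>(xs, Q)\<in>{xs. length xs = n} \<times> UNIV. g (xs ! k) Q * t (xs[k := Q]) * w xs)
      = (\<Sum>(xs, Q)\<in>{xs. length xs = n} \<times> UNIV. t xs * (g Q (xs ! k) * w (xs[k := Q])))"
    by (rule sum.reindex_bij_witness[where i = "\<lambda>(xs, Q). (xs[k := Q], xs ! k)"
        and j = "\<lambda>(xs, Q). (xs[k := Q], xs ! k)"]) (use assms in auto)
  then show ?thesis
    by (simp add: sum.cartesian_product sum_distrib_left sum_distrib_right)
qed

text \<open>This is tau^{AE'}, the matrix that contracts each index of one field with a conjugate
  index of the other in the Hermitian pairings.\<close>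

definition herm_form :: "'a spin_data \<Rightarrow> 'a \<Rightarrow> 2 \<Rightarrow> 2 \<Rightarrow> complex" where
  "herm_form S p A E = (\<Sum>B\<in>UNIV. eps A B * normal_up S p B E)"

lemma raise_hat:
  assumes "length xs = n"
  shows "raise n (hat S \<phi>) xs p =
    (\<Sum>zs | length zs = n. (\<Prod>k<n. herm_form S p (xs ! k) (zs ! k)) * cnj (\<phi> zs p))"
proof -
  have "raise n (hat S \<phi>) xs p = (\<Sum>ys | length ys = n. \<Sum>zs | length zs = n.
      (\<Prod>k<n. eps (xs ! k) (ys ! k) * normal_up S p (ys ! k) (zs ! k)) * cnj (\<phi> zs p))"
    using assms by (auto simp: raise_def hat_def sum_distrib_left prod.distrib mult.assoc intro!: sum.cong)
  also have "\<dots> = (\<Sum>zs | length zs = n. (\<Sum>ys | length ys = n.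
      (\<Prod>k<n. eps (xs ! k) (ys ! k) * normal_up S p (ys ! k) (zs ! k))) * cnj (\<phi> zs p))"
    by (subst sum.swap) (simp add: sum_distrib_right)
  finally show ?thesis
    by (simp add: sum_index_lists_prod[where g = "\<lambda>k B. eps (xs ! k) B * normal_up S p B (_ ! k)"]
        herm_form_def)
qed

section \<open>Algebra of the normal spinor\<close>

context vacuum_spin
begin

lemma normal_cnj: "cnj (normal S p A E) = normal S p E A"
  using spin_structure by (simp add: spinor_structure_def)

text \<open>For two-valued indices the full contraction of tau with itself is twice its determinant,
  so the normalisation to 2 becomes determinant 1. The contraction identities below are 2 by 2
  consequences of this equation, checked entry by entry.\<close>

lemma normal_det: "normal S p 1 1 * normal S p 2 2 - normal S p 1 2 * normal S p 2 1 = 1"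
proof -
  have "(\<Sum>A\<in>UNIV. \<Sum>E\<in>UNIV. \<Sum>B\<in>UNIV. \<Sum>F\<in>UNIV.
      normal S p A E * eps A B * eps E F * normal S p B F) = 2"
    using spin_structure by (simp add: spinor_structure_def)
  then have "2 * (normal S p 1 1 * normal S p 2 2 - normal S p 1 2 * normal S p 2 1) = 2 * 1"
    by (simp add: sum_2 algebra_simps)
  then show ?thesis by (metis mult_left_cancel zero_neq_numeral)
qed

lemma normal_up_simps:
  "normal_up S p A 1 = normal S p A 2" "normal_up S p A 2 = - normal S p A 1"
  by (simp_all add: normal_up_def sum_2)

lemma herm_form_simps:
  "herm_form S p 1 A = normal_up S p 2 A" "herm_form S p 2 A = - normal_up S p 1 A"
  by (simp_all add: herm_form_def sum_2)

lemma herm_form_cnj: "cnj (herm_form S p A E) = herm_form S p E A"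
proof -
  have "\<forall>A E. cnj (herm_form S p A E) = herm_form S p E A"
    by (simp add: forall_2 herm_form_simps normal_up_simps normal_cnj)
  then show ?thesis by blast
qed

lemma herm_form_inverse:
  "(\<Sum>A\<in>UNIV. normal S p A F * herm_form S p A E) = (if E = F then 1 else 0)"
proof -
  have "\<forall>E F. (\<Sum>A\<in>UNIV. normal S p A F * herm_form S p A E) = (if E = F then 1 else 0)"
    using normal_det[of p] by (simp add: forall_2 sum_2 herm_form_simps normal_up_simps algebra_simps)
  then show ?thesis by blast
qed

lemma normal_up_herm_form:
  "(\<Sum>A\<in>UNIV. normal_up S p A E * herm_form S p A F) = eps E F"
proof -
  have "\<forall>E F. (\<Sum>A\<in>UNIV. normal_up S p A E * herm_form S p A F) = eps E F"
    using normal_det[of p] by (simp add: forall_2 sum_2 herm_form_simps normal_up_simps algebra_simps)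
  then show ?thesis by blast
qed

lemma normal_up_normal: "(\<Sum>E\<in>UNIV. normal_up S p B E * normal S p A E) = eps A B"
proof -
  have "\<forall>A B. (\<Sum>E\<in>UNIV. normal_up S p B E * normal S p A E) = eps A B"
    using normal_det[of p] by (simp add: forall_2 sum_2 normal_up_simps algebra_simps)
  then show ?thesis by blast
qed

lemma normal_up_eps: "(\<Sum>E\<in>UNIV. \<Sum>F\<in>UNIV. normal_up S p B E * normal_up S p D F * eps E F) = eps B D"
proof -
  have "\<forall>B D. (\<Sum>E\<in>UNIV. \<Sum>F\<in>UNIV. normal_up S p B E * normal_up S p D F * eps E F) = eps B D"
    using normal_det[of p] by (simp add: forall_2 sum_2 normal_up_simps algebra_simps)
  then show ?thesis by blast
qed

text \<open>Hermitian conjugation squares to -1 on spinors of valence 1: it is a quaternionic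
  structure, not a real one.\<close>

lemma normal_up_cnj:
  "(\<Sum>F\<in>UNIV. normal_up S p A F * cnj (normal_up S p F G)) = (if A = G then -1 else 0)"
proof -
  have "\<forall>A G. (\<Sum>F\<in>UNIV. normal_up S p A F * cnj (normal_up S p F G)) = (if A = G then -1 else 0)"
    using normal_det[of p] by (simp add: forall_2 sum_2 normal_up_simps normal_cnj algebra_simps)
  then show ?thesis by blast
qed

end

lemma solder_sym: "solder S c p a B A = solder S c p a A B"
  by (simp add: solder_def add.commute)

context chart_of
begin

lemma smooth_normal: "smooth_in_chart c (\<lambda>p. normal S p A E)"
  using spin_structure c_atlas by (simp add: spinor_structure_def)

lemma smooth_normal_up: "smooth_in_chart c (\<lambda>p. normal_up S p A E)"
  unfolding normal_up_def by (intro smooth_sum smooth_mult smooth_normal smooth_const)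

lemma smooth_herm_form: "smooth_in_chart c (\<lambda>p. herm_form S p A E)"
  unfolding herm_form_def by (intro smooth_sum smooth_mult smooth_normal_up smooth_const)

lemma smooth_ivdw: "smooth_in_chart c (\<lambda>p. ivdw S c p a A E)"
  using spin_structure c_atlas by (simp add: spinor_structure_def complex_vector_field_def)

lemma ivdw_cnj: "p \<in> fst c \<Longrightarrow> cnj (ivdw S c p a A E) = ivdw S c p a E A"
  using spin_structure c_atlas by (simp add: spinor_structure_def)

lemma ivdw_metric: "p \<in> fst c \<Longrightarrow>
    (\<Sum>a\<in>UNIV. \<Sum>b\<in>UNIV. of_real (metric S c p $ a $ b) * ivdw S c p a A E * ivdw S c p b B F)
    + normal S p A E * normal S p B F / 2 = eps A B * eps E F"
  using spin_structure c_atlas unfolding spinor_structure_def by blast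

lemma smooth_solder: "smooth_in_chart c (\<lambda>p. solder S c p a A B)"
  unfolding solder_def
  by (intro smooth_divide_const smooth_sum smooth_add smooth_mult smooth_normal_up smooth_ivdw)

lemma smooth_conn: "smooth_in_chart c (\<lambda>p. conn S c p a C Q)"
  using spin_connection c_atlas by (simp add: spinor_connection_def complex_covector_field_def)

lemma smooth_extr: "smooth_in_chart c (\<lambda>p. extr S c p $ a $ b)"
  using initial_data c_atlas
  by (intro smooth_nth) (simp add: initial_data_set_def covariant_2_tensor_def)

lemma smooth_metric: "smooth_in_chart c (\<lambda>p. metric S c p $ a $ b)"
  using initial_data c_atlas
  by (intro smooth_nth) (simp add: initial_data_set_def covariant_2_tensor_def)

lemma metric_sym: "p \<in> fst c \<Longrightarrow> metric S c p $ a $ b = metric S c p $ b $ a"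
proof -
  assume "p \<in> fst c"
  then have "transpose (metric S c p) = metric S c p"
    using initial_data c_atlas by (auto simp: initial_data_set_def)
  then have "transpose (metric S c p) $ b $ a = metric S c p $ b $ a" by simp
  then show ?thesis by (simp add: transpose_def)
qed

lemma extr_sym: "p \<in> fst c \<Longrightarrow> extr S c p $ a $ b = extr S c p $ b $ a"
proof -
  assume "p \<in> fst c"
  then have "transpose (extr S c p) = extr S c p"
    using initial_data c_atlas by (auto simp: initial_data_set_def)
  then have "transpose (extr S c p) $ b $ a = extr S c p $ b $ a" by simp
  then show ?thesis by (simp add: transpose_def)
qed

lemma solder_deriv: "p \<in> fst c \<Longrightarrow>
    chart_deriv c b (\<lambda>q. solder S c q a A B) p =
      - (\<Sum>d\<in>UNIV. of_real (christoffel S c p a b d) * solder S c p d A B)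
      + (\<Sum>Q\<in>UNIV. conn S c p b A Q * solder S c p a Q B)
      + (\<Sum>Q\<in>UNIV. conn S c p b B Q * solder S c p a A Q)"
  using spin_connection c_atlas unfolding spinor_connection_def
  by (auto simp: algebra_simps add_eq_0_iff2 eq_neg_iff_add_eq_0)

text \<open>Each of the two terms of the symmetrised product contains one conjugated factor tau,
  which meets an outer tau and gives -1 by \<open>normal_up_cnj\<close>. The other outer tau
  rebuilds the solder form, because \<open>ivdw\<close> is Hermitian.\<close>

lemma solder_hat:
  assumes "p \<in> fst c"
  shows "(\<Sum>E\<in>UNIV. \<Sum>F\<in>UNIV. normal_up S p A E * normal_up S p B F * cnj (solder S c p a E F))
    = - solder S c p a A B"
proof -
  let ?T = "normal_up S p" and ?v = "ivdw S c p a"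
  have "(\<Sum>E\<in>UNIV. \<Sum>F\<in>UNIV. ?T A E * ?T B F * cnj (solder S c p a E F))
    = (\<Sum>G\<in>UNIV. \<Sum>E\<in>UNIV. ?T A E * ?v G E * (\<Sum>F\<in>UNIV. ?T B F * cnj (?T F G))
       + ?T B E * ?v G E * (\<Sum>F\<in>UNIV. ?T A F * cnj (?T F G))) / 2"
    by (simp add: solder_def sum_2 ivdw_cnj assms algebra_simps add_divide_distrib)
  also have "\<dots> = - solder S c p a A B"
  proof -
    have "\<forall>A B. (\<Sum>G\<in>UNIV. \<Sum>E\<in>UNIV. ?T A E * ?v G E * (if B = G then -1 else 0)
       + ?T B E * ?v G E * (if A = G then -1 else 0)) / 2 = - solder S c p a A B"
      by (simp add: forall_2 solder_def sum_2 algebra_simps add_divide_distrib)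
    then show ?thesis by (simp only: normal_up_cnj)
  qed
  finally show ?thesis .
qed

text \<open>The normal part of the space-time metric contributes a multiple of eps_{AB} eps_{CD},
  which symmetrising over A and B removes. What remains is nondegenerate on symmetric spinors, so
  the three solder forms span them.\<close>

lemma solder_metric:
  assumes "p \<in> fst c"
  shows "(\<Sum>a\<in>UNIV. \<Sum>b\<in>UNIV. of_real (metric S c p $ a $ b) * solder S c p a A B * solder S c p b C D)
    = (eps A C * eps B D + eps A D * eps B C) / 2"
proof -
  let ?T = "normal_up S p"
  define H where "H A E B F = (\<Sum>a\<in>UNIV. \<Sum>b\<in>UNIV.
    of_real (metric S c p $ a $ b) * ivdw S c p a A E * ivdw S c p b B F)" for A E B F
  have H: "H A E B F = eps A B * eps E F - normal S p A E * normal S p B F / 2" for A E B F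
    using ivdw_metric[OF assms, of A E B F] by (simp add: H_def algebra_simps)
  have TH: "(\<Sum>E\<in>UNIV. \<Sum>F\<in>UNIV. ?T B E * ?T D F * H A E C F)
      = eps A C * eps B D - eps A B * eps C D / 2" for A B C D
  proof -
    have "(\<Sum>E\<in>UNIV. \<Sum>F\<in>UNIV. ?T B E * ?T D F * H A E C F)
        = eps A C * (\<Sum>E\<in>UNIV. \<Sum>F\<in>UNIV. ?T B E * ?T D F * eps E F)
          - (\<Sum>E\<in>UNIV. ?T B E * normal S p A E) * (\<Sum>F\<in>UNIV. ?T D F * normal S p C F) / 2"
      by (simp add: H sum_2 algebra_simps add_divide_distrib)
    then show ?thesis by (simp only: normal_up_normal normal_up_eps)
  qed
  have "(\<Sum>a\<in>UNIV. \<Sum>b\<in>UNIV. of_real (metric S c p $ a $ b) * solder S c p a A B * solder S c p b C D)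
    = ((\<Sum>E\<in>UNIV. \<Sum>F\<in>UNIV. ?T B E * ?T D F * H A E C F)
        + (\<Sum>E\<in>UNIV. \<Sum>F\<in>UNIV. ?T A E * ?T D F * H B E C F)
        + (\<Sum>E\<in>UNIV. \<Sum>F\<in>UNIV. ?T B E * ?T C F * H A E D F)
        + (\<Sum>E\<in>UNIV. \<Sum>F\<in>UNIV. ?T A E * ?T C F * H B E D F)) / 4"
    unfolding solder_def H_def by (simp add: sum_2 sum_3 field_simps)
  then show ?thesis
    by (simp only: TH) (simp add: eps_antisym[of B A] eps_antisym[of D C] field_simps)
qed

end

section \<open>Hermitian conjugation and the connection\<close>

context chart_of
begin

text \<open>Differentiating \<open>solder_hat\<close> constrains the covariant derivative \<open>N\<close> of $\tau_A{}^{E'}$, and as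
  the $\sigma^a{}_{AB}$ span the symmetric spinors, this forces \<open>N\<close> to vanish.\<close>

lemma normal_up_deriv:
  assumes p: "p \<in> fst c"
  shows "chart_deriv c b (\<lambda>q. normal_up S q A E) p =
    (\<Sum>Q\<in>UNIV. conn S c p b A Q * normal_up S p Q E)
    - (\<Sum>Q\<in>UNIV. cnj (conn S c p b Q E) * normal_up S p A Q)"
proof -
  let ?T = "normal_up S p" and ?g = "conn S c p b" and ?s = "solder S c p"
  define T' where "T' A E = chart_deriv c b (\<lambda>q. normal_up S q A E) p" for A E
  define N where "N A E = T' A E - (\<Sum>Q\<in>UNIV. ?g A Q * ?T Q E) + (\<Sum>Q\<in>UNIV. cnj (?g Q E) * ?T A Q)" for A E
  have sym: "?s a 2 1 = ?s a 1 2" for a by (rule solder_sym)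
  \<comment> \<open>The derivative of \<open>solder_hat\<close>, with \<open>solder_deriv\<close>
    inserted on both sides. Christoffel terms cancel because they act on a alone, and the connection
    terms are absorbed into N, the covariant derivative of the normal.\<close>
  have rel: "(\<Sum>E\<in>UNIV. \<Sum>F\<in>UNIV. (N A E * ?T B F + ?T A E * N B F) * cnj (?s a E F)) = 0" for A B a
  proof -
    define \<Gamma> where "\<Gamma> d = complex_of_real (christoffel S c p a b d)" for d
    have sm: "smooth_in_chart c (\<lambda>q. normal_up S q A E * normal_up S q B F * cnj (solder S c q a E F))" for A B E F
      by (intro smooth_mult smooth_normal_up smooth_cnj smooth_solder)
    have ds: "chart_deriv c b (\<lambda>q. solder S c q a A B) p =
      - (\<Sum>d\<in>UNIV. \<Gamma> d * ?s d A B) + (\<Sum>Q\<in>UNIV. ?g A Q * ?s a Q B) + (\<Sum>Q\<in>UNIV. ?g B Q * ?s a A Q)" for A B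
      using solder_deriv[OF p] by (simp add: \<Gamma>_def)
    have "chart_deriv c b (\<lambda>q. \<Sum>E\<in>UNIV. \<Sum>F\<in>UNIV.
        normal_up S q A E * normal_up S q B F * cnj (solder S c q a E F)) p =
      chart_deriv c b (\<lambda>q. - solder S c q a A B) p"
      by (rule chart_deriv_cong[of "fst c"]) (use open_dom p solder_hat in simp_all)
    then have "(\<Sum>E\<in>UNIV. \<Sum>F\<in>UNIV. (T' A E * ?T B F + ?T A E * T' B F) * cnj (?s a E F)
       + ?T A E * ?T B F * cnj (chart_deriv c b (\<lambda>q. solder S c q a E F) p))
       = - chart_deriv c b (\<lambda>q. solder S c q a A B) p"
      by (simp add: chart_deriv_sum smooth_sum sm p chart_deriv_mult smooth_mult smooth_normal_up
          smooth_cnj smooth_solder chart_deriv_cnj chart_deriv_minus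
          T'_def algebra_simps)
    then have eq: "(\<Sum>E\<in>UNIV. \<Sum>F\<in>UNIV. (T' A E * ?T B F + ?T A E * T' B F) * cnj (?s a E F)
       + ?T A E * ?T B F * cnj (chart_deriv c b (\<lambda>q. solder S c q a E F) p))
       + chart_deriv c b (\<lambda>q. solder S c q a A B) p = 0" by simp
    define X where "X d E F = cnj (?s d E F)" for d E F
    have s: "?s d A B = - (\<Sum>E\<in>UNIV. \<Sum>F\<in>UNIV. ?T A E * ?T B F * X d E F)" for d A B
      using solder_hat[OF p, of A B d] by (simp add: X_def)
    have cds: "cnj (chart_deriv c b (\<lambda>q. solder S c q a A B) p) = - (\<Sum>d\<in>UNIV. \<Gamma> d * X d A B)
      + (\<Sum>Q\<in>UNIV. cnj (?g A Q) * X a Q B) + (\<Sum>Q\<in>UNIV. cnj (?g B Q) * X a A Q)" for A B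
      by (simp add: ds X_def \<Gamma>_def)
    have "(\<Sum>E\<in>UNIV. \<Sum>F\<in>UNIV. (N A E * ?T B F + ?T A E * N B F) * X a E F)
      = (\<Sum>E\<in>UNIV. \<Sum>F\<in>UNIV. (T' A E * ?T B F + ?T A E * T' B F) * X a E F
       + ?T A E * ?T B F * (- (\<Sum>d\<in>UNIV. \<Gamma> d * X d E F)
      + (\<Sum>Q\<in>UNIV. cnj (?g E Q) * X a Q F) + (\<Sum>Q\<in>UNIV. cnj (?g F Q) * X a E Q)))
      + (- (\<Sum>d\<in>UNIV. \<Gamma> d * (- (\<Sum>E\<in>UNIV. \<Sum>F\<in>UNIV. ?T A E * ?T B F * X d E F)))
       + (\<Sum>Q\<in>UNIV. ?g A Q * (- (\<Sum>E\<in>UNIV. \<Sum>F\<in>UNIV. ?T Q E * ?T B F * X a E F)))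
       + (\<Sum>Q\<in>UNIV. ?g B Q * (- (\<Sum>E\<in>UNIV. \<Sum>F\<in>UNIV. ?T A E * ?T Q F * X a E F))))"
      by (simp add: N_def sum_2 sum_3 algebra_simps)
    also have "\<dots> = 0"
      using eq unfolding cds unfolding ds unfolding s[symmetric] X_def[symmetric] .
    finally show ?thesis by (simp add: X_def)
  qed
  \<comment> \<open>A form that annihilates every solder form has no symmetric part, because by
    \<open>solder_metric\<close> the solder forms span the symmetric spinors.\<close>
  have asym: "(N A E * ?T B F + ?T A E * N B F) + (N A F * ?T B E + ?T A F * N B E) = 0" for A B E F
  proof -
    define \<Lambda> where "\<Lambda> E F = N A E * ?T B F + ?T A E * N B F" for E F
    define X where "X d E F = cnj (?s d E F)" for d E F
    have gram: "(\<Sum>a\<in>UNIV. \<Sum>b\<in>UNIV. of_real (metric S c p $ a $ b) * X a E F * X b C D)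
      = (eps E C * eps F D + eps E D * eps F C) / 2" for E F C D
      using arg_cong[OF solder_metric[OF p, of E F C D], of cnj] by (simp add: X_def)
    have rel': "(\<Sum>E\<in>UNIV. \<Sum>F\<in>UNIV. \<Lambda> E F * X a E F) = 0" for a
      using rel by (simp add: \<Lambda>_def X_def)
    have "(\<Sum>E\<in>UNIV. \<Sum>F\<in>UNIV. \<Lambda> E F * (eps E C * eps F D + eps E D * eps F C)) = 0" for C D
    proof -
      have "(\<Sum>E\<in>UNIV. \<Sum>F\<in>UNIV. \<Lambda> E F *
          (\<Sum>a\<in>UNIV. \<Sum>b\<in>UNIV. of_real (metric S c p $ a $ b) * X a E F * X b C D))
        = (\<Sum>a\<in>UNIV. \<Sum>b\<in>UNIV. of_real (metric S c p $ a $ b) * X b C D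
            * (\<Sum>E\<in>UNIV. \<Sum>F\<in>UNIV. \<Lambda> E F * X a E F))"
        by (simp add: sum_2 sum_3 algebra_simps)
      then show ?thesis
        by (simp only: gram rel' times_divide_eq_right sum_divide_distrib[symmetric]) simp
    qed
    then have "\<forall>C D. (\<Sum>E\<in>UNIV. \<Sum>F\<in>UNIV. \<Lambda> E F * (eps E C * eps F D + eps E D * eps F C)) = 0"
      by blast
    then have "\<Lambda> 1 1 = 0 \<and> \<Lambda> 2 2 = 0 \<and> \<Lambda> 2 1 = - \<Lambda> 1 2"
      by (auto simp: forall_2 sum_2 algebra_simps)
    then have "\<forall>E F. \<Lambda> E F + \<Lambda> F E = 0"
      by (simp add: forall_2)
    then show ?thesis by (simp add: \<Lambda>_def)
  qed
  have "N A E = 0"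
  proof -
    \<comment> \<open>With B = A the relation says that the symmetric product of row A of N with row
      A of tau vanishes. The row of tau is nonzero, hence the row of N is zero.\<close>
    have row: "?T A 1 \<noteq> 0 \<or> ?T A 2 \<noteq> 0"
    proof (rule ccontr)
      assume "\<not> ?thesis"
      then have "eps A B = 0" for B
        using normal_up_eps[of p A B] by (simp add: sum_2)
      then show False using exhaust_2[of A] by (metis eps_simps(2,3) neg_equal_zero one_neq_zero zero_neq_neg_one)
    qed
    have "N A E * ?T A E = 0" for E
      using asym[of A E A E] by (simp add: algebra_simps)
    moreover have "N A 1 * ?T A 2 + ?T A 1 * N A 2 = 0"
      using asym[of A 1 A 2] by algebra
    ultimately have "N A 1 = 0 \<and> N A 2 = 0" using row by force
    then show ?thesis using exhaust_2[of E] by auto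
  qed
  then show ?thesis by (simp add: N_def T'_def algebra_simps)
qed

text \<open>Constancy of eps_{12} is the vanishing of the trace of the connection matrix: the
  connection takes values in sl(2,C).\<close>

lemma conn_trace:
  assumes "p \<in> fst c" shows "conn S c p a 2 2 = - conn S c p a 1 1"
proof -
  have "cov_deriv S c a (\<lambda>xs q. eps (xs ! 0) (xs ! 1)) [1, 2] p = 0"
    using spin_connection c_atlas assms unfolding spinor_connection_def by blast
  then show ?thesis
    by (auto simp: cov_deriv_def chart_deriv_const numeral_2_eq_2 sum_2 lessThan_Suc)
      (metis minus_minus)
qed

text \<open>Obtained from \<open>normal_up_deriv\<close> by raising the unprimed index. For a
  trace-free matrix, raising with eps replaces the action on a lower index by minus the transpose,
  so tau^{AE'} is parallel too.\<close>

lemma herm_form_deriv: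
  assumes "p \<in> fst c"
  shows "chart_deriv c b (\<lambda>q. herm_form S q A E) p =
    - (\<Sum>Q\<in>UNIV. conn S c p b Q A * herm_form S p Q E)
    - (\<Sum>Q\<in>UNIV. cnj (conn S c p b Q E) * herm_form S p A Q)"
proof -
  have "chart_deriv c b (\<lambda>q. herm_form S q A E) p
      = (\<Sum>B\<in>UNIV. eps A B * chart_deriv c b (\<lambda>q. normal_up S q B E) p)"
    unfolding herm_form_def using assms
    by (simp add: chart_deriv_sum chart_deriv_cmult smooth_mult smooth_normal_up)
  moreover have "\<forall>A E. (\<Sum>B\<in>UNIV. eps A B * chart_deriv c b (\<lambda>q. normal_up S q B E) p) =
    - (\<Sum>Q\<in>UNIV. conn S c p b Q A * herm_form S p Q E)
    - (\<Sum>Q\<in>UNIV. cnj (conn S c p b Q E) * herm_form S p A Q)"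
    unfolding forall_2 by (simp add: sum_2 normal_up_deriv herm_form_simps conn_trace assms algebra_simps)
  ultimately show ?thesis by metis
qed

lemma raise_hat_smooth:
  assumes "length xs = n" "\<And>zs. length zs = n \<Longrightarrow> smooth_in_chart c (\<zeta> zs)"
  shows "smooth_in_chart c (raise n (hat S \<zeta>) xs)"
proof -
  have "smooth_in_chart c (\<lambda>p. \<Sum>zs | length zs = n.
      (\<Prod>k<n. herm_form S p (xs ! k) (zs ! k)) * cnj (\<zeta> zs p))"
    by (intro smooth_sum smooth_mult smooth_prod smooth_herm_form smooth_cnj assms(2)) simp
  then show ?thesis by (simp add: raise_hat[OF assms(1), abs_def])
qed

text \<open>By the Leibniz rule each factor \<open>herm_form\<close> yields one connection term at
  its index in xs and one conjugate term at its index in zs. The former are those of an upper index;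
  the latter, moved over by \<open>sum_index_lists_transfer\<close>, complete the partial derivative
  of \<zeta> to a covariant one.\<close>

lemma raise_hat_deriv:
  assumes p: "p \<in> fst c" and xs: "length xs = n"
    and \<zeta>: "\<And>zs. length zs = n \<Longrightarrow> smooth_in_chart c (\<zeta> zs)"
  shows "chart_deriv c a (raise n (hat S \<zeta>) xs) p = raise n (hat S (cov_deriv S c a \<zeta>)) xs p
    - (\<Sum>k<n. \<Sum>Q\<in>UNIV. conn S c p a Q (xs ! k) * raise n (hat S \<zeta>) (xs[k := Q]) p)"
proof -
  let ?M = "herm_form S p" and ?g = "conn S c p a"
  define P where "P xs zs = (\<Prod>k<n. ?M (xs ! k) (zs ! k))" for xs zs :: "2 list"
  have upd: "P (xs[k := Q]) zs = ?M Q (zs ! k) * (\<Prod>j\<in>{..<n} - {k}. ?M (xs ! j) (zs ! j))"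
      "P xs (zs[k := Q]) = ?M (xs ! k) Q * (\<Prod>j\<in>{..<n} - {k}. ?M (xs ! j) (zs ! j))"
    if "k < n" "length zs = n" for k Q zs
    unfolding P_def using that xs by (auto simp: prod.remove[of "{..<n}" k] intro!: prod.cong)
  have w: "raise n (hat S \<zeta>) ys p = (\<Sum>zs | length zs = n. P ys zs * cnj (\<zeta> zs p))"
    if "length ys = n" for ys
    using raise_hat[OF that] by (simp add: P_def)
  have dM: "chart_deriv c a (\<lambda>q. \<Prod>k<n. herm_form S q (xs ! k) (zs ! k)) p
      = - (\<Sum>k<n. \<Sum>Q\<in>UNIV. ?g Q (xs ! k) * P (xs[k := Q]) zs)
        - (\<Sum>k<n. \<Sum>Q\<in>UNIV. cnj (?g Q (zs ! k)) * P xs (zs[k := Q]))"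
    if zs: "length zs = n" for zs
  proof -
    have "chart_deriv c a (\<lambda>q. \<Prod>k<n. herm_form S q (xs ! k) (zs ! k)) p
      = (\<Sum>k<n. - (\<Sum>Q\<in>UNIV. ?g Q (xs ! k) * P (xs[k := Q]) zs)
        - (\<Sum>Q\<in>UNIV. cnj (?g Q (zs ! k)) * P xs (zs[k := Q])))"
      by (simp add: chart_deriv_prod smooth_herm_form p herm_form_deriv upd zs left_diff_distrib
          sum_distrib_right mult.assoc)
    then show ?thesis by (simp add: sum_subtractf sum_negf)
  qed
  have "chart_deriv c a (raise n (hat S \<zeta>) xs) p =
      (\<Sum>zs | length zs = n. P xs zs * cnj (chart_deriv c a (\<zeta> zs) p)
        + chart_deriv c a (\<lambda>q. \<Prod>k<n. herm_form S q (xs ! k) (zs ! k)) p * cnj (\<zeta> zs p))"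
  proof -
    have "chart_deriv c a (raise n (hat S \<zeta>) xs) p = (\<Sum>zs | length zs = n. chart_deriv c a
        (\<lambda>q. (\<Prod>k<n. herm_form S q (xs ! k) (zs ! k)) * cnj (\<zeta> zs q)) p)"
      unfolding raise_hat[OF xs, abs_def]
      by (rule chart_deriv_sum)
        (auto intro!: smooth_mult smooth_prod smooth_herm_form smooth_cnj \<zeta> p)
    also have "\<dots> = (\<Sum>zs | length zs = n. P xs zs * cnj (chart_deriv c a (\<zeta> zs) p)
        + chart_deriv c a (\<lambda>q. \<Prod>k<n. herm_form S q (xs ! k) (zs ! k)) p * cnj (\<zeta> zs p))"
      by (intro sum.cong refl, subst chart_deriv_mult)
        (auto intro!: smooth_prod smooth_herm_form smooth_cnj \<zeta> simp: p chart_deriv_cnj \<zeta> P_def)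
    finally show ?thesis .
  qed
  also have "\<dots> = (\<Sum>zs | length zs = n. P xs zs * cnj (chart_deriv c a (\<zeta> zs) p))
      - (\<Sum>k<n. \<Sum>Q\<in>UNIV. ?g Q (xs ! k) * (\<Sum>zs | length zs = n. P (xs[k := Q]) zs * cnj (\<zeta> zs p)))
      - (\<Sum>k<n. \<Sum>zs | length zs = n. cnj (\<zeta> zs p) *
          (\<Sum>Q\<in>UNIV. cnj (?g Q (zs ! k)) * P xs (zs[k := Q])))"
  proof -
    have "(\<Sum>zs | length zs = n. chart_deriv c a (\<lambda>q. \<Prod>k<n. herm_form S q (xs ! k) (zs ! k)) p * cnj (\<zeta> zs p))
      = - (\<Sum>zs | length zs = n. \<Sum>k<n. \<Sum>Q\<in>UNIV. ?g Q (xs ! k) * (P (xs[k := Q]) zs * cnj (\<zeta> zs p)))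
        - (\<Sum>zs | length zs = n. \<Sum>k<n. cnj (\<zeta> zs p) * (\<Sum>Q\<in>UNIV. cnj (?g Q (zs ! k)) * P xs (zs[k := Q])))"
      by (simp add: dM left_diff_distrib right_diff_distrib sum_subtractf sum_negf sum_distrib_right sum_distrib_left mult_ac)
    also have "(\<Sum>zs | length zs = n. \<Sum>k<n. \<Sum>Q\<in>UNIV. ?g Q (xs ! k) * (P (xs[k := Q]) zs * cnj (\<zeta> zs p)))
      = (\<Sum>k<n. \<Sum>Q\<in>UNIV. \<Sum>zs | length zs = n. ?g Q (xs ! k) * (P (xs[k := Q]) zs * cnj (\<zeta> zs p)))"
      by (subst sum.swap) (intro sum.cong sum.swap refl)
    also have "(\<Sum>zs | length zs = n. \<Sum>k<n. cnj (\<zeta> zs p) * (\<Sum>Q\<in>UNIV. cnj (?g Q (zs ! k)) * P xs (zs[k := Q])))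
      = (\<Sum>k<n. \<Sum>zs | length zs = n. cnj (\<zeta> zs p) * (\<Sum>Q\<in>UNIV. cnj (?g Q (zs ! k)) * P xs (zs[k := Q])))"
      by (rule sum.swap)
    finally show ?thesis by (simp add: sum.distrib sum_distrib_left)
  qed
  also have "(\<Sum>k<n. \<Sum>zs | length zs = n. cnj (\<zeta> zs p) *
          (\<Sum>Q\<in>UNIV. cnj (?g Q (zs ! k)) * P xs (zs[k := Q])))
      = (\<Sum>k<n. \<Sum>zs | length zs = n. (\<Sum>Q\<in>UNIV. cnj (?g (zs ! k) Q) * cnj (\<zeta> (zs[k := Q]) p)) * P xs zs)"
    by (rule sum.cong[OF refl], subst sum_index_lists_transfer) auto
  also have "\<dots> = (\<Sum>zs | length zs = n. P xs zs * cnj (\<Sum>k<n. \<Sum>Q\<in>UNIV. ?g (zs ! k) Q * \<zeta> (zs[k := Q]) p))"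
    by (subst sum.swap) (simp add: sum_distrib_left mult_ac)
  also have "(\<Sum>zs | length zs = n. P xs zs * cnj (chart_deriv c a (\<zeta> zs) p))
      - (\<Sum>k<n. \<Sum>Q\<in>UNIV. ?g Q (xs ! k) * (\<Sum>zs | length zs = n. P (xs[k := Q]) zs * cnj (\<zeta> zs p)))
      - (\<Sum>zs | length zs = n. P xs zs * cnj (\<Sum>k<n. \<Sum>Q\<in>UNIV. ?g (zs ! k) Q * \<zeta> (zs[k := Q]) p))
     = (\<Sum>zs | length zs = n. P xs zs * cnj (cov_deriv S c a \<zeta> zs p))
      - (\<Sum>k<n. \<Sum>Q\<in>UNIV. ?g Q (xs ! k) * (\<Sum>zs | length zs = n. P (xs[k := Q]) zs * cnj (\<zeta> zs p)))"
    by (simp add: cov_deriv_def right_diff_distrib sum_subtractf)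
  finally show ?thesis
    using xs by (simp add: w raise_hat[OF xs, of S "cov_deriv S c a \<zeta>" p] P_def)
qed

end

section \<open>Independence of the chart\<close>

lemma sum_swap_pairs:
  "(\<Sum>a\<in>A. \<Sum>b\<in>B. \<Sum>i\<in>I. \<Sum>j\<in>K. f a b i j) = (\<Sum>i\<in>I. \<Sum>j\<in>K. \<Sum>a\<in>A. \<Sum>b\<in>B. f a b i j)"
proof -
  have "(\<Sum>a\<in>A. \<Sum>b\<in>B. \<Sum>i\<in>I. \<Sum>j\<in>K. f a b i j) = (\<Sum>a\<in>A. \<Sum>i\<in>I. \<Sum>b\<in>B. \<Sum>j\<in>K. f a b i j)"
    by (rule sum.cong[OF refl], rule sum.swap)
  also have "\<dots> = (\<Sum>i\<in>I. \<Sum>a\<in>A. \<Sum>b\<in>B. \<Sum>j\<in>K. f a b i j)"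
    by (rule sum.swap)
  also have "\<dots> = (\<Sum>i\<in>I. \<Sum>a\<in>A. \<Sum>j\<in>K. \<Sum>b\<in>B. f a b i j)"
    by (rule sum.cong[OF refl], rule sum.cong[OF refl], rule sum.swap)
  also have "\<dots> = (\<Sum>i\<in>I. \<Sum>j\<in>K. \<Sum>a\<in>A. \<Sum>b\<in>B. f a b i j)"
    by (rule sum.cong[OF refl], rule sum.swap)
  finally show ?thesis .
qed

context two_charts
begin

lemma solder_change:
  assumes "p \<in> fst c" "p \<in> fst c'"
  shows "solder S c p a A B = (\<Sum>b\<in>UNIV. of_real (jac c c' p a b) * solder S c' p b A B)"
proof -
  have v: "ivdw S c p a A E = (\<Sum>b\<in>UNIV. of_real (jac c c' p a b) * ivdw S c' p b A E)" for A E
    using spin_structure c_atlas c'.c_atlas assms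
    unfolding spinor_structure_def complex_vector_field_def by blast
  show ?thesis by (simp add: solder_def v sum_2 sum_3 field_simps)
qed

lemma cov_deriv_change:
  assumes "p \<in> fst c" "p \<in> fst c'" "smooth_in_chart c (\<phi> xs)"
  shows "cov_deriv S c' a \<phi> xs p = (\<Sum>b\<in>UNIV. of_real (jac c c' p b a) * cov_deriv S c b \<phi> xs p)"
proof -
  have g: "conn S c' p a C Q = (\<Sum>b\<in>UNIV. of_real (jac c c' p b a) * conn S c p b C Q)" for C Q
    using spin_connection c_atlas c'.c_atlas assms
    unfolding spinor_connection_def complex_covector_field_def by blast
  have "(\<Sum>k<length xs. \<Sum>Q\<in>UNIV. conn S c' p a (xs ! k) Q * \<phi> (xs[k := Q]) p)
     = (\<Sum>b\<in>UNIV. of_real (jac c c' p b a) * (\<Sum>k<length xs. \<Sum>Q\<in>UNIV. conn S c p b (xs ! k) Q * \<phi> (xs[k := Q]) p))"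
    by (simp add: g sum_2 sum_3 sum_distrib_left sum.distrib algebra_simps)
  then show ?thesis
    by (simp add: cov_deriv_def chart_deriv_change[OF assms(3,1,2)] scaleR_conv_of_real
        right_diff_distrib sum_subtractf)
qed

text \<open>The vector law expresses c through c' and the covector law expresses c' through c, both
  with the matrix \<open>jac c c'\<close>; it just moves from one factor to the other.\<close>

lemma solder_cov_deriv_change:
  assumes "p \<in> fst c" "p \<in> fst c'" "smooth_in_chart c (\<phi> xs)"
  shows "(\<Sum>a\<in>UNIV. solder S c p a A B * cov_deriv S c a \<phi> xs p)
    = (\<Sum>a\<in>UNIV. solder S c' p a A B * cov_deriv S c' a \<phi> xs p)"
  by (simp add: solder_change[OF assms(1,2)] cov_deriv_change[of p \<phi> xs, OF assms] sum_3 algebra_simps)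

lemma solder_extr_change:
  assumes "p \<in> fst c" "p \<in> fst c'"
  shows "(\<Sum>a\<in>UNIV. \<Sum>b\<in>UNIV. solder S c p a A B * solder S c p b C D * of_real (extr S c p $ a $ b))
    = (\<Sum>a\<in>UNIV. \<Sum>b\<in>UNIV. solder S c' p a A B * solder S c' p b C D * of_real (extr S c' p $ a $ b))"
proof -
  have e: "extr S c' p $ i $ j =
      (\<Sum>k\<in>UNIV. \<Sum>l\<in>UNIV. jac c c' p k i * jac c c' p l j * extr S c p $ k $ l)" for i j
    using initial_data c_atlas c'.c_atlas assms
    unfolding initial_data_set_def covariant_2_tensor_def by blast
  have "(\<Sum>a\<in>UNIV. \<Sum>b\<in>UNIV. (\<Sum>i\<in>UNIV. of_real (jac c c' p a i) * solder S c' p i A B)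
       * (\<Sum>j\<in>UNIV. of_real (jac c c' p b j) * solder S c' p j C D) * of_real (extr S c p $ a $ b))
    = (\<Sum>i\<in>UNIV. \<Sum>j\<in>UNIV. solder S c' p i A B * solder S c' p j C D *
        (\<Sum>a\<in>UNIV. \<Sum>b\<in>UNIV. of_real (jac c c' p a i) * of_real (jac c c' p b j) * of_real (extr S c p $ a $ b)))"
    (is "(\<Sum>a\<in>UNIV. \<Sum>b\<in>UNIV. (\<Sum>i\<in>UNIV. ?f a i) * (\<Sum>j\<in>UNIV. ?h b j) * ?e a b) = _")
  proof -
    have "(\<Sum>a\<in>UNIV. \<Sum>b\<in>UNIV. (\<Sum>i\<in>UNIV. ?f a i) * (\<Sum>j\<in>UNIV. ?h b j) * ?e a b)
      = (\<Sum>a\<in>UNIV. \<Sum>b\<in>UNIV. \<Sum>i\<in>UNIV. \<Sum>j\<in>UNIV. ?f a i * ?h b j * ?e a b)"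
      unfolding sum_product unfolding sum_distrib_right ..
    also have "\<dots> = (\<Sum>i\<in>UNIV. \<Sum>j\<in>UNIV. \<Sum>a\<in>UNIV. \<Sum>b\<in>UNIV. ?f a i * ?h b j * ?e a b)"
      by (rule sum_swap_pairs)
    finally show ?thesis
      by (simp only: sum_distrib_left mult_ac)
  qed
  then show ?thesis by (simp add: solder_change[OF assms] e)
qed

end

context chart_of
begin

text \<open>The definition uses \<open>chart_at\<close>, a choice that may jump from point to point.
  With one fixed chart on all of its domain, smoothness in p can be seen.\<close>

lemma K_spinor_chart:
  assumes "p \<in> fst c"
  shows "K_spinor S xs p = (\<Sum>a\<in>UNIV. \<Sum>b\<in>UNIV. solder S c p a (xs ! 0) (xs ! 1)
    * solder S c p b (xs ! 2) (xs ! 3) * of_real (extr S c p $ a $ b))"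
proof -
  interpret c': chart_of S "chart_at S p" by (rule chart_of_atlas[OF chart_at(1)])
  interpret two_charts S "chart_at S p" c by unfold_locales
  show ?thesis
    unfolding K_spinor_def Let_def by (rule solder_extr_change[OF chart_at(2) assms])
qed

lemma sen_chart:
  assumes "p \<in> fst c" "smooth_fun S (\<phi> xs)"
  shows "sen S \<phi> (A # B # xs) p = (\<Sum>a\<in>UNIV. solder S c p a A B * cov_deriv S c a \<phi> xs p)
    + (\<Sum>k<length xs. \<Sum>Q\<in>UNIV. \<Sum>R\<in>UNIV.
          eps Q R * K_spinor S [A, B, xs ! k, R] p * \<phi> (xs[k := Q]) p) / 2"
proof -
  interpret c': chart_of S "chart_at S p" by (rule chart_of_atlas[OF chart_at(1)])
  interpret two_charts S "chart_at S p" c by unfold_locales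
  show ?thesis
    using assms(2) solder_cov_deriv_change[OF chart_at(2) assms(1), of \<phi> xs A B]
    by (simp add: smooth_fun_def c'.c_atlas Let_def)
qed

lemma smooth_K_spinor: "smooth_in_chart c (K_spinor S xs)"
proof -
  have "smooth_in_chart c (\<lambda>p. \<Sum>a\<in>UNIV. \<Sum>b\<in>UNIV. solder S c p a (xs ! 0) (xs ! 1)
    * solder S c p b (xs ! 2) (xs ! 3) * of_real (extr S c p $ a $ b))"
    by (intro smooth_sum smooth_mult smooth_solder smooth_of_real smooth_extr)
  then show ?thesis by (rule smooth_cong) (simp add: K_spinor_chart)
qed

lemma smooth_cov_deriv:
  assumes "\<And>ys. length ys = length xs \<Longrightarrow> smooth_in_chart c (\<phi> ys)"
  shows "smooth_in_chart c (cov_deriv S c a \<phi> xs)"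
  unfolding cov_deriv_def[abs_def]
  by (intro smooth_diff smooth_chart_deriv smooth_sum smooth_mult smooth_conn assms) simp_all

lemma smooth_sen:
  assumes "smooth_spinor_field S (length xs) \<phi>"
  shows "smooth_in_chart c (sen S \<phi> (A # B # xs))"
proof -
  have \<phi>: "smooth_in_chart c (\<phi> ys)" if "length ys = length xs" for ys
    using assms that c_atlas by (simp add: smooth_spinor_field_def)
  have "smooth_in_chart c (\<lambda>p. (\<Sum>a\<in>UNIV. solder S c p a A B * cov_deriv S c a \<phi> xs p)
    + (\<Sum>k<length xs. \<Sum>Q\<in>UNIV. \<Sum>R\<in>UNIV.
          eps Q R * K_spinor S [A, B, xs ! k, R] p * \<phi> (xs[k := Q]) p) / 2)"
    by (intro smooth_sum smooth_mult smooth_add smooth_divide_const smooth_solder smooth_cov_deriv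
        smooth_K_spinor smooth_const \<phi>) simp_all
  then show ?thesis
    using assms by (elim smooth_cong) (simp add: sen_chart smooth_fun_def smooth_spinor_field_def del: sen.simps)
qed

end

context vacuum_spin
begin

lemma smooth_sen_field:
  assumes "smooth_spinor_field S n \<phi>"
  shows "smooth_spinor_field S (n + 2) (sen S \<phi>)"
  unfolding smooth_spinor_field_def
proof (intro allI impI ballI)
  fix xs :: "2 list" and c assume "length xs = n + 2" "c \<in> atlas S"
  then obtain A B ys where "xs = A # B # ys" "length ys = n"
    by (auto simp: length_Suc_conv)
  then show "smooth_in_chart c (sen S \<phi> xs)"
    using chart_of.smooth_sen[OF chart_of_atlas[OF \<open>c \<in> atlas S\<close>]] assms by simp
qed

lemma smooth_symmetrise:
  assumes "smooth_spinor_field S n \<phi>"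
  shows "smooth_spinor_field S n (symmetrise \<phi>)"
  unfolding smooth_spinor_field_def symmetrise_def[abs_def]
proof (intro allI impI ballI)
  fix xs :: "2 list" and c assume n: "length xs = n" and c: "c \<in> atlas S"
  interpret chart_of S c using c by (rule chart_of_atlas)
  show "smooth_in_chart c (\<lambda>p. (\<Sum>\<pi> | \<pi> permutes {..<length xs}. \<phi> (permute_list \<pi> xs) p) / fact (length xs))"
    using assms n c by (intro smooth_divide_const smooth_sum) (simp add: smooth_spinor_field_def)
qed

end

section \<open>Symmetrisation and the pointwise inner products\<close>

text \<open>The pointwise Hermitian inner product, conjugate-linear in v.\<close>

definition pairing :: "'a spin_data \<Rightarrow> nat \<Rightarrow> 'a spinor_field \<Rightarrow> 'a spinor_field \<Rightarrow> 'a \<Rightarrow> complex" where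
  "pairing S n u v p = (\<Sum>xs | length xs = n. u xs p * raise n (hat S v) xs p)"

lemma J_density_pairing: "J_density S \<kappa> p = pairing S 4 (Phi S \<kappa>) (sen S \<kappa>) p"
  by (simp add: J_density_def pairing_def Phi_def)

lemma pairing_eq:
  "pairing S n u v p = (\<Sum>xs | length xs = n. \<Sum>zs | length zs = n.
    u xs p * (\<Prod>k<n. herm_form S p (xs ! k) (zs ! k)) * cnj (v zs p))"
  by (simp add: pairing_def raise_hat sum_distrib_left mult.assoc)

lemma pairing_eq':
  "pairing S n u v p = (\<Sum>zs | length zs = n.
    (\<Sum>xs | length xs = n. u xs p * (\<Prod>k<n. herm_form S p (xs ! k) (zs ! k))) * cnj (v zs p))"
  unfolding pairing_eq by (subst sum.swap) (simp add: sum_distrib_right)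

lemma pairing_cong:
  assumes "\<And>xs. length xs = n \<Longrightarrow> u xs p = u' xs p" "\<And>xs. length xs = n \<Longrightarrow> v xs p = v' xs p"
  shows "pairing S n u v p = pairing S n u' v' p"
  unfolding pairing_eq using assms by (auto intro!: sum.cong)

lemma pairing_add_left:
  "pairing S n (\<lambda>xs p. u xs p + v xs p) w p = pairing S n u w p + pairing S n v w p"
  and pairing_add_right:
  "pairing S n w (\<lambda>xs p. u xs p + v xs p) p = pairing S n w u p + pairing S n w v p"
  and pairing_diff_right:
  "pairing S n w (\<lambda>xs p. u xs p - v xs p) p = pairing S n w u p - pairing S n w v p"
  and pairing_scale_left:
  "pairing S n (\<lambda>xs p. k * u xs p) w p = k * pairing S n u w p"
  and pairing_scale_right:
  "pairing S n w (\<lambda>xs p. k * u xs p) p = cnj k * pairing S n w u p"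
  unfolding pairing_eq by (simp_all add: sum.distrib sum_subtractf sum_distrib_left algebra_simps)

lemma sum_rotate:
  "(\<Sum>x\<in>A. \<Sum>y\<in>B. \<Sum>z\<in>C. f x y z) = (\<Sum>z\<in>C. \<Sum>x\<in>A. \<Sum>y\<in>B. f x y z)"
proof -
  have "(\<Sum>x\<in>A. \<Sum>y\<in>B. \<Sum>z\<in>C. f x y z) = (\<Sum>x\<in>A. \<Sum>z\<in>C. \<Sum>y\<in>B. f x y z)"
    by (rule sum.cong[OF refl], rule sum.swap)
  also have "\<dots> = (\<Sum>z\<in>C. \<Sum>x\<in>A. \<Sum>y\<in>B. f x y z)"
    by (rule sum.swap)
  finally show ?thesis .
qed

lemma permute_list_inverse:
  assumes "\<pi> permutes {..<length xs}"
  shows "permute_list (inv \<pi>) (permute_list \<pi> xs) = xs" "permute_list \<pi> (permute_list (inv \<pi>) xs) = xs"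
  using assms permutes_inv[OF assms]
  by (simp_all flip: permute_list_compose add: permutes_inv_o)

lemma sum_index_lists_permute:
  assumes "\<pi> permutes {..<n}"
  shows "(\<Sum>xs | length xs = n. f (permute_list \<pi> xs)) = (\<Sum>xs :: 2 list | length xs = n. f xs)"
  by (rule sum.reindex_bij_witness[where i = "permute_list (inv \<pi>)" and j = "permute_list \<pi>"])
    (use assms in \<open>auto simp: permute_list_inverse\<close>)

lemma prod_permute_lists:
  assumes "\<pi> permutes {..<n}" "length xs = n" "length zs = n"
  shows "(\<Prod>k<n. g (permute_list \<pi> xs ! k) (permute_list \<pi> zs ! k)) = (\<Prod>k<n. g (xs ! k) (zs ! k))"
proof -
  have "(\<Prod>k<n. g (xs ! k) (zs ! k)) = (\<Prod>k<n. g (xs ! \<pi> k) (zs ! \<pi> k))"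
    using prod.permute[OF assms(1), of "\<lambda>k. g (xs ! k) (zs ! k)"] by (simp add: o_def)
  then show ?thesis using assms by (simp add: permute_list_nth)
qed

text \<open>The product of the \<open>herm_form\<close> factors does not change when xs and zs are
  permuted together. A permutation acting on u can therefore be traded for its inverse acting on v,
  and the average over the whole group is insensitive to inversion.\<close>

lemma pairing_symmetrise: "pairing S n (symmetrise u) v p = pairing S n u (symmetrise v) p"
proof -
  let ?P = "\<lambda>xs zs. \<Prod>k<n. herm_form S p (xs ! k) (zs ! k)"
  define F where "F \<pi> = (\<Sum>xs | length xs = n. \<Sum>zs | length zs = n.
    u (permute_list \<pi> xs) p * ?P xs zs * cnj (v zs p))" for \<pi>
  define G where "G \<pi> = (\<Sum>xs | length xs = n. \<Sum>zs | length zs = n.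
    u xs p * ?P xs zs * cnj (v (permute_list \<pi> zs) p))" for \<pi>
  have "F \<pi> = G (inv \<pi>)" if \<pi>: "\<pi> permutes {..<n}" for \<pi>
  proof -
    have "F \<pi> = (\<Sum>xs | length xs = n. \<Sum>zs | length zs = n.
        u (permute_list \<pi> xs) p * ?P (permute_list \<pi> xs) (permute_list \<pi> zs) * cnj (v zs p))"
      unfolding F_def using prod_permute_lists[OF \<pi>, of _ _ "herm_form S p"] by simp
    also have "\<dots> = (\<Sum>xs | length xs = n. \<Sum>zs | length zs = n.
        u xs p * ?P xs (permute_list \<pi> zs) * cnj (v zs p))"
      by (rule sum_index_lists_permute[OF \<pi>, of "\<lambda>xs. \<Sum>zs | length zs = n.
        u xs p * ?P xs (permute_list \<pi> zs) * cnj (v zs p)"])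
    also have "\<dots> = G (inv \<pi>)"
      unfolding G_def
    proof (rule sum.cong[OF refl])
      fix xs
      have "(\<Sum>zs | length zs = n. u xs p * ?P xs zs * cnj (v (permute_list (inv \<pi>) zs) p))
        = (\<Sum>zs | length zs = n. u xs p * ?P xs (permute_list \<pi> zs) *
            cnj (v (permute_list (inv \<pi>) (permute_list \<pi> zs)) p))"
        by (rule sum_index_lists_permute[OF \<pi>, symmetric])
      then show "(\<Sum>zs | length zs = n. u xs p * ?P xs (permute_list \<pi> zs) * cnj (v zs p))
        = (\<Sum>zs | length zs = n. u xs p * ?P xs zs * cnj (v (permute_list (inv \<pi>) zs) p))"
        using \<pi> by (simp add: permute_list_inverse)
    qed
    finally show ?thesis .
  qed
  then have "(\<Sum>\<pi> | \<pi> permutes {..<n}. F \<pi>) = (\<Sum>\<pi> | \<pi> permutes {..<n}. G (inv \<pi>))"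
    by (intro sum.cong) auto
  also have "\<dots> = (\<Sum>\<pi> | \<pi> permutes {..<n}. G \<pi>)"
    by (rule sum_permutations_inverse[symmetric])
  finally have FG: "(\<Sum>\<pi> | \<pi> permutes {..<n}. F \<pi>) = (\<Sum>\<pi> | \<pi> permutes {..<n}. G \<pi>)" .
  have "pairing S n (symmetrise u) v p = (\<Sum>xs | length xs = n. \<Sum>zs | length zs = n.
      \<Sum>\<pi> | \<pi> permutes {..<n}. u (permute_list \<pi> xs) p * ?P xs zs * cnj (v zs p) / fact n)"
    unfolding pairing_eq symmetrise_def
    by (intro sum.cong refl) (simp add: sum_distrib_right sum_divide_distrib)
  also have "\<dots> = (\<Sum>\<pi> | \<pi> permutes {..<n}. F \<pi> / fact n)"
    unfolding F_def sum_divide_distrib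
    by (rule sum_rotate)
  also have "\<dots> = (\<Sum>\<pi> | \<pi> permutes {..<n}. F \<pi>) / fact n"
    by (simp add: sum_divide_distrib)
  finally have 1: "pairing S n (symmetrise u) v p = (\<Sum>\<pi> | \<pi> permutes {..<n}. F \<pi>) / fact n" .
  have "pairing S n u (symmetrise v) p = (\<Sum>xs | length xs = n. \<Sum>zs | length zs = n.
      \<Sum>\<pi> | \<pi> permutes {..<n}. u xs p * ?P xs zs * cnj (v (permute_list \<pi> zs) p) / fact n)"
    unfolding pairing_eq symmetrise_def
    by (intro sum.cong refl) (simp add: sum_distrib_left sum_divide_distrib)
  also have "\<dots> = (\<Sum>\<pi> | \<pi> permutes {..<n}. G \<pi> / fact n)"
    unfolding G_def sum_divide_distrib
    by (rule sum_rotate)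
  also have "\<dots> = (\<Sum>\<pi> | \<pi> permutes {..<n}. G \<pi>) / fact n"
    by (simp add: sum_divide_distrib)
  finally show ?thesis using 1 FG by simp
qed

lemma symmetrise_permute:
  assumes "\<rho> permutes {..<length xs}"
  shows "symmetrise \<phi> (permute_list \<rho> xs) p = symmetrise \<phi> xs p"
proof -
  have "(\<Sum>\<pi> | \<pi> permutes {..<length xs}. \<phi> (permute_list \<pi> (permute_list \<rho> xs)) p)
      = (\<Sum>\<pi> | \<pi> permutes {..<length xs}. \<phi> (permute_list (\<rho> \<circ> \<pi>) xs) p)"
    by (intro sum.cong refl) (simp add: permute_list_compose)
  then show ?thesis
    using setum_permutations_compose_left[OF assms, of "\<lambda>\<pi>. \<phi> (permute_list \<pi> xs) p"]
    by (simp add: symmetrise_def)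
qed

lemma symmetrise_mset:
  assumes "mset ys = mset xs" shows "symmetrise \<phi> ys = symmetrise \<phi> xs"
proof
  fix p
  obtain \<rho> where "\<rho> permutes {..<length xs}" "permute_list \<rho> xs = ys"
    using mset_eq_permutation[OF assms] by metis
  then show "symmetrise \<phi> ys p = symmetrise \<phi> xs p"
    using symmetrise_permute by metis
qed

lemma symmetrise_symmetric:
  assumes "\<And>ys. mset ys = mset xs \<Longrightarrow> \<phi> ys p = \<phi> xs p"
  shows "symmetrise \<phi> xs p = \<phi> xs p"
proof -
  have "(\<Sum>\<pi> | \<pi> permutes {..<length xs}. \<phi> (permute_list \<pi> xs) p)
      = (\<Sum>\<pi> | \<pi> permutes {..<length xs}. \<phi> xs p)"
    by (intro sum.cong refl assms) (simp add: mset_permute_list)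
  then show ?thesis by (simp add: symmetrise_def card_permutations[OF refl])
qed

lemma symmetrise_2: "symmetrise \<phi> [A, B] p = (\<phi> [A, B] p + \<phi> [B, A] p) / 2"
proof -
  have "{..<2::nat} = insert 0 {1}" by auto
  then show ?thesis
    by (simp add: symmetrise_def permute_list_def sum_over_permutations_insert permutes_sing
        numeral_2_eq_2 upt_rec transpose_def)
qed

text \<open>The assumed symmetries generate a group of 8 permutations. The 24 permutations fall into
  3 cosets, one for each splitting of the four indices into two pairs.\<close>

lemma symmetrise_4:
  assumes K: "\<And>A B C D. K [B, A, C, D] p = K [A, B, C, D] p" "\<And>A B C D. K [C, D, A, B] p = K [A, B, C, D] p"
  shows "symmetrise K [A, B, C, D] p = (K [A, B, C, D] p + K [A, C, B, D] p + K [A, D, B, C] p) / 3"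
proof -
  have s: "{..<4::nat} = insert 0 (insert (Suc 0) (insert (Suc (Suc 0)) {Suc (Suc (Suc 0))}))" by auto
  have K': "K [A, B, D, C] p = K [A, B, C, D] p" for A B C D
    using K by metis
  have "symmetrise K [A, B, C, D] p = (\<Sum>\<pi> | \<pi> permutes {..<4}. K (permute_list \<pi> [A, B, C, D]) p) / 24"
  proof -
    have "length [A, B, C, D] = 4" by simp
    then show ?thesis by (simp only: symmetrise_def) (simp add: fact_numeral)
  qed
  also have "(\<Sum>\<pi> | \<pi> permutes {..<4}. K (permute_list \<pi> [A, B, C, D]) p)
     = 8 * (K [A, B, C, D] p + K [A, C, B, D] p + K [A, D, B, C] p)"
    unfolding s
    by (simp add: permute_list_def sum_over_permutations_insert permutes_sing
        upt_rec transpose_def K K')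
  finally have "symmetrise K [A, B, C, D] p
      = 8 * (K [A, B, C, D] p + K [A, C, B, D] p + K [A, D, B, C] p) / 24" .
  moreover have "8 * X / 24 = X / 3" for X :: complex by simp
  ultimately show ?thesis by (simp only:)
qed

text \<open>A permutation of xs is compensated by the same permutation of the summed list zs, under
  which v is invariant.\<close>

lemma raise_hat_mset:
  assumes v: "\<And>xs ys. length xs = n \<Longrightarrow> mset ys = mset xs \<Longrightarrow> v ys p = v xs p"
    and xs: "length xs = n" "mset ys = mset xs"
  shows "raise n (hat S v) ys p = raise n (hat S v) xs p"
proof -
  obtain \<rho> where \<rho>: "\<rho> permutes {..<n}" "permute_list \<rho> xs = ys"
    using mset_eq_permutation[OF xs(2)] xs(1) by metis
  let ?f = "\<lambda>ys zs. (\<Prod>k<n. herm_form S p (ys ! k) (zs ! k)) * cnj (v zs p)"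
  have "raise n (hat S v) ys p = (\<Sum>zs | length zs = n. ?f ys zs)"
    using \<rho> xs by (intro raise_hat) auto
  also have "\<dots> = (\<Sum>zs | length zs = n. ?f (permute_list \<rho> xs) (permute_list \<rho> zs))"
    using sum_index_lists_permute[OF \<rho>(1), of "?f ys"] \<rho>(2) by simp
  also have "\<dots> = (\<Sum>zs | length zs = n. ?f xs zs)"
  proof (rule sum.cong[OF refl])
    fix zs :: "2 list" assume zs: "zs \<in> {zs. length zs = n}"
    then have "v (permute_list \<rho> zs) p = v zs p"
      using \<rho>(1) by (intro v) (auto simp: mset_permute_list)
    then show "?f (permute_list \<rho> xs) (permute_list \<rho> zs) = ?f xs zs"
      using prod_permute_lists[OF \<rho>(1) xs(1), of zs "herm_form S p"] zs by simp
  qed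
  also have "\<dots> = raise n (hat S v) xs p"
    using xs by (simp add: raise_hat)
  finally show ?thesis .
qed

section \<open>The formal adjoint, pointwise\<close>

lemma prod_lessThan_4: "(\<Prod>k<4::nat. f k) = f 0 * f 1 * f 2 * f 3"
  and prod_lessThan_2: "(\<Prod>k<2::nat. f k) = f 0 * f 1"
  by (simp_all add: numeral_eq_Suc)

lemma sum_lessThan_4: "(\<Sum>k<4::nat. f k) = f 0 + f 1 + f 2 + f 3"
  by (simp add: numeral_eq_Suc)

definition K_up :: "'a spin_data \<Rightarrow> 'a \<Rightarrow> 2 \<Rightarrow> 2 \<Rightarrow> 2 \<Rightarrow> 2 \<Rightarrow> complex" where
  "K_up S p E F G C = (\<Sum>X\<in>UNIV. \<Sum>Y\<in>UNIV. \<Sum>Z\<in>UNIV.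
     eps E X * eps F Y * eps G Z * K_spinor S [X, Y, Z, C] p)"

text \<open>\<open>K_contr S \<zeta> xs\<close> is $K^{EFG}{}_C\zeta_{EFGD}$ for \<open>xs = [C, D]\<close>.\<close>

definition K_contr :: "'a spin_data \<Rightarrow> 'a spinor_field \<Rightarrow> 'a spinor_field" where
  "K_contr S \<zeta> xs p = (\<Sum>E\<in>UNIV. \<Sum>F\<in>UNIV. \<Sum>G\<in>UNIV. K_up S p E F G (xs ! 0) * \<zeta> [E, F, G, xs ! 1] p)"

definition K_mult :: "'a spin_data \<Rightarrow> 'a spinor_field \<Rightarrow> 'a spinor_field" where
  "K_mult S \<eta> xs p = (\<Sum>Q\<in>UNIV. \<Sum>R\<in>UNIV.
     eps Q R * K_spinor S [xs ! 0, xs ! 1, xs ! 2, R] p * \<eta> [Q, xs ! 3] p)"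

definition D_grad :: "'a spin_data \<Rightarrow> 'a chart \<Rightarrow> 'a spinor_field \<Rightarrow> 'a spinor_field" where
  "D_grad S c \<eta> xs p = (\<Sum>a\<in>UNIV. solder S c p a (xs ! 0) (xs ! 1) * cov_deriv S c a \<eta> (drop 2 xs) p)"

definition D_div :: "'a spin_data \<Rightarrow> 'a chart \<Rightarrow> 'a spinor_field \<Rightarrow> 'a spinor_field" where
  "D_div S c \<zeta> xs p = (\<Sum>A\<in>UNIV. \<Sum>B\<in>UNIV. \<Sum>G\<in>UNIV. \<Sum>H\<in>UNIV. eps A G * eps B H *
     (\<Sum>a\<in>UNIV. solder S c p a G H * cov_deriv S c a \<zeta> (A # B # xs) p))"

text \<open>The vector field $\sigma^a{}_{AB}\,\eta_{CD}\,\hat\zeta^{ABCD}$ whose divergence is the defect of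
  the adjunction.\<close>

definition flux :: "'a spin_data \<Rightarrow> 'a chart \<Rightarrow> 'a spinor_field \<Rightarrow> 'a spinor_field \<Rightarrow> 3 \<Rightarrow> 'a \<Rightarrow> complex" where
  "flux S c \<eta> \<zeta> a p = pairing S 4 (\<lambda>xs q. solder S c q a (xs ! 0) (xs ! 1) * \<eta> (drop 2 xs) q) \<zeta> p"

lemma K_spinor_sym1: "K_spinor S [B, A, C, D] p = K_spinor S [A, B, C, D] p"
  by (simp add: K_spinor_def Let_def solder_sym[of S _ p _ B A])

context chart_of
begin

lemma K_spinor_sym2_chart: "p \<in> fst c \<Longrightarrow> K_spinor S [C, D, A, B] p = K_spinor S [A, B, C, D] p"
  by (simp add: K_spinor_chart, subst sum.swap) (simp add: extr_sym mult_ac)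

text \<open>This is \<open>solder_hat\<close> in the shape in which pairings use it: after
  substitution, tau contracted with \<open>herm_form\<close> collapses to eps. The two eps factors
  come out transposed, so their signs cancel and the minus of anti-Hermiticity stays.\<close>

lemma solder_herm_form:
  assumes "p \<in> fst c"
  shows "(\<Sum>A\<in>UNIV. \<Sum>B\<in>UNIV. solder S c p a A B * herm_form S p A E * herm_form S p B F)
    = - (\<Sum>X\<in>UNIV. \<Sum>Y\<in>UNIV. eps E X * eps F Y * cnj (solder S c p a X Y))"
proof -
  have s: "solder S c p a A B =
      - (\<Sum>E\<in>UNIV. \<Sum>F\<in>UNIV. normal_up S p A E * normal_up S p B F * cnj (solder S c p a E F))" for A B
    using solder_hat[OF assms, of A B a] by simp
  have "(\<Sum>A\<in>UNIV. \<Sum>B\<in>UNIV. solder S c p a A B * herm_form S p A E * herm_form S p B F)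
    = - (\<Sum>X\<in>UNIV. \<Sum>Y\<in>UNIV. (\<Sum>A\<in>UNIV. normal_up S p A X * herm_form S p A E)
         * (\<Sum>B\<in>UNIV. normal_up S p B Y * herm_form S p B F) * cnj (solder S c p a X Y))"
    by (subst s) (simp add: sum_2 algebra_simps)
  then show ?thesis
    by (simp add: normal_up_herm_form eps_antisym[of _ E] eps_antisym[of _ F])
qed

text \<open>Here one index of the solder form is contracted with \<open>herm_form\<close>, and the
  other passes through eps and recreates a \<open>herm_form\<close>. A single eps comes out
  transposed, which absorbs the minus of anti-Hermiticity.\<close>

lemma solder_herm_form_mixed:
  assumes "p \<in> fst c"
  shows "(\<Sum>C\<in>UNIV. \<Sum>R\<in>UNIV. eps Q R * solder S c p a C R * herm_form S p C G)
    = (\<Sum>Q'\<in>UNIV. \<Sum>Z\<in>UNIV. herm_form S p Q Q' * eps G Z * cnj (solder S c p a Z Q'))"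
proof -
  have s: "solder S c p a A B =
      - (\<Sum>E\<in>UNIV. \<Sum>F\<in>UNIV. normal_up S p A E * normal_up S p B F * cnj (solder S c p a E F))" for A B
    using solder_hat[OF assms, of A B a] by simp
  have "(\<Sum>C\<in>UNIV. \<Sum>R\<in>UNIV. eps Q R * solder S c p a C R * herm_form S p C G)
    = - (\<Sum>Q'\<in>UNIV. \<Sum>Z\<in>UNIV. (\<Sum>R\<in>UNIV. eps Q R * normal_up S p R Q')
        * (\<Sum>C\<in>UNIV. normal_up S p C Z * herm_form S p C G) * cnj (solder S c p a Z Q'))"
    by (subst s) (simp add: sum_2 algebra_simps)
  then show ?thesis
    by (simp add: normal_up_herm_form eps_antisym[of _ G] sum_negf flip: herm_form_def)
qed

text \<open>K is a real tensor between two solder forms. The pair A, B is handled by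
  \<open>solder_herm_form\<close> and the pair C, R by \<open>solder_herm_form_mixed\<close>; only
  the first brings a sign.\<close>

lemma K_spinor_herm_form:
  assumes p: "p \<in> fst c"
  shows "(\<Sum>A\<in>UNIV. \<Sum>B\<in>UNIV. \<Sum>C\<in>UNIV. \<Sum>R\<in>UNIV. eps Q R * K_spinor S [A, B, C, R] p
      * herm_form S p A E * herm_form S p B F * herm_form S p C G)
    = - (\<Sum>Q'\<in>UNIV. herm_form S p Q Q' * cnj (K_up S p E F G Q'))"
proof -
  let ?s = "solder S c p" and ?M = "herm_form S p"
  define k where "k a b = complex_of_real (extr S c p $ a $ b)" for a b
  have K: "K_spinor S [A, B, C, D] p = (\<Sum>a\<in>UNIV. \<Sum>b\<in>UNIV. ?s a A B * ?s b C D * k a b)" for A B C D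
    by (simp add: K_spinor_chart[OF p] k_def)
  have ck: "cnj (k a b) = k a b" for a b by (simp add: k_def)
  have "(\<Sum>A\<in>UNIV. \<Sum>B\<in>UNIV. \<Sum>C\<in>UNIV. \<Sum>R\<in>UNIV. eps Q R * K_spinor S [A, B, C, R] p
      * ?M A E * ?M B F * ?M C G)
    = (\<Sum>a\<in>UNIV. \<Sum>b\<in>UNIV. k a b * (\<Sum>A\<in>UNIV. \<Sum>B\<in>UNIV. ?s a A B * ?M A E * ?M B F)
        * (\<Sum>C\<in>UNIV. \<Sum>R\<in>UNIV. eps Q R * ?s b C R * ?M C G))"
    by (simp add: K sum_2 sum.distrib sum_distrib_left sum_distrib_right algebra_simps)
  also have "\<dots> = (\<Sum>a\<in>UNIV. \<Sum>b\<in>UNIV. k a b *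
       (- (\<Sum>X\<in>UNIV. \<Sum>Y\<in>UNIV. eps E X * eps F Y * cnj (?s a X Y)))
        * (\<Sum>Q'\<in>UNIV. \<Sum>Z\<in>UNIV. ?M Q Q' * eps G Z * cnj (?s b Z Q')))"
    by (simp only: solder_herm_form[OF p] solder_herm_form_mixed[OF p])
  also have "\<dots> = - (\<Sum>Q'\<in>UNIV. ?M Q Q' * cnj (K_up S p E F G Q'))"
    by (simp add: K_up_def K ck sum_2 sum.distrib sum_negf sum_subtractf sum_distrib_left sum_distrib_right algebra_simps)
  finally show ?thesis .
qed

text \<open>Multiplication by sigma_{AB} has as its pointwise adjoint minus the contraction with
  sigma^{AB}. This minus turns the derivative of \<zeta> in the flux into the divergence term of the
  adjoint.\<close>

lemma pairing_solder:
  assumes p: "p \<in> fst c"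
  shows "pairing S 4 (\<lambda>xs q. solder S c q a (xs ! 0) (xs ! 1) * \<eta> (drop 2 xs) q) \<psi> p
    = - pairing S 2 \<eta> (\<lambda>xs q. \<Sum>A\<in>UNIV. \<Sum>B\<in>UNIV. \<Sum>G\<in>UNIV. \<Sum>H\<in>UNIV.
        eps A G * eps B H * solder S c q a G H * \<psi> (A # B # xs) q) p"
proof -
  let ?s = "solder S c p a" and ?M = "herm_form S p"
  define N where "N G H = (\<Sum>C\<in>UNIV. \<Sum>D\<in>UNIV. \<eta> [C, D] p * ?M C G * ?M D H)" for G H
  define Y where "Y E F = (\<Sum>X\<in>UNIV. \<Sum>Y\<in>UNIV. eps E X * eps F Y * cnj (?s X Y))" for E F
  have "(\<Sum>A\<in>UNIV. \<Sum>B\<in>UNIV. \<Sum>C\<in>UNIV. \<Sum>D\<in>UNIV. ?s A B * \<eta> [C, D] p * (?M A E * ?M B F * ?M C G * ?M D H))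
      = (\<Sum>A\<in>UNIV. \<Sum>B\<in>UNIV. ?s A B * ?M A E * ?M B F) * N G H" for E F G H
    by (simp add: N_def sum_2 algebra_simps)
  then have *: "(\<Sum>A\<in>UNIV. \<Sum>B\<in>UNIV. \<Sum>C\<in>UNIV. \<Sum>D\<in>UNIV. ?s A B * \<eta> [C, D] p * (?M A E * ?M B F * ?M C G * ?M D H))
      = - Y E F * N G H" for E F G H
    by (simp add: solder_herm_form[OF p] Y_def)
  have "pairing S 4 (\<lambda>xs q. solder S c q a (xs ! 0) (xs ! 1) * \<eta> (drop 2 xs) q) \<psi> p
     = (\<Sum>E\<in>UNIV. \<Sum>F\<in>UNIV. \<Sum>G\<in>UNIV. \<Sum>H\<in>UNIV. - Y E F * N G H * cnj (\<psi> [E, F, G, H] p))"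
    unfolding pairing_eq' sum_index_lists_4 prod_lessThan_4 by (simp add: * numeral_2_eq_2 numeral_3_eq_3)
  moreover have "pairing S 2 \<eta> (\<lambda>xs q. \<Sum>A\<in>UNIV. \<Sum>B\<in>UNIV. \<Sum>G\<in>UNIV. \<Sum>H\<in>UNIV.
        eps A G * eps B H * solder S c q a G H * \<psi> (A # B # xs) q) p
     = (\<Sum>G\<in>UNIV. \<Sum>H\<in>UNIV. N G H * cnj (\<Sum>E\<in>UNIV. \<Sum>F\<in>UNIV. cnj (Y E F) * \<psi> [E, F, G, H] p))"
    unfolding pairing_eq' sum_index_lists_2 prod_lessThan_2
    by (simp add: N_def Y_def sum_distrib_left sum_distrib_right mult_ac)
  ultimately show ?thesis
    by (simp add: sum_2 algebra_simps)
qed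

text \<open>The analogue of \<open>pairing_solder\<close> for the algebraic term: the adjoint of
  multiplication by K is minus the contraction with K, with the sign of
  \<open>K_spinor_herm_form\<close>.\<close>

lemma pairing_K_mult:
  assumes p: "p \<in> fst c"
  shows "pairing S 4 (K_mult S \<eta>) \<zeta> p = - pairing S 2 \<eta> (K_contr S \<zeta>) p"
proof -
  let ?M = "herm_form S p"
  define N where "N G H = (\<Sum>C\<in>UNIV. \<Sum>D\<in>UNIV. \<eta> [C, D] p * ?M C G * ?M D H)" for G H
  define k where "k E F G Q = cnj (K_up S p E F G Q)" for E F G Q
  have *: "(\<Sum>A\<in>UNIV. \<Sum>B\<in>UNIV. \<Sum>C\<in>UNIV. \<Sum>D\<in>UNIV. K_mult S \<eta> [A, B, C, D] p * (?M A E * ?M B F * ?M C G * ?M D H))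
      = - (\<Sum>Q\<in>UNIV. N Q H * k E F G Q)" for E F G H
  proof -
    have "(\<Sum>A\<in>UNIV. \<Sum>B\<in>UNIV. \<Sum>C\<in>UNIV. \<Sum>D\<in>UNIV. K_mult S \<eta> [A, B, C, D] p * (?M A E * ?M B F * ?M C G * ?M D H))
      = (\<Sum>Q\<in>UNIV. \<Sum>D\<in>UNIV. \<eta> [Q, D] p * ?M D H * (\<Sum>A\<in>UNIV. \<Sum>B\<in>UNIV. \<Sum>C\<in>UNIV. \<Sum>R\<in>UNIV.
          eps Q R * K_spinor S [A, B, C, R] p * ?M A E * ?M B F * ?M C G))"
      by (simp add: K_mult_def sum_2 algebra_simps)
    also have "\<dots> = (\<Sum>Q\<in>UNIV. \<Sum>D\<in>UNIV. \<eta> [Q, D] p * ?M D H * (- (\<Sum>Q'\<in>UNIV. ?M Q Q' * k E F G Q')))"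
      by (simp only: K_spinor_herm_form[OF p] k_def)
    finally show ?thesis by (simp add: N_def sum_2 algebra_simps)
  qed
  have "pairing S 4 (K_mult S \<eta>) \<zeta> p
     = (\<Sum>E\<in>UNIV. \<Sum>F\<in>UNIV. \<Sum>G\<in>UNIV. \<Sum>H\<in>UNIV. - (\<Sum>Q\<in>UNIV. N Q H * k E F G Q) * cnj (\<zeta> [E, F, G, H] p))"
    unfolding pairing_eq' sum_index_lists_4 prod_lessThan_4 by (simp add: * numeral_2_eq_2 numeral_3_eq_3)
  moreover have "pairing S 2 \<eta> (K_contr S \<zeta>) p
     = (\<Sum>Q\<in>UNIV. \<Sum>H\<in>UNIV. N Q H * (\<Sum>E\<in>UNIV. \<Sum>F\<in>UNIV. \<Sum>G\<in>UNIV. k E F G Q * cnj (\<zeta> [E, F, G, H] p)))"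
    unfolding pairing_eq' sum_index_lists_2 prod_lessThan_2
    by (simp add: N_def k_def K_contr_def mult_ac)
  ultimately show ?thesis
    by (simp add: sum_2 algebra_simps)
qed

end

section \<open>Symmetries of K and the passage to Omega\<close>

context vacuum_spin
begin

lemma K_spinor_sym2: "K_spinor S [C, D, A, B] p = K_spinor S [A, B, C, D] p"
  using chart_of.K_spinor_sym2_chart[OF chart_of_atlas[OF chart_at(1)] chart_at(2)] .

lemma K_spinor_sym3: "K_spinor S [A, B, D, C] p = K_spinor S [A, B, C, D] p"
  by (metis K_spinor_sym1 K_spinor_sym2)

lemma Omega_eq: "Omega S [A, B, C, D] p =
    (K_spinor S [A, B, C, D] p + K_spinor S [A, C, B, D] p + K_spinor S [A, D, B, C] p) / 3"
  unfolding Omega_def by (rule symmetrise_4) (rule K_spinor_sym1, rule K_spinor_sym2)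

text \<open>K differs from its totally symmetric part by a trace term built from eps_{AC} eps_{BD} +
  eps_{AD} eps_{BC}. Such a term vanishes once three of its indices are symmetrised, and contraction
  with a symmetric \<zeta> does that.\<close>

lemma Omega_contr:
  assumes \<zeta>: "\<And>xs ys. length xs = 4 \<Longrightarrow> mset ys = mset xs \<Longrightarrow> \<zeta> ys p = \<zeta> xs p"
  shows "(\<Sum>A\<in>UNIV. \<Sum>B\<in>UNIV. \<Sum>F\<in>UNIV. raise 3 (Omega S) [A, B, F, C] p * \<zeta> [D, A, B, F] p)
    = K_contr S \<zeta> [C, D] p"
proof -
  define k where "k A B C D = K_spinor S [A, B, C, D] p" for A B C D
  have k: "k 2 1 C D = k 1 2 C D" "k C D 2 1 = k C D 1 2" "k 1 2 1 1 = k 1 1 1 2" "k 2 2 1 1 = k 1 1 2 2"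
    "k 2 2 1 2 = k 1 2 2 2" for C D
    by (simp_all add: k_def K_spinor_sym1 K_spinor_sym2 K_spinor_sym3)
  define z where "z A B F = \<zeta> [A, B, F, D] p" for A B F
  have z: "z 1 2 1 = z 1 1 2" "z 2 1 1 = z 1 1 2" "z 2 1 2 = z 1 2 2" "z 2 2 1 = z 1 2 2"
    unfolding z_def by (auto intro!: \<zeta>)
  have z': "\<zeta> [D, A, B, F] p = z A B F" for A B F
    unfolding z_def by (auto intro!: \<zeta>)
  have r: "raise 3 (Omega S) [A, B, F, C] p = (\<Sum>X\<in>UNIV. \<Sum>Y\<in>UNIV. \<Sum>Z\<in>UNIV.
     eps A X * eps B Y * eps F Z * ((k X Y Z C + k X Z Y C + k X C Y Z) / 3))" for A B F
    by (simp add: raise_def numeral_eq_Suc sum_index_lists_Suc Omega_eq k_def mult_ac del: length_0_conv)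
  have K: "K_contr S \<zeta> [C, D] p = (\<Sum>E\<in>UNIV. \<Sum>F\<in>UNIV. \<Sum>G\<in>UNIV. (\<Sum>X\<in>UNIV. \<Sum>Y\<in>UNIV. \<Sum>Z\<in>UNIV.
     eps E X * eps F Y * eps G Z * k X Y Z C) * z E F G)"
    by (simp add: K_contr_def K_up_def k_def z_def)
  have "C = 1 \<or> C = 2" by (rule exhaust_2)
  then show ?thesis
    unfolding r z' K by (elim disjE) (simp_all add: sum_2 k z field_simps)
qed

end

lemma length_4E:
  assumes "length xs = 4" obtains A B C D where "xs = [A, B, C, D]"
  using assms by (auto simp: numeral_eq_Suc length_Suc_conv)

lemma length_2E:
  assumes "length xs = 2" obtains A B where "xs = [A, B]"
  using assms by (auto simp: numeral_eq_Suc length_Suc_conv)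

lemma symmetric_smooth: "symmetric_spinor_field S n \<phi> \<Longrightarrow> smooth_spinor_field S n \<phi>"
  unfolding symmetric_spinor_field_def by blast

lemma symmetric_mset:
  "symmetric_spinor_field S n \<phi> \<Longrightarrow> length xs = n \<Longrightarrow> mset ys = mset xs \<Longrightarrow> \<phi> ys = \<phi> xs"
  unfolding symmetric_spinor_field_def by blast

lemma symmetrise_symmetric_field:
  "symmetric_spinor_field S n \<phi> \<Longrightarrow> length xs = n \<Longrightarrow> symmetrise \<phi> xs p = \<phi> xs p"
  by (intro symmetrise_symmetric fun_cong[OF symmetric_mset])

lemma (in vacuum_spin) smooth_fun_spinor:
  "smooth_spinor_field S n \<phi> \<Longrightarrow> length xs = n \<Longrightarrow> smooth_fun S (\<phi> xs)"
  by (simp add: smooth_spinor_field_def smooth_fun_def)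

context chart_of
begin

lemma smooth_spinor_chart:
  "smooth_spinor_field S n \<phi> \<Longrightarrow> length xs = n \<Longrightarrow> smooth_in_chart c (\<phi> xs)"
  using c_atlas by (simp add: smooth_spinor_field_def)

text \<open>The K terms of \<open>sen\<close> for the two indices of \<eta> differ by exchanging C
  and D. Against a symmetric \<zeta> they pair equally, so their half-sum may be replaced by the
  single term \<open>K_mult\<close>.\<close>

lemma pairing_sen:
  assumes p: "p \<in> fst c" and \<eta>: "symmetric_spinor_field S 2 \<eta>" and \<zeta>: "symmetric_spinor_field S 4 \<zeta>"
  shows "pairing S 4 (sen S \<eta>) \<zeta> p = pairing S 4 (D_grad S c \<eta>) \<zeta> p + pairing S 4 (K_mult S \<eta>) \<zeta> p"
proof -
  define w where "w A B C D = raise 4 (hat S \<zeta>) [A, B, C, D] p" for A B C D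
  have w: "w A B D C = w A B C D" for A B C D
    unfolding w_def by (rule raise_hat_mset) (auto intro: fun_cong[OF symmetric_mset[OF \<zeta>]])
  have sen: "sen S \<eta> [A, B, C, D] p = D_grad S c \<eta> [A, B, C, D] p
      + (K_mult S \<eta> [A, B, C, D] p + K_mult S \<eta> [A, B, D, C] p) / 2" for A B C D
  proof -
    have "\<eta> [C, Q] = \<eta> [Q, C]" for Q
      by (rule symmetric_mset[OF \<eta>]) auto
    then show ?thesis
      using sen_chart[of p \<eta> "[C, D]" A B] p smooth_fun_spinor[OF symmetric_smooth[OF \<eta>], of "[C, D]"]
      by (simp add: D_grad_def K_mult_def numeral_2_eq_2 numeral_3_eq_3 lessThan_Suc add_divide_distrib del: sen.simps)
  qed
  have "(\<Sum>A\<in>UNIV. \<Sum>B\<in>UNIV. \<Sum>C\<in>UNIV. \<Sum>D\<in>UNIV. K_mult S \<eta> [A, B, D, C] p * w A B C D)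
      = (\<Sum>A\<in>UNIV. \<Sum>B\<in>UNIV. \<Sum>C\<in>UNIV. \<Sum>D\<in>UNIV. K_mult S \<eta> [A, B, C, D] p * w A B C D)"
    by (subst (3) sum.swap) (simp add: w)
  then have "pairing S 4 (sen S \<eta>) \<zeta> p = pairing S 4 (D_grad S c \<eta>) \<zeta> p
     + (pairing S 4 (K_mult S \<eta>) \<zeta> p + pairing S 4 (K_mult S \<eta>) \<zeta> p) / 2"
    unfolding pairing_def sum_index_lists_4 sen w_def[symmetric]
    by (simp add: distrib_right sum.distrib sum_divide_distrib[symmetric])
  then show ?thesis by simp
qed

lemma pairing_sum_right: "pairing S n w (\<lambda>xs p. \<Sum>i\<in>I. u i xs p) p = (\<Sum>i\<in>I. pairing S n w (u i) p)"
  unfolding pairing_eq by (simp only: cnj_sum sum_distrib_left) (rule sum_rotate)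

lemma pairing_sum_left: "pairing S n (\<lambda>xs p. \<Sum>i\<in>I. u i xs p) w p = (\<Sum>i\<in>I. pairing S n (u i) w p)"
  unfolding pairing_def by (simp only: sum_distrib_right) (rule sum.swap)

lemma smooth_flux:
  assumes "smooth_spinor_field S 2 \<eta>" "smooth_spinor_field S 4 \<zeta>"
  shows "smooth_in_chart c (flux S c \<eta> \<zeta> a)"
  unfolding flux_def[abs_def] pairing_def
  by (intro smooth_sum smooth_mult smooth_solder raise_hat_smooth smooth_spinor_chart[OF assms(1)]
      smooth_spinor_chart[OF assms(2)]) simp_all

text \<open>Holds for each a separately, before summation. The lower-index connection terms of sigma
  and \<eta> cancel against the upper-index ones of the hatted \<zeta>, by index transfer; only the
  Christoffel term from the vector index of sigma is left.\<close>

lemma flux_deriv: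
  assumes p: "p \<in> fst c" and \<eta>: "smooth_spinor_field S 2 \<eta>" and \<zeta>: "smooth_spinor_field S 4 \<zeta>"
  shows "chart_deriv c a (flux S c \<eta> \<zeta> a) p =
    - (\<Sum>d\<in>UNIV. of_real (christoffel S c p a a d) * flux S c \<eta> \<zeta> d p)
    + pairing S 4 (\<lambda>xs q. solder S c q a (xs ! 0) (xs ! 1) * cov_deriv S c a \<eta> (drop 2 xs) q) \<zeta> p
    + pairing S 4 (\<lambda>xs q. solder S c q a (xs ! 0) (xs ! 1) * \<eta> (drop 2 xs) q) (cov_deriv S c a \<zeta>) p"
proof -
  let ?g = "conn S c p a"
  define t where "t d xs q = solder S c q d (xs ! 0) (xs ! 1) * \<eta> (drop 2 xs) q" for d xs q
  define w where "w = raise 4 (hat S \<zeta>)"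
  have smt: "smooth_in_chart c (t d xs)" if "length xs = 4" for d xs
    unfolding t_def using that by (intro smooth_mult smooth_solder smooth_spinor_chart[OF \<eta>]) simp
  have smw: "smooth_in_chart c (w xs)" if "length xs = 4" for xs
    unfolding w_def using that by (intro raise_hat_smooth smooth_spinor_chart[OF \<zeta>])
  \<comment> \<open>The connection terms of the solder form supply k = 0, 1 of the sum, those of
    \<eta> supply k = 2, 3.\<close>
  have dt: "chart_deriv c a (t a xs) p = solder S c p a (xs ! 0) (xs ! 1) * cov_deriv S c a \<eta> (drop 2 xs) p
      - (\<Sum>d\<in>UNIV. of_real (christoffel S c p a a d) * t d xs p)
      + (\<Sum>k<4. \<Sum>Q\<in>UNIV. ?g (xs ! k) Q * t a (xs[k := Q]) p)" if "length xs = 4" for xs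
  proof -
    obtain A B C D where xs: "xs = [A, B, C, D]" using \<open>length xs = 4\<close> by (rule length_4E)
    have "chart_deriv c a (t a xs) p = solder S c p a A B * chart_deriv c a (\<eta> [C, D]) p
        + chart_deriv c a (\<lambda>q. solder S c q a A B) p * \<eta> [C, D] p"
      unfolding t_def xs using chart_deriv_mult[OF smooth_solder smooth_spinor_chart[OF \<eta>] p, of "[C, D]"]
      by (simp add: numeral_2_eq_2)
    also have "chart_deriv c a (\<eta> [C, D]) p = cov_deriv S c a \<eta> [C, D] p
        + (\<Sum>Q\<in>UNIV. ?g C Q * \<eta> [Q, D] p) + (\<Sum>Q\<in>UNIV. ?g D Q * \<eta> [C, Q] p)"
      by (simp add: cov_deriv_def numeral_2_eq_2 lessThan_Suc)
    finally show ?thesis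
      unfolding xs sum_lessThan_4 t_def
      by (simp add: solder_deriv[OF p] numeral_2_eq_2 numeral_3_eq_3 sum_2 sum_3 algebra_simps)
  qed
  have dw: "chart_deriv c a (w xs) p = raise 4 (hat S (cov_deriv S c a \<zeta>)) xs p
      - (\<Sum>k<4. \<Sum>Q\<in>UNIV. ?g Q (xs ! k) * w (xs[k := Q]) p)" if "length xs = 4" for xs
    unfolding w_def using that by (intro raise_hat_deriv p smooth_spinor_chart[OF \<zeta>])
  have transfer: "(\<Sum>xs | length xs = 4. (\<Sum>k<4. \<Sum>Q\<in>UNIV. ?g (xs ! k) Q * t a (xs[k := Q]) p) * w xs p)
      = (\<Sum>xs | length xs = 4. t a xs p * (\<Sum>k<4. \<Sum>Q\<in>UNIV. ?g Q (xs ! k) * w (xs[k := Q]) p))"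
  proof -
    have "(\<Sum>xs | length xs = 4. (\<Sum>k<4. \<Sum>Q\<in>UNIV. ?g (xs ! k) Q * t a (xs[k := Q]) p) * w xs p)
      = (\<Sum>k<4. \<Sum>xs | length xs = 4. (\<Sum>Q\<in>UNIV. ?g (xs ! k) Q * t a (xs[k := Q]) p) * w xs p)"
      by (subst sum.swap) (simp only: sum_distrib_right)
    also have "\<dots> = (\<Sum>k<4. \<Sum>xs | length xs = 4. t a xs p * (\<Sum>Q\<in>UNIV. ?g Q (xs ! k) * w (xs[k := Q]) p))"
      by (rule sum.cong[OF refl], rule sum_index_lists_transfer) simp
    also have "\<dots> = (\<Sum>xs | length xs = 4. t a xs p * (\<Sum>k<4. \<Sum>Q\<in>UNIV. ?g Q (xs ! k) * w (xs[k := Q]) p))"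
      by (subst sum.swap) (simp only: sum_distrib_left)
    finally show ?thesis .
  qed
  have F: "flux S c \<eta> \<zeta> d = (\<lambda>q. \<Sum>xs | length xs = 4. t d xs q * w xs q)" for d
    by (intro ext) (simp add: flux_def pairing_def t_def w_def)
  have "chart_deriv c a (flux S c \<eta> \<zeta> a) p =
      chart_deriv c a (\<lambda>q. \<Sum>xs | length xs = 4. t a xs q * w xs q) p"
    by (simp only: F)
  also have "\<dots> = (\<Sum>xs | length xs = 4. chart_deriv c a (\<lambda>q. t a xs q * w xs q) p)"
    by (rule chart_deriv_sum) (auto intro!: smooth_mult smt smw p)
  also have "\<dots> = (\<Sum>xs | length xs = 4. t a xs p * chart_deriv c a (w xs) p + chart_deriv c a (t a xs) p * w xs p)"
    by (intro sum.cong refl chart_deriv_mult smt smw p) auto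
  also have "\<dots> = (\<Sum>xs | length xs = 4. t a xs p * raise 4 (hat S (cov_deriv S c a \<zeta>)) xs p)
      + (\<Sum>xs | length xs = 4. solder S c p a (xs ! 0) (xs ! 1) * cov_deriv S c a \<eta> (drop 2 xs) p * w xs p)
      - (\<Sum>xs | length xs = 4. \<Sum>d\<in>UNIV. of_real (christoffel S c p a a d) * (t d xs p * w xs p))"
    using transfer by (simp add: dt dw ring_distribs sum.distrib sum_subtractf sum_distrib_right mult.assoc)
  also have "(\<Sum>xs | length xs = 4. \<Sum>d\<in>UNIV. of_real (christoffel S c p a a d) * (t d xs p * w xs p))
      = (\<Sum>d\<in>UNIV. of_real (christoffel S c p a a d) * (\<Sum>xs | length xs = 4. t d xs p * w xs p))"
    by (subst sum.swap) (simp add: sum_distrib_left)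
  finally show ?thesis
    by (simp add: F pairing_def t_def w_def)
qed

text \<open>The Sen divergence contributes the symmetrised K contraction with coefficient +1, and
  the Omega term subtracts it twice. The net coefficient -1 is the one produced by
  \<open>pairing_K_mult\<close>.\<close>

lemma Phi_adj_eq:
  assumes p: "p \<in> fst c" and \<zeta>: "symmetric_spinor_field S 4 \<zeta>"
  shows "Phi_adj S \<zeta> [C, D] p = D_div S c \<zeta> [C, D] p
    - (K_contr S \<zeta> [C, D] p + K_contr S \<zeta> [D, C] p) / 2"
proof -
  define k where "k A B C D = K_spinor S [A, B, C, D] p" for A B C D
  have k: "k 2 1 C D = k 1 2 C D" "k C D 2 1 = k C D 1 2" "k 1 2 1 1 = k 1 1 1 2" "k 2 2 1 1 = k 1 1 2 2"
    "k 2 2 1 2 = k 1 2 2 2" for C D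
    by (simp_all add: k_def K_spinor_sym1 K_spinor_sym2 K_spinor_sym3)
  define z where "z A B F D = \<zeta> [A, B, F, D] p" for A B F D
  have z: "z 1 1 2 1 = z 1 1 1 2" "z 1 2 1 1 = z 1 1 1 2" "z 2 1 1 1 = z 1 1 1 2"
    "z 1 2 1 2 = z 1 1 2 2" "z 1 2 2 1 = z 1 1 2 2" "z 2 1 1 2 = z 1 1 2 2" "z 2 1 2 1 = z 1 1 2 2"
    "z 2 2 1 1 = z 1 1 2 2" "z 2 1 2 2 = z 1 2 2 2" "z 2 2 1 2 = z 1 2 2 2" "z 2 2 2 1 = z 1 2 2 2"
    unfolding z_def by (auto intro!: symmetric_mset[OF \<zeta>, THEN fun_cong])
  have K: "K_contr S \<zeta> [C, D] p = (\<Sum>E\<in>UNIV. \<Sum>F\<in>UNIV. \<Sum>G\<in>UNIV. (\<Sum>X\<in>UNIV. \<Sum>Y\<in>UNIV. \<Sum>Z\<in>UNIV.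
     eps E X * eps F Y * eps G Z * k X Y Z C) * z E F G D)" for C D
    by (simp add: K_contr_def K_up_def k_def z_def)
  have sen: "sen S \<zeta> [G, H, A, B, C, D] p = (\<Sum>a\<in>UNIV. solder S c p a G H * cov_deriv S c a \<zeta> [A, B, C, D] p)
    + (\<Sum>Q\<in>UNIV. \<Sum>R\<in>UNIV. eps Q R * (k G H A R * z Q B C D + k G H B R * z A Q C D
       + k G H C R * z A B Q D + k G H D R * z A B C Q)) / 2" for G H A B
    using sen_chart[of p \<zeta> "[A, B, C, D]" G H] p
      smooth_fun_spinor[OF symmetric_smooth[OF \<zeta>], of "[A, B, C, D]"]
    by (simp add: k_def z_def lessThan_Suc sum.distrib distrib_left mult.assoc del: sen.simps)
  have raise: "raise 2 \<phi> (A # B # xs) p = (\<Sum>G\<in>UNIV. \<Sum>H\<in>UNIV. eps A G * eps B H * \<phi> (G # H # xs) p)"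
    for \<phi> :: "'a spinor_field" and A B xs
    by (simp add: raise_def sum_index_lists_2 prod_lessThan_2)
  \<comment> \<open>The terms acting on the contracted indices A and B drop out: by its pair
    symmetry, K with one index of each pair contracted is antisymmetric in the other two, and
    \<zeta> is symmetric. The terms for C and D remain.\<close>
  have "(\<Sum>A\<in>UNIV. \<Sum>B\<in>UNIV. \<Sum>G\<in>UNIV. \<Sum>H\<in>UNIV. eps A G * eps B H *
      (\<Sum>Q\<in>UNIV. \<Sum>R\<in>UNIV. eps Q R * (k G H A R * z Q B C D + k G H B R * z A Q C D
       + k G H C R * z A B Q D + k G H D R * z A B C Q)))
      = K_contr S \<zeta> [C, D] p + K_contr S \<zeta> [D, C] p"
    unfolding K using exhaust_2[of C] exhaust_2[of D]
    by (elim disjE) (simp_all add: sum_2 k z algebra_simps)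
  then have "(\<Sum>A\<in>UNIV. \<Sum>B\<in>UNIV. raise 2 (sen S \<zeta>) (A # B # A # B # [C, D]) p)
      = D_div S c \<zeta> [C, D] p + (K_contr S \<zeta> [C, D] p + K_contr S \<zeta> [D, C] p) / 2"
    unfolding raise sen D_div_def
    by (simp only: distrib_left sum.distrib times_divide_eq_right sum_divide_distrib[symmetric])
  moreover have "symmetrise (\<lambda>ys q. \<Sum>A\<in>UNIV. \<Sum>B\<in>UNIV. \<Sum>F\<in>UNIV.
      raise 3 (Omega S) [A, B, F, ys ! 0] q * \<zeta> [ys ! 1, A, B, F] q) [C, D] p
      = (K_contr S \<zeta> [C, D] p + K_contr S \<zeta> [D, C] p) / 2"
  proof -
    have "(\<Sum>A\<in>UNIV. \<Sum>B\<in>UNIV. \<Sum>F\<in>UNIV. raise 3 (Omega S) [A, B, F, C] p * \<zeta> [D, A, B, F] p)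
        = K_contr S \<zeta> [C, D] p" for C D
      by (rule Omega_contr) (rule fun_cong[OF symmetric_mset[OF \<zeta>]])
    then show ?thesis unfolding symmetrise_2 by simp
  qed
  ultimately show ?thesis
    unfolding Phi_adj_def by (simp only:) (simp add: field_simps)
qed

definition div_flux :: "(3 \<Rightarrow> 'a \<Rightarrow> complex) \<Rightarrow> 'a \<Rightarrow> complex" where
  "div_flux X p = (\<Sum>a\<in>UNIV. chart_deriv c a (X a) p
     + (\<Sum>d\<in>UNIV. of_real (christoffel S c p a a d) * X d p))"

text \<open>Both pairings contain the same multiple of \<open>K_contr\<close>, since the
  symmetrisation in the adjoint can be shifted onto the symmetric \<eta>. Cancelling it leaves a
  pure Leibniz rule for D.\<close>

lemma adjoint_pointwise:
  assumes p: "p \<in> fst c" and \<eta>: "symmetric_spinor_field S 2 \<eta>" and \<zeta>: "symmetric_spinor_field S 4 \<zeta>"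
  shows "pairing S 4 (Phi S \<eta>) \<zeta> p - pairing S 2 \<eta> (Phi_adj S \<zeta>) p = div_flux (flux S c \<eta> \<zeta>) p"
proof -
  note sm = symmetric_smooth[OF \<eta>] symmetric_smooth[OF \<zeta>]
  have "pairing S 4 (Phi S \<eta>) \<zeta> p = pairing S 4 (sen S \<eta>) \<zeta> p"
    unfolding Phi_def pairing_symmetrise
    by (rule pairing_cong) (simp_all add: symmetrise_symmetric_field[OF \<zeta>])
  then have 1: "pairing S 4 (Phi S \<eta>) \<zeta> p = pairing S 4 (D_grad S c \<eta>) \<zeta> p - pairing S 2 \<eta> (K_contr S \<zeta>) p"
    by (simp add: pairing_sen[OF p \<eta> \<zeta>] pairing_K_mult[OF p])
  have "pairing S 2 \<eta> (Phi_adj S \<zeta>) p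
      = pairing S 2 \<eta> (\<lambda>xs p. D_div S c \<zeta> xs p - symmetrise (K_contr S \<zeta>) xs p) p"
    by (rule pairing_cong)
      (auto elim!: length_2E simp: Phi_adj_eq[OF p \<zeta>] symmetrise_2)
  also have "\<dots> = pairing S 2 \<eta> (D_div S c \<zeta>) p - pairing S 2 \<eta> (symmetrise (K_contr S \<zeta>)) p"
    by (rule pairing_diff_right)
  also have "pairing S 2 \<eta> (symmetrise (K_contr S \<zeta>)) p = pairing S 2 \<eta> (K_contr S \<zeta>) p"
    unfolding pairing_symmetrise[symmetric]
    by (rule pairing_cong) (simp_all add: symmetrise_symmetric_field[OF \<eta>])
  finally have 2: "pairing S 4 (Phi S \<eta>) \<zeta> p - pairing S 2 \<eta> (Phi_adj S \<zeta>) p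
      = pairing S 4 (D_grad S c \<eta>) \<zeta> p - pairing S 2 \<eta> (D_div S c \<zeta>) p"
    using 1 by simp
  have "D_div S c \<zeta> = (\<lambda>xs p. \<Sum>a\<in>UNIV. \<Sum>A\<in>UNIV. \<Sum>B\<in>UNIV. \<Sum>G\<in>UNIV. \<Sum>H\<in>UNIV.
      eps A G * eps B H * solder S c p a G H * cov_deriv S c a \<zeta> (A # B # xs) p)"
    by (intro ext) (simp add: D_div_def sum_2 sum_3 algebra_simps)
  then have "pairing S 2 \<eta> (D_div S c \<zeta>) p = - (\<Sum>a\<in>UNIV. pairing S 4
      (\<lambda>xs q. solder S c q a (xs ! 0) (xs ! 1) * \<eta> (drop 2 xs) q) (cov_deriv S c a \<zeta>) p)"
    unfolding pairing_solder[OF p] by (simp only: pairing_sum_right sum_negf minus_minus)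
  moreover have "pairing S 4 (D_grad S c \<eta>) \<zeta> p = (\<Sum>a\<in>UNIV. pairing S 4
      (\<lambda>xs q. solder S c q a (xs ! 0) (xs ! 1) * cov_deriv S c a \<eta> (drop 2 xs) q) \<zeta> p)"
    unfolding D_grad_def[abs_def] by (rule pairing_sum_left)
  ultimately show ?thesis
    unfolding 2 div_flux_def by (simp add: flux_deriv[OF p sm] sum.distrib)
qed

end

section \<open>The divergence theorem\<close>

text \<open>No Fubini is needed: the difference quotients of \<open>f\<close> integrate to 0 by translation invariance.\<close>

lemma integral_partial_eq_0:
  fixes f :: "real^3 \<Rightarrow> complex"
  assumes f: "Ck_on 1 UNIV f" and R: "\<And>x. x \<notin> cball 0 R \<Longrightarrow> f x = 0"
  shows "integrable lborel (\<lambda>x. frechet_derivative f (at x) (axis i 1))"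
    and "(LINT x|lborel. frechet_derivative f (at x) (axis i 1)) = 0"
proof -
  let ?e = "axis i 1 :: real^3"
  let ?f' = "\<lambda>x. frechet_derivative f (at x) ?e"
  have fd: "(f has_derivative frechet_derivative f (at x)) (at x)" for x
    using f by (simp add: frechet_derivative_works)
  have cf: "continuous_on UNIV f" by (rule Ck_on_continuous[OF f])
  have cf': "continuous_on UNIV ?f'" using f by simp
  have line: "((\<lambda>s. f (x + s *\<^sub>R ?e)) has_derivative (\<lambda>h. h *\<^sub>R ?f' (x + s *\<^sub>R ?e))) (at s)" for x s
  proof -
    have "((\<lambda>s. f (x + s *\<^sub>R ?e)) has_derivative (\<lambda>h. frechet_derivative f (at (x + s *\<^sub>R ?e)) (h *\<^sub>R ?e))) (at s)"
      by (rule has_derivative_compose[OF _ fd]) (auto intro!: derivative_eq_intros)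
    then show ?thesis
      using linear_scale[OF has_derivative_linear[OF fd]] by simp
  qed
  have f'0: "?f' x = 0" if "x \<notin> cball 0 R" for x
  proof -
    have "frechet_derivative f (at x) = frechet_derivative (\<lambda>_. 0) (at x)"
      by (rule frechet_derivative_cong_open[of "- cball 0 R"]) (use that R in auto)
    then show ?thesis by simp
  qed
  obtain B where B: "\<And>x. norm (?f' x) \<le> B" "B \<ge> 0"
  proof -
    have "bounded (?f' ` cball 0 R)"
      by (intro compact_imp_bounded compact_continuous_image continuous_on_subset[OF cf']) auto
    then obtain B where "\<forall>y\<in>?f' ` cball 0 R. norm y \<le> B"
      unfolding bounded_iff by blast
    then have "norm (?f' x) \<le> B" if "x \<in> cball 0 R" for x
      using that by blast
    then have "norm (?f' x) \<le> max B 0" for x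
      using f'0[of x] by (cases "x \<in> cball 0 R") (auto simp: le_max_iff_disj)
    then show ?thesis using that[of "max B 0"] by auto
  qed
  \<comment> \<open>Steps of length at most 1 keep every difference quotient supported in the ball
    of radius R + 1.\<close>
  define h where "h n = inverse (real (Suc n))" for n
  have h: "h n > 0" "h n \<le> 1" for n by (simp_all add: h_def field_simps)
  define g where "g n x = (f (x + h n *\<^sub>R ?e) - f x) /\<^sub>R h n" for n x
  have meas: "f \<in> borel_measurable borel" "?f' \<in> borel_measurable borel"
    using cf cf' by (auto intro: borel_measurable_continuous_onI)
  have mshift: "(\<lambda>x. f (x + h n *\<^sub>R ?e)) \<in> borel_measurable borel" for n
    by (intro borel_measurable_continuous_onI continuous_on_compose2[OF cf] continuous_intros) auto
  have int_f: "integrable lborel f"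
  proof -
    have "integrable lborel (\<lambda>x. indicator (cball 0 R) x *\<^sub>R f x)"
      using borel_integrable_compact[of "cball 0 R" f] continuous_on_subset[OF cf]
      by (auto simp: set_integrable_def)
    moreover have "(\<lambda>x. indicator (cball 0 R) x *\<^sub>R f x) = f"
      using R by (auto simp: indicator_def)
    ultimately show ?thesis by simp
  qed
  have shift: "integrable lborel (\<lambda>x. f (x + v))" "(LINT x|lborel. f (x + v)) = (LINT x|lborel. f x)" for v
  proof -
    have "integrable (distr lborel borel ((+) v)) f"
      using int_f by (simp add: lborel_distr_plus)
    then show "integrable lborel (\<lambda>x. f (x + v))"
      using meas(1) by (subst (asm) integrable_distr_eq) (auto simp: add.commute)
    have "(LINT x|distr lborel borel ((+) v). f x) = (LINT x|lborel. f (v + x))"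
      using meas(1) by (intro integral_distr) auto
    then show "(LINT x|lborel. f (x + v)) = (LINT x|lborel. f x)"
      by (simp add: lborel_distr_plus add.commute)
  qed
  have g0: "(LINT x|lborel. g n x) = 0" for n
    unfolding g_def using shift int_f by simp
  have lim: "(\<lambda>n. g n x) \<longlonglongrightarrow> ?f' x" for x
  proof -
    have "((\<lambda>s. (f (x + s *\<^sub>R ?e) - f x) /\<^sub>R s) \<longlongrightarrow> ?f' x) (at 0)"
    proof -
      have "((\<lambda>s. norm (f (x + s *\<^sub>R ?e) - f x - s *\<^sub>R ?f' x) / norm s) \<longlongrightarrow> 0) (at 0)"
        using line[of x 0] unfolding has_derivative_at by simp
      then have "((\<lambda>s. norm ((f (x + s *\<^sub>R ?e) - f x) /\<^sub>R s - ?f' x)) \<longlongrightarrow> 0) (at 0)"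
      proof (rule Lim_transform_eventually)
        have "norm (f (x + s *\<^sub>R ?e) - f x - s *\<^sub>R ?f' x) / norm s
            = norm ((f (x + s *\<^sub>R ?e) - f x) /\<^sub>R s - ?f' x)" if "s \<noteq> 0" for s
        proof -
          have "(f (x + s *\<^sub>R ?e) - f x) /\<^sub>R s - ?f' x = (f (x + s *\<^sub>R ?e) - f x - s *\<^sub>R ?f' x) /\<^sub>R s"
            using that by (simp add: scaleR_diff_right)
          then show ?thesis by (simp add: divide_inverse)
        qed
        then show "\<forall>\<^sub>F s in at 0. norm (f (x + s *\<^sub>R ?e) - f x - s *\<^sub>R ?f' x) / norm s
            = norm ((f (x + s *\<^sub>R ?e) - f x) /\<^sub>R s - ?f' x)"
          by (simp add: eventually_at_filter)
      qed
      then show ?thesis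
        by (rule LIM_zero_cancel[OF tendsto_norm_zero_cancel])
    qed
    moreover have "filterlim h (at 0) sequentially"
    proof -
      have "h \<longlonglongrightarrow> 0"
        using LIMSEQ_inverse_real_of_nat by (simp add: h_def[abs_def])
      then show ?thesis
        unfolding filterlim_at using h(1) by (simp add: less_imp_neq[symmetric])
    qed
    ultimately show ?thesis
      unfolding g_def by (rule filterlim_compose)
  qed
  \<comment> \<open>The mean value inequality along the i-th axis bounds the quotients uniformly by
    B, so dominated convergence applies on the enlarged ball.\<close>
  have bound: "norm (g n x) \<le> B * indicator (cball 0 (R + 1)) x" for n x
  proof (cases "x \<in> cball 0 (R + 1)")
    case True
    have "\<exists>s\<in>{0<..<h n}. norm (f (x + h n *\<^sub>R ?e) - f (x + 0 *\<^sub>R ?e)) \<le> norm ((h n - 0) *\<^sub>R ?f' (x + s *\<^sub>R ?e))"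
      by (rule mvt_general[OF h(1), of n "\<lambda>s. f (x + s *\<^sub>R ?e)" "\<lambda>s h. h *\<^sub>R ?f' (x + s *\<^sub>R ?e)"])
        (use line in \<open>auto intro!: continuous_on_compose2[OF cf] continuous_intros\<close>)
    then obtain s where "norm (f (x + h n *\<^sub>R ?e) - f x) \<le> h n * norm (?f' (x + s *\<^sub>R ?e))"
      using h(1)[of n] by auto
    also have "\<dots> \<le> h n * B" using B h(1)[of n] by (intro mult_left_mono) auto
    finally have "norm (f (x + h n *\<^sub>R ?e) - f x) / h n \<le> B"
      using h(1)[of n] by (simp add: divide_le_eq mult.commute)
    then show ?thesis using True h(1)[of n] by (simp add: g_def divide_inverse mult.commute)
  next
    case False
    then have x: "norm x > R + 1" by simp
    have "norm x \<le> norm (x + h n *\<^sub>R ?e) + norm (h n *\<^sub>R ?e)"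
      by (metis add_diff_cancel norm_triangle_ineq4)
    then have "norm (x + h n *\<^sub>R ?e) > R"
      using x h[of n] by simp
    then show ?thesis using x R[of x] R[of "x + h n *\<^sub>R ?e"] by (simp add: g_def)
  qed
  have dom: "integrable lborel (\<lambda>x::real^3. B * indicator (cball 0 (R + 1)) x :: real)"
    by (intro integrable_mult_right integrable_real_indicator) (use emeasure_compact_finite[OF compact_cball, of "0 :: real^3" "R + 1"] in auto)
  have mg: "g n \<in> borel_measurable lborel" for n
    unfolding g_def using mshift meas by measurable
  show "integrable lborel ?f'"
    by (rule integrable_dominated_convergence[of ?f' lborel g, OF _ mg dom])
      (use meas(2) lim bound in auto)
  have "(\<lambda>n. LINT x|lborel. g n x) \<longlonglongrightarrow> (LINT x|lborel. ?f' x)"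
    by (rule integral_dominated_convergence[of ?f' lborel g, OF _ mg dom])
      (use meas(2) lim bound in auto)
  then show "(LINT x|lborel. ?f' x) = 0"
    by (simp add: g0 LIMSEQ_const_iff)
qed

text \<open>The derivative of the 3 by 3 determinant at A in the direction B, expanded term by term
  to match the product rule applied to \<open>det_3\<close>.\<close>

definition det_deriv :: "real^3^3 \<Rightarrow> (3 \<Rightarrow> 3 \<Rightarrow> real) \<Rightarrow> real" where
  "det_deriv A B =
     B 1 1 * A$2$2 * A$3$3 + A$1$1 * B 2 2 * A$3$3 + A$1$1 * A$2$2 * B 3 3
   + B 1 2 * A$2$3 * A$3$1 + A$1$2 * B 2 3 * A$3$1 + A$1$2 * A$2$3 * B 3 1
   + B 1 3 * A$2$1 * A$3$2 + A$1$3 * B 2 1 * A$3$2 + A$1$3 * A$2$1 * B 3 2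
   - B 1 1 * A$2$3 * A$3$2 - A$1$1 * B 2 3 * A$3$2 - A$1$1 * A$2$3 * B 3 2
   - B 1 2 * A$2$1 * A$3$3 - A$1$2 * B 2 1 * A$3$3 - A$1$2 * A$2$1 * B 3 3
   - B 1 3 * A$2$2 * A$3$1 - A$1$3 * B 2 2 * A$3$1 - A$1$3 * A$2$2 * B 3 1"

text \<open>Write B = A C with C the inverse of A times B. The claim becomes a polynomial identity
  in the entries of A and C, with the trace of C on the right.\<close>

lemma jacobi_formula:
  assumes "invertible A"
  shows "det_deriv A B = det A * (\<Sum>i\<in>UNIV. \<Sum>j\<in>UNIV. matrix_inv A $ i $ j * B j i)"
proof -
  define C where "C i j = (\<Sum>k\<in>UNIV. matrix_inv A $ i $ k * B k j)" for i j
  have inv: "(\<Sum>k\<in>UNIV. A $ i $ k * matrix_inv A $ k $ j) = (if i = j then 1 else 0)" for i j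
  proof -
    have "A ** matrix_inv A = mat 1"
      using someI_ex[OF assms[unfolded invertible_def]] by (simp add: matrix_inv_def)
    then have "(A ** matrix_inv A) $ i $ j = mat 1 $ i $ j" by simp
    then show ?thesis by (simp add: matrix_matrix_mult_def mat_def)
  qed
  have B: "B i j = (\<Sum>k\<in>UNIV. A $ i $ k * C k j)" for i j
  proof -
    have "(\<Sum>k\<in>UNIV. A $ i $ k * C k j) = (\<Sum>l\<in>UNIV. (\<Sum>k\<in>UNIV. A $ i $ k * matrix_inv A $ k $ l) * B l j)"
      by (simp add: C_def sum_3 algebra_simps)
    then show ?thesis by (simp add: inv if_distrib[of "\<lambda>x. x * _"] cong: if_cong)
  qed
  have "det_deriv A (\<lambda>i j. \<Sum>k\<in>UNIV. A $ i $ k * C k j) = det A * (\<Sum>i\<in>UNIV. C i i)"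
    by (simp add: det_deriv_def det_3 sum_3 algebra_simps)
  then show ?thesis by (simp add: B[symmetric]) (simp add: C_def)
qed

section \<open>Volume density and Riemannian measure in a chart\<close>

context chart_of
begin

definition dens :: "'a \<Rightarrow> real" where
  "dens p = sqrt \<bar>det (metric S c p)\<bar>"

lemma metric_invertible: "p \<in> fst c \<Longrightarrow> invertible (metric S c p)"
proof -
  assume "p \<in> fst c"
  then have neg: "v \<noteq> 0 \<Longrightarrow> v \<bullet> (metric S c p *v v) < 0" for v
    using initial_data c_atlas by (auto simp: initial_data_set_def)
  have "inj ((*v) (metric S c p))"
    using neg unfolding matrix_vector_mul_linear[THEN linear_injective_0]
    by (metis inner_zero_right less_irrefl)
  then show ?thesis
    using invertible_left_inverse matrix_left_invertible_injective by blast
qed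

lemma det_metric_nz: "p \<in> fst c \<Longrightarrow> det (metric S c p) \<noteq> 0"
  using metric_invertible invertible_det_nz by blast

lemma smooth_det: "smooth_in_chart c (\<lambda>p. det (metric S c p))"
  unfolding det_3 by (intro smooth_add smooth_diff smooth_mult smooth_metric)

lemma dens_pos: "p \<in> fst c \<Longrightarrow> dens p > 0"
  using det_metric_nz by (simp add: dens_def)

lemma smooth_dens: "smooth_in_chart c dens"
proof -
  have d: "det (metric S c p) * det (metric S c p) > 0" if "p \<in> fst c" for p
    using det_metric_nz[OF that] by (metis not_real_square_gt_zero)
  \<comment> \<open>The absolute value is replaced by the root of the square, whose argument is
    positive because the determinant does not vanish.\<close>
  have "smooth_in_chart c (\<lambda>p. sqrt (sqrt (det (metric S c p) * det (metric S c p))))"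
    by (intro smooth_sqrt smooth_mult smooth_det real_sqrt_gt_zero d)
  then show ?thesis by (rule smooth_cong) (simp add: dens_def)
qed

text \<open>Two of the three derivative terms of the Christoffel symbol are exchanged by swapping a
  and b. They cancel in the trace because the inverse metric is symmetric.\<close>

lemma christoffel_trace:
  assumes p: "p \<in> fst c"
  shows "(\<Sum>a\<in>UNIV. christoffel S c p a a d) =
    (\<Sum>a\<in>UNIV. \<Sum>b\<in>UNIV. inv_metric S c p $ a $ b * chart_deriv c d (\<lambda>q. metric S c q $ b $ a) p) / 2"
proof -
  have "transpose (inv_metric S c p) = inv_metric S c p"
  proof -
    have t: "transpose (metric S c p) = metric S c p"
      using initial_data c_atlas p by (auto simp: initial_data_set_def)
    let ?A = "metric S c p"
    have 1: "?A ** inv_metric S c p = mat 1" "inv_metric S c p ** ?A = mat 1"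
      using someI_ex[OF metric_invertible[OF p, unfolded invertible_def]]
      by (simp_all add: inv_metric_def matrix_inv_def)
    have "transpose (inv_metric S c p) ** ?A = mat 1"
      using arg_cong[OF 1(1), of transpose] by (simp add: matrix_transpose_mul t)
    then show ?thesis
      by (metis 1 matrix_mul_assoc matrix_mul_lid matrix_mul_rid)
  qed
  then have "transpose (inv_metric S c p) $ b $ a = inv_metric S c p $ b $ a" for a b
    by simp
  then have g: "inv_metric S c p $ a $ b = inv_metric S c p $ b $ a" for a b
    by (simp add: transpose_def)
  have m: "chart_deriv c e (\<lambda>q. metric S c q $ a $ b) p = chart_deriv c e (\<lambda>q. metric S c q $ b $ a) p" for e a b
    by (rule chart_deriv_cong[OF open_dom p p]) (rule metric_sym)
  show ?thesis
    unfolding christoffel_def sum_3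
    by (simp add: g[of 2 1] g[of 3 1] g[of 3 2] m[of _ 2 1] m[of _ 3 1] m[of _ 3 2] field_simps)
qed

text \<open>Jacobi's formula gives the derivative of the determinant as twice the determinant times
  the Christoffel trace, and the square root halves the factor.\<close>

lemma dens_deriv:
  assumes p: "p \<in> fst c"
  shows "chart_deriv c d dens p = dens p * (\<Sum>a\<in>UNIV. christoffel S c p a a d)"
proof -
  let ?T = "\<Sum>a\<in>UNIV. christoffel S c p a a d" and ?D = "det (metric S c p)"
  have "chart_deriv c d (\<lambda>q. det (metric S c q)) p =
      det_deriv (metric S c p) (\<lambda>i j. chart_deriv c d (\<lambda>q. metric S c q $ i $ j) p)"
    unfolding det_3 det_deriv_def diff_conv_add_uminus
    by (simp only: chart_deriv_add chart_deriv_minus chart_deriv_mult smooth_add smooth_minus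
        smooth_mult smooth_metric p) (simp add: algebra_simps)
  then have dD: "chart_deriv c d (\<lambda>q. det (metric S c q)) p = 2 * ?D * ?T"
    by (simp add: jacobi_formula[OF metric_invertible[OF p]] christoffel_trace[OF p] inv_metric_def)
  \<comment> \<open>The fourth power of the density is the square of the determinant.
    Differentiating this relation avoids any case distinction on the sign of the
    determinant.\<close>
  have sq: "dens q * dens q * (dens q * dens q) = det (metric S c q) * det (metric S c q)" for q
    by (simp add: dens_def)
  have "chart_deriv c d (\<lambda>q. dens q * dens q * (dens q * dens q)) p
      = chart_deriv c d (\<lambda>q. det (metric S c q) * det (metric S c q)) p"
    by (simp only: sq)
  then have "4 * (dens p * dens p * dens p) * chart_deriv c d dens p = 4 * (?D * ?D) * ?T"
    by (simp add: chart_deriv_mult smooth_mult smooth_dens smooth_det p dD algebra_simps)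
  also have "\<dots> = 4 * (dens p * dens p * dens p) * (dens p * ?T)"
    unfolding sq[symmetric] by simp
  finally show ?thesis using dens_pos[OF p] by simp
qed

lemma sets_vol: "sets (vol S) = sets borel" and space_vol: "space (vol S) = UNIV"
proof -
  show *: "sets (vol S) = sets borel"
    using initial_data by (simp add: initial_data_set_def riemannian_measure_def)
  show "space (vol S) = UNIV" using sets_eq_imp_space_eq[OF *] by simp
qed

lemma emeasure_vol_chart:
  "B \<in> sets borel \<Longrightarrow> B \<subseteq> fst c \<Longrightarrow>
    emeasure (vol S) B = (\<integral>\<^sup>+x\<in>snd c ` B. ennreal (dens (chart_inv c x)) \<partial>lborel)"
  using initial_data c_atlas by (simp add: initial_data_set_def riemannian_measure_def dens_def)

lemma dens_measurable [measurable]: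
  "(\<lambda>x. indicator U x * dens (chart_inv c x)) \<in> borel_measurable borel"
proof -
  have "continuous_on U (\<lambda>x. dens (chart_inv c x))"
    using smooth_dens smooth_on_continuous by (fastforce simp: smooth_in_chart_def o_def)
  then have "(\<lambda>x. indicator U x *\<^sub>R dens (chart_inv c x)) \<in> borel_measurable borel"
    using open_U by (intro borel_measurable_continuous_on_indicator) auto
  then show ?thesis by simp
qed

lemma emeasure_chart_compact:
  assumes K: "compact K" "K \<subseteq> fst c"
  shows "emeasure (vol S) K < \<infinity>"
proof -
  have cK: "compact (snd c ` K)"
    using K homeomorphism_cont1[OF homeo]
    by (intro compact_continuous_image) (auto intro: continuous_on_subset)
  have "continuous_on (snd c ` K) (\<lambda>x. dens (chart_inv c x))"
    using smooth_dens smooth_on_continuous K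
    by (fastforce simp: smooth_in_chart_def o_def intro: continuous_on_subset)
  then have "bounded ((\<lambda>x. dens (chart_inv c x)) ` snd c ` K)"
    by (intro compact_imp_bounded compact_continuous_image[OF _ cK])
  then obtain B where B: "\<forall>y\<in>(\<lambda>x. dens (chart_inv c x)) ` snd c ` K. norm y \<le> B"
    unfolding bounded_iff by blast
  have "emeasure (vol S) K = (\<integral>\<^sup>+x\<in>snd c ` K. ennreal (dens (chart_inv c x)) \<partial>lborel)"
    using K by (intro emeasure_vol_chart borel_compact)
  also have "\<dots> \<le> (\<integral>\<^sup>+x. ennreal B * indicator (snd c ` K) x \<partial>lborel)"
    using B by (intro nn_integral_mono) (auto simp: indicator_def intro!: ennreal_leI)
  also have "\<dots> = ennreal B * emeasure lborel (snd c ` K)"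
    using cK by (subst nn_integral_cmult_indicator) (auto intro: borel_compact)
  also have "\<dots> < \<infinity>"
    using emeasure_compact_finite[OF cK] by (simp add: ennreal_mult_less_top)
  finally show ?thesis .
qed

text \<open>The data fix \<open>vol\<close> only through its values on Borel sets inside the chart.
  These suffice to identify its restriction to the domain with the push-forward of the weighted
  Lebesgue measure, and then integrals transfer.\<close>

lemma integral_vol_chart:
  fixes f :: "'a \<Rightarrow> complex"
  assumes f: "f \<in> borel_measurable borel" and 0: "\<And>p. p \<notin> fst c \<Longrightarrow> f p = 0"
  shows "(LINT p|vol S. f p) = (LINT x|lborel. (indicator U x * dens (chart_inv c x)) *\<^sub>R f (chart_inv c x))"
proof (cases "fst c = {}")
  case True
  then show ?thesis using 0 by simp
next
  case False
  then obtain p0 where p0: "p0 \<in> fst c" by auto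
  \<comment> \<open>A total Borel map that agrees with \<open>chart_inv\<close> on U. Its value
    elsewhere is arbitrary, since the weight w vanishes off U.\<close>
  define \<phi> where "\<phi> x = (if x \<in> U then chart_inv c x else p0)" for x
  define w where "w x = indicator U x * dens (chart_inv c x)" for x
  have w: "w \<in> borel_measurable borel" "w x \<ge> 0" for x
    using dens_measurable dens_pos by (auto simp: w_def[abs_def] indicator_def less_imp_le)
  have \<phi>: "\<phi> \<in> borel_measurable borel"
    unfolding \<phi>_def
    by (rule borel_measurable_continuous_on_if[OF _ homeomorphism_cont2[OF homeo]]) (use open_U in auto)
  have dom: "fst c \<in> sets (vol S)" using open_dom by (simp add: sets_vol)
  have "distr (density lborel (\<lambda>x. ennreal (w x))) borel \<phi> = density (vol S) (indicator (fst c))"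
  proof (rule measure_eqI)
    show "sets (distr (density lborel (\<lambda>x. ennreal (w x))) borel \<phi>) = sets (density (vol S) (indicator (fst c)))"
      by (simp add: sets_vol)
    fix B assume "B \<in> sets (distr (density lborel (\<lambda>x. ennreal (w x))) borel \<phi>)"
    then have B: "B \<in> sets borel" by simp
    have pre: "\<phi> -` B \<in> sets borel"
      using measurable_sets[OF \<phi> B] by simp
    have "emeasure (distr (density lborel (\<lambda>x. ennreal (w x))) borel \<phi>) B
        = emeasure (density lborel (\<lambda>x. ennreal (w x))) (\<phi> -` B)"
      using \<phi> B by (simp add: emeasure_distr)
    also have "\<dots> = (\<integral>\<^sup>+x. ennreal (w x) * indicator (\<phi> -` B) x \<partial>lborel)"
      using w(1) pre by (intro emeasure_density) auto
    also have "\<dots> = (\<integral>\<^sup>+x\<in>snd c ` (B \<inter> fst c). ennreal (dens (chart_inv c x)) \<partial>lborel)"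
    proof (rule nn_integral_cong)
      fix x
      have "x \<in> snd c ` (B \<inter> fst c) \<longleftrightarrow> x \<in> U \<and> x \<in> \<phi> -` B"
        by (auto simp: \<phi>_def intro: rev_image_eqI)
      then show "ennreal (w x) * indicator (\<phi> -` B) x
          = ennreal (dens (chart_inv c x)) * indicator (snd c ` (B \<inter> fst c)) x"
        by (auto simp: w_def indicator_def)
    qed
    also have "\<dots> = emeasure (vol S) (B \<inter> fst c)"
      using B open_dom by (intro emeasure_vol_chart[symmetric]) auto
    also have "\<dots> = emeasure (density (vol S) (indicator (fst c))) B"
      using B dom by (subst emeasure_density) (auto intro!: borel_measurable_indicator simp: sets_vol indicator_inter_arith[symmetric] Int_commute)
    finally show "emeasure (distr (density lborel (\<lambda>x. ennreal (w x))) borel \<phi>) B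
        = emeasure (density (vol S) (indicator (fst c))) B" .
  qed
  then have "(LINT p|density (vol S) (\<lambda>p. ennreal (indicator (fst c) p)). f p)
      = (LINT p|distr (density lborel (\<lambda>x. ennreal (w x))) borel \<phi>. f p)"
    by (simp add: ennreal_indicator)
  also have "\<dots> = (LINT x|density lborel (\<lambda>x. ennreal (w x)). f (\<phi> x))"
    using \<phi> f by (intro integral_distr) auto
  also have "\<dots> = (LINT x|lborel. w x *\<^sub>R f (\<phi> x))"
    using w measurable_compose[OF \<phi> f] by (intro integral_density) auto
  also have "\<dots> = (LINT x|lborel. w x *\<^sub>R f (chart_inv c x))"
    by (intro Bochner_Integration.integral_cong refl) (auto simp: w_def \<phi>_def)
  also have "(LINT p|density (vol S) (\<lambda>p. ennreal (indicator (fst c) p)). f p)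
      = (LINT p|vol S. indicator (fst c) p *\<^sub>R f p)"
  proof (rule integral_density)
    show "f \<in> borel_measurable (vol S)"
      using f measurable_cong_sets[OF sets_vol refl] by blast
  qed (use dom in auto)
  also have "\<dots> = (LINT p|vol S. f p)"
    by (intro Bochner_Integration.integral_cong refl) (auto simp: 0 indicator_def)
  finally show ?thesis by (simp add: w_def)
qed

text \<open>Multiplied by the density, the covariant divergence becomes a sum of coordinate
  derivatives, by \<open>dens_deriv\<close>; each of these integrates to 0. The integrand is a
  separate f because \<open>div_flux\<close> has a meaning only on the chart domain.\<close>

lemma integral_div_flux:
  assumes X: "\<And>a. smooth_in_chart c (X a)" and K: "compact K" "K \<subseteq> fst c"
    and 0: "\<And>a p. p \<in> fst c \<Longrightarrow> p \<notin> K \<Longrightarrow> X a p = 0"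
    and f: "f \<in> borel_measurable borel" "\<And>p. p \<in> fst c \<Longrightarrow> f p = div_flux X p"
      "\<And>p. p \<notin> fst c \<Longrightarrow> f p = 0"
  shows "(LINT p|vol S. f p) = 0"
proof -
  \<comment> \<open>The density times the component of X, in coordinates and extended by zero. The
    extension is smooth because K is compact inside the domain.\<close>
  define Y where "Y a x = (if x \<in> U then of_real (dens (chart_inv c x)) * X a (chart_inv c x) else 0)" for a x
  have cK: "compact (snd c ` K)"
    using K homeomorphism_cont1[OF homeo]
    by (intro compact_continuous_image) (auto intro: continuous_on_subset)
  obtain R where R: "snd c ` K \<subseteq> cball 0 R"
    using compact_imp_bounded[OF cK] by (auto simp: bounded_iff subset_iff)
  have Y0: "Y a x = 0" if "x \<notin> snd c ` K" for a x
    using that 0[of "chart_inv c x" a] by (force simp: Y_def)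
  have smDX: "smooth_in_chart c (\<lambda>p. of_real (dens p) * X a p)" for a
    by (intro smooth_mult smooth_of_real smooth_dens X)
  have "smooth_on UNIV (Y a)" for a
  proof (rule smooth_on_local)
    fix x :: "real^3"
    show "\<exists>V. open V \<and> x \<in> V \<and> smooth_on V (Y a)"
    proof (cases "x \<in> U")
      case True
      have "smooth_on U (Y a)"
        by (rule smooth_on_cong[OF open_U _ smDX[of a, unfolded smooth_in_chart_def]]) (simp add: Y_def)
      then show ?thesis using open_U True by blast
    next
      case False
      have "open (- (snd c ` K))" using cK by (simp add: compact_imp_closed open_Compl)
      moreover have "smooth_on (- (snd c ` K)) (Y a)"
        by (rule smooth_on_cong[OF calculation _ smooth_on_const[of _ 0]]) (simp add: Y0)
      moreover have "x \<in> - (snd c ` K)" using False K by auto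
      ultimately show ?thesis by blast
    qed
  qed
  then have Y1: "Ck_on 1 UNIV (Y a)" for a by (rule smooth_onD)
  have I: "integrable lborel (\<lambda>x. frechet_derivative (Y a) (at x) (axis a 1))"
    "(LINT x|lborel. frechet_derivative (Y a) (at x) (axis a 1)) = 0" for a
    using integral_partial_eq_0[OF Y1[of a], of R a] Y0[of _ a] R by blast+
  have dY: "frechet_derivative (Y a) (at x) (axis a 1)
      = (if x \<in> U then chart_deriv c a (\<lambda>p. of_real (dens p) * X a p) (chart_inv c x) else 0)" for a x
  proof (cases "x \<in> U")
    case True
    have "frechet_derivative (Y a) (at x)
        = frechet_derivative ((\<lambda>p. of_real (dens p) * X a p) \<circ> chart_inv c) (at x)"
      by (rule frechet_derivative_cong_open[OF open_U True]) (simp add: Y_def)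
    then show ?thesis using True by (auto simp: chart_deriv_def)
  next
    case False
    have "open (- (snd c ` K))" using cK by (simp add: compact_imp_closed open_Compl)
    then have "frechet_derivative (Y a) (at x) = frechet_derivative (\<lambda>_. 0) (at x)"
      by (rule frechet_derivative_cong_open) (use False K Y0 in auto)
    then show ?thesis using False by simp
  qed
  have *: "(\<Sum>a\<in>UNIV. chart_deriv c a (\<lambda>p. of_real (dens p) * X a p) p) = of_real (dens p) * div_flux X p"
    if p: "p \<in> fst c" for p
  proof -
    have "chart_deriv c a (\<lambda>p. of_real (dens p) * X a p) p = of_real (dens p) * (chart_deriv c a (X a) p
        + (\<Sum>d\<in>UNIV. of_real (christoffel S c p d d a)) * X a p)" for a
      by (simp add: chart_deriv_mult smooth_of_real smooth_dens X p chart_deriv_of_real dens_deriv[OF p]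
          algebra_simps)
    moreover have "(\<Sum>a\<in>UNIV. (\<Sum>d\<in>UNIV. of_real (christoffel S c p d d a)) * X a p)
      = (\<Sum>a\<in>UNIV. \<Sum>d\<in>UNIV. of_real (christoffel S c p a a d) * X d p)"
      unfolding sum_distrib_right by (rule sum.swap)
    ultimately show ?thesis
      by (simp add: div_flux_def sum.distrib distrib_left flip: sum_distrib_left)
  qed
  have "(LINT p|vol S. f p) = (LINT x|lborel. (indicator U x * dens (chart_inv c x)) *\<^sub>R f (chart_inv c x))"
    by (rule integral_vol_chart[OF f(1,3)])
  also have "\<dots> = (LINT x|lborel. (\<Sum>a\<in>UNIV. frechet_derivative (Y a) (at x) (axis a 1)))"
    by (intro Bochner_Integration.integral_cong refl)
      (auto simp: dY indicator_def * f(2) scaleR_conv_of_real)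
  also have "\<dots> = 0"
    using I by (simp add: Bochner_Integration.integral_sum)
  finally show ?thesis .
qed

end

section \<open>Linearity, support and symmetry of the operators\<close>

lemma symmetrise_linear:
  assumes "\<And>ys. length ys = length xs \<Longrightarrow> w ys p = u ys p + k * v ys p"
  shows "symmetrise w xs p = symmetrise u xs p + k * symmetrise v xs p"
proof -
  have "symmetrise w xs p =
      (\<Sum>\<pi> | \<pi> permutes {..<length xs}. u (permute_list \<pi> xs) p + k * v (permute_list \<pi> xs) p) / fact (length xs)"
    unfolding symmetrise_def by (intro arg_cong2[of _ _ _ _ "(/)"] sum.cong refl assms) auto
  then show ?thesis
    by (simp add: symmetrise_def sum.distrib sum_distrib_left add_divide_distrib)
qed

lemma (in chart_of) cov_deriv_linear:
  assumes "p \<in> fst c" "smooth_in_chart c (u xs)" "smooth_in_chart c (v xs)"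
  shows "cov_deriv S c a (\<lambda>xs q. u xs q + k * v xs q) xs p = cov_deriv S c a u xs p + k * cov_deriv S c a v xs p"
  using assms
  by (simp add: cov_deriv_def chart_deriv_add chart_deriv_cmult smooth_mult distrib_left sum.distrib
      sum_distrib_left right_diff_distrib mult_ac)

context vacuum_spin
begin

lemma sen_linear:
  assumes "smooth_fun S (u xs)" "smooth_fun S (v xs)"
  shows "sen S (\<lambda>xs q. u xs q + k * v xs q) (A # B # xs) p = sen S u (A # B # xs) p + k * sen S v (A # B # xs) p"
proof -
  interpret chart_of S "chart_at S p" by (rule chart_of_atlas[OF chart_at(1)])
  have "cov_deriv S (chart_at S p) a (\<lambda>xs q. u xs q + k * v xs q) xs p
      = cov_deriv S (chart_at S p) a u xs p + k * cov_deriv S (chart_at S p) a v xs p" for a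
    by (rule cov_deriv_linear) (use assms chart_at c_atlas in \<open>auto simp: smooth_fun_def\<close>)
  then show ?thesis
    by (simp add: Let_def distrib_left sum.distrib sum_distrib_left add_divide_distrib mult_ac)
qed

lemma Phi_linear:
  assumes "smooth_spinor_field S 2 u" "smooth_spinor_field S 2 v" "length xs = 4"
  shows "Phi S (\<lambda>xs q. u xs q + k * v xs q) xs p = Phi S u xs p + k * Phi S v xs p"
  unfolding Phi_def
proof (rule symmetrise_linear)
  fix ys :: "2 list" assume "length ys = length xs"
  then obtain A B C D where "ys = [A, B, C, D]" using assms(3) by (auto elim: length_4E)
  then show "sen S (\<lambda>xs q. u xs q + k * v xs q) ys p = sen S u ys p + k * sen S v ys p"
    using sen_linear[of u "[C, D]" v k A B p] assms smooth_fun_spinor[of 2 _ "[C, D]"] by simp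
qed

text \<open>Closedness of C matters: \<eta> then vanishes on a neighbourhood of p, so its
  derivatives vanish at p as well.\<close>

lemma Phi_zero_outside:
  assumes "closed C" "supported_in \<eta> 2 C" "p \<notin> C" "length xs = 4"
  shows "Phi S \<eta> xs p = 0"
proof -
  interpret chart_of S "chart_at S p" by (rule chart_of_atlas[OF chart_at(1)])
  have 0: "\<eta> ys q = 0" if "length ys = 2" "q \<notin> C" for ys q
    using assms(2) that by (simp add: supported_in_def)
  have "sen S \<eta> ys p = 0" if ys: "length ys = 4" for ys
  proof -
    obtain A B C' D where ys: "ys = [A, B, C', D]" using ys by (rule length_4E)
    have "chart_deriv (chart_at S p) a (\<eta> [C', D]) p = chart_deriv (chart_at S p) a (\<lambda>_. 0) p" for a
      by (rule chart_deriv_cong[of "- C"]) (use assms chart_at 0 in auto)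
    then show ?thesis
      using assms(3) by (simp add: ys cov_deriv_def chart_deriv_const 0 Let_def)
  qed
  then show ?thesis
    using assms(4) by (simp add: Phi_def symmetrise_def)
qed

lemma Phi_symmetric:
  assumes "symmetric_spinor_field S 2 \<kappa>" shows "symmetric_spinor_field S 4 (Phi S \<kappa>)"
  unfolding symmetric_spinor_field_def
proof (intro conjI allI impI)
  have "smooth_spinor_field S 4 (sen S \<kappa>)"
    using smooth_sen_field[OF symmetric_smooth[OF assms]] by simp
  then show "smooth_spinor_field S 4 (Phi S \<kappa>)"
    unfolding Phi_def by (rule smooth_symmetrise)
qed (auto simp: Phi_def intro: symmetrise_mset)

lemma smooth_pairing:
  assumes "smooth_spinor_field S n u" "smooth_spinor_field S n v"
  shows "smooth_fun S (pairing S n u v)"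
  unfolding smooth_fun_def
proof
  fix c assume "c \<in> atlas S"
  then interpret chart_of S c by (rule chart_of_atlas)
  show "smooth_in_chart c (pairing S n u v)"
    unfolding pairing_def[abs_def]
    by (intro smooth_sum smooth_mult raise_hat_smooth smooth_spinor_chart[OF assms(1)]
        smooth_spinor_chart[OF assms(2)]) simp_all
qed

text \<open>Both properties are read off from \<open>Phi_adj_eq\<close>, which is symmetric in C and
  D for symmetric \<zeta> and involves a single fixed chart.\<close>

lemma Phi_adj_symmetric:
  assumes \<zeta>: "symmetric_spinor_field S 4 \<zeta>"
  shows "symmetric_spinor_field S 2 (Phi_adj S \<zeta>)"
proof -
  have "Phi_adj S \<zeta> [D, C] p = Phi_adj S \<zeta> [C, D] p" for C D p
  proof -
    interpret chart_of S "chart_at S p" by (rule chart_of_atlas[OF chart_at(1)])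
    have z: "\<zeta> [A, B, D, C] = \<zeta> [A, B, C, D]" for A B C D
      by (rule symmetric_mset[OF \<zeta>]) auto
    have "cov_deriv S c a \<zeta> [A, B, D, C] p = cov_deriv S c a \<zeta> [A, B, C, D] p" for c a A B
      by (simp add: cov_deriv_def lessThan_Suc z[of _ _ D C] z[of _ _ D] z[of _ _ _ C])
    then show ?thesis
      by (simp add: Phi_adj_eq[OF chart_at(2) \<zeta>] D_div_def add.commute)
  qed
  moreover have "smooth_in_chart c (Phi_adj S \<zeta> [C, D])" if "c \<in> atlas S" for c C D
  proof -
    interpret chart_of S c using that by (rule chart_of_atlas)
    note z = smooth_spinor_chart[OF symmetric_smooth[OF \<zeta>]]
    have "smooth_in_chart c (\<lambda>p. D_div S c \<zeta> [C, D] p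
        - (K_contr S \<zeta> [C, D] p + K_contr S \<zeta> [D, C] p) / 2)"
      unfolding D_div_def K_contr_def K_up_def
      by (intro smooth_diff smooth_add smooth_divide_const smooth_sum smooth_mult smooth_const
          smooth_solder smooth_cov_deriv smooth_K_spinor z) simp_all
    then show ?thesis by (rule smooth_cong) (simp add: Phi_adj_eq[OF _ \<zeta>])
  qed
  moreover have "ys = [C, D] \<or> ys = [D, C]" if "mset ys = {#C, D#}" for ys :: "2 list" and C D
  proof -
    have "length ys = 2" using arg_cong[OF that, of size] by simp
    then obtain A B where "ys = [A, B]" by (rule length_2E)
    then show ?thesis using that by (auto simp: add_eq_conv_diff split: if_splits)
  qed
  ultimately show ?thesis
    unfolding symmetric_spinor_field_def smooth_spinor_field_def
    by (fastforce elim!: length_2E)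
qed

subsection \<open>Integration over the manifold\<close>

text \<open>Finiteness is known for compact sets inside one chart. Sets where some bump function is
  positive lie in such compact sets, and finitely many of them cover C.\<close>

lemma emeasure_compact:
  assumes "compact C" shows "emeasure (vol S) C < \<infinity>"
proof -
  have "\<exists>W K. open W \<and> p \<in> W \<and> W \<subseteq> K \<and> compact K \<and> emeasure (vol S) K < \<infinity>" for p
  proof -
    interpret chart_of S "chart_at S p" by (rule chart_of_atlas[OF chart_at(1)])
    obtain f :: "'a \<Rightarrow> real" and K where f: "smooth_fun S f" "\<forall>q. f q \<ge> 0" "f p > 0" "compact K"
      "K \<subseteq> UNIV \<inter> fst (chart_at S p)" "\<forall>q. q \<notin> K \<longrightarrow> f q = 0"
      using bump_exists[OF open_UNIV UNIV_I chart_at, of p] by blast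
    have "open {q. f q > 0}"
      using smooth_fun_continuous[OF f(1)] by (intro open_Collect_less continuous_on_const)
    moreover have "{q. f q > 0} \<subseteq> K" using f(6) by fastforce
    ultimately show ?thesis
      using f emeasure_chart_compact[OF f(4)] by blast
  qed
  then obtain W K where W: "\<And>p. open (W p)" "\<And>p. p \<in> W p" "\<And>p. W p \<subseteq> K p"
    "\<And>p. compact (K p)" "\<And>p. emeasure (vol S) (K p) < \<infinity>"
    by metis
  obtain T where T: "T \<subseteq> C" "finite T" "C \<subseteq> (\<Union>p\<in>T. W p)"
    using compactE_image[OF assms, of C W] W(1,2) by blast
  \<comment> \<open>The facts about the sigma-algebra of \<open>vol\<close> do not depend on the
    chart, so the chart at an arbitrary point gives access to them.\<close>
  interpret chart_of S "chart_at S undefined" by (rule chart_of_atlas[OF chart_at(1)])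
  have sK: "K p \<in> sets (vol S)" for p using W(4) by (simp add: sets_vol borel_compact)
  have "emeasure (vol S) C \<le> emeasure (vol S) (\<Union>p\<in>T. K p)"
  proof (rule emeasure_mono)
    show "C \<subseteq> (\<Union>p\<in>T. K p)" using T(3) W(3) by blast
  qed (use T(2) sK in auto)
  also have "\<dots> \<le> (\<Sum>p\<in>T. emeasure (vol S) (K p))"
    using T sK by (intro emeasure_subadditive_finite) auto
  also have "\<dots> < \<infinity>"
    using T W(5) by (simp add: sum_Pinfty less_top[symmetric] infinity_ennreal_def)
  finally show ?thesis .
qed

lemma measurable_smooth:
  fixes f :: "'a \<Rightarrow> complex"
  assumes "smooth_fun S f" shows "f \<in> borel_measurable borel" "f \<in> borel_measurable (vol S)"
proof -
  interpret chart_of S "chart_at S undefined" by (rule chart_of_atlas[OF chart_at(1)])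
  show "f \<in> borel_measurable borel"
    by (intro borel_measurable_continuous_onI smooth_fun_continuous assms)
  then show "f \<in> borel_measurable (vol S)"
    using measurable_cong_sets[OF sets_vol refl] by blast
qed

lemma set_integrable_smooth:
  fixes f :: "'a \<Rightarrow> complex"
  assumes "smooth_fun S f" "compact C" shows "set_integrable (vol S) C f"
proof -
  interpret chart_of S "chart_at S undefined" by (rule chart_of_atlas[OF chart_at(1)])
  have "bounded (f ` C)"
    using smooth_fun_continuous[OF assms(1)] assms(2)
    by (intro compact_imp_bounded compact_continuous_image) (auto intro: continuous_on_subset)
  then obtain B where B: "\<forall>y\<in>f ` C. norm y \<le> B"
    unfolding bounded_iff by blast
  have C: "C \<in> sets (vol S)" using assms(2) by (simp add: sets_vol borel_compact)
  show ?thesis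
    unfolding set_integrable_def
  proof (rule integrableI_bounded_set[where A = C and B = B])
    show "AE x in vol S. x \<in> C \<longrightarrow> norm (indicat_real C x *\<^sub>R f x) \<le> B"
      using B by (auto simp: indicator_def)
    show "(\<lambda>x. indicat_real C x *\<^sub>R f x) \<in> borel_measurable (vol S)"
      using C measurable_smooth(2)[OF assms(1)] by (intro borel_measurable_scaleR) auto
  qed (use C emeasure_compact[OF assms(2)] in auto)
qed

lemma integrable_smooth:
  fixes f :: "'a \<Rightarrow> complex"
  assumes "smooth_fun S f" "compact C" "\<And>p. p \<notin> C \<Longrightarrow> f p = 0"
  shows "integrable (vol S) f" "(LINT p:C|vol S. f p) = (LINT p|vol S. f p)"
proof -
  have e: "(\<lambda>p. indicat_real C p *\<^sub>R f p) = f" using assms(3) by (auto simp: indicator_def)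
  show "integrable (vol S) f"
    using set_integrable_smooth[OF assms(1,2)] unfolding set_integrable_def e .
  show "(LINT p:C|vol S. f p) = (LINT p|vol S. f p)"
    unfolding set_lebesgue_integral_def e ..
qed

section \<open>The integrated adjunction, from one chart to the whole manifold\<close>

lemma pairing_zero_left: "(\<And>xs. length xs = n \<Longrightarrow> u xs p = 0) \<Longrightarrow> pairing S n u v p = 0"
  by (simp add: pairing_def)

lemma pairing_zero_right: "(\<And>xs. length xs = n \<Longrightarrow> v xs p = 0) \<Longrightarrow> pairing S n u v p = 0"
  by (simp add: pairing_eq)

lemma symmetric_scale:
  assumes "smooth_fun S f" "symmetric_spinor_field S n \<eta>"
  shows "symmetric_spinor_field S n (\<lambda>xs p. f p * \<eta> xs p)"
  unfolding symmetric_spinor_field_def smooth_spinor_field_def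
proof (intro conjI allI impI ballI)
  fix xs :: "2 list" and c assume n: "length xs = n" and "c \<in> atlas S"
  then interpret chart_of S c by (simp add: chart_of_atlas)
  show "smooth_in_chart c (\<lambda>p. f p * \<eta> xs p)"
    using assms(1) c_atlas n
    by (intro smooth_mult smooth_spinor_chart[OF symmetric_smooth[OF assms(2)]]) (auto simp: smooth_fun_def)
next
  fix xs ys :: "2 list" assume "length xs = n \<and> mset ys = mset xs"
  then have "\<eta> ys = \<eta> xs" using symmetric_mset[OF assms(2)] by blast
  then show "(\<lambda>p. f p * \<eta> ys p) = (\<lambda>p. f p * \<eta> xs p)" by simp
qed

lemma symmetric_add:
  assumes "symmetric_spinor_field S n u" "symmetric_spinor_field S n v"
  shows "symmetric_spinor_field S n (\<lambda>xs p. u xs p + v xs p)"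
  unfolding symmetric_spinor_field_def smooth_spinor_field_def
proof (intro conjI allI impI ballI)
  fix xs :: "2 list" and c assume n: "length xs = n" and "c \<in> atlas S"
  then interpret chart_of S c by (simp add: chart_of_atlas)
  show "smooth_in_chart c (\<lambda>p. u xs p + v xs p)"
    using n by (intro smooth_add smooth_spinor_chart[OF symmetric_smooth[OF assms(1)]]
        smooth_spinor_chart[OF symmetric_smooth[OF assms(2)]])
next
  fix xs ys :: "2 list" assume "length xs = n \<and> mset ys = mset xs"
  then have "u ys = u xs" "v ys = v xs" using symmetric_mset assms by blast+
  then show "(\<lambda>p. u ys p + v ys p) = (\<lambda>p. u xs p + v xs p)" by simp
qed

lemma smooth_fun_const: "smooth_fun S (\<lambda>p. k)"
  unfolding smooth_fun_def using chart_of.smooth_const[OF chart_of_atlas] by blast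

lemma smooth_fun_of_real: "smooth_fun S f \<Longrightarrow> smooth_fun S (\<lambda>p. complex_of_real (f p))"
  unfolding smooth_fun_def using chart_of.smooth_of_real[OF chart_of_atlas] by blast

lemma smooth_fun_diff: "smooth_fun S f \<Longrightarrow> smooth_fun S g \<Longrightarrow> smooth_fun S (\<lambda>p. f p - g p)"
  unfolding smooth_fun_def using chart_of.smooth_diff[OF chart_of_atlas] by blast

lemma smooth_fun_sum: "(\<And>i. i \<in> I \<Longrightarrow> smooth_fun S (f i)) \<Longrightarrow> smooth_fun S (\<lambda>p. \<Sum>i\<in>I. f i p)"
  unfolding smooth_fun_def using chart_of.smooth_sum[OF chart_of_atlas, of _ I f] by blast

text \<open>The divergence of the flux, expressed without reference to a chart. It is additive in
  \<eta> and vanishes off the support of \<eta>, so it can be localised by cutting up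
  \<eta>.\<close>

definition defect :: "'a spinor_field \<Rightarrow> 'a spinor_field \<Rightarrow> 'a \<Rightarrow> complex" where
  "defect \<eta> \<zeta> p = pairing S 4 (Phi S \<eta>) \<zeta> p - pairing S 2 \<eta> (Phi_adj S \<zeta>) p"

lemma smooth_defect:
  assumes "symmetric_spinor_field S 2 \<eta>" "symmetric_spinor_field S 4 \<zeta>"
  shows "smooth_fun S (defect \<eta> \<zeta>)"
  unfolding defect_def[abs_def]
  by (intro smooth_fun_diff smooth_pairing symmetric_smooth Phi_symmetric Phi_adj_symmetric assms)

lemma defect_outside:
  assumes "compact C" "supported_in \<eta> 2 C" "p \<notin> C"
  shows "defect \<eta> \<zeta> p = 0"
  using Phi_zero_outside[OF compact_imp_closed[OF assms(1)] assms(2,3)] assms(2,3)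
  by (simp add: defect_def pairing_zero_left supported_in_def)

lemma integral_defect_local:
  assumes "c \<in> atlas S" and K: "compact K" "K \<subseteq> fst c" and supp: "supported_in \<eta> 2 K"
    and \<eta>: "symmetric_spinor_field S 2 \<eta>" and \<zeta>: "symmetric_spinor_field S 4 \<zeta>"
  shows "integrable (vol S) (defect \<eta> \<zeta>)" "(LINT p|vol S. defect \<eta> \<zeta> p) = 0"
proof -
  interpret chart_of S c using assms(1) by (rule chart_of_atlas)
  note sm = symmetric_smooth[OF \<eta>] symmetric_smooth[OF \<zeta>]
  show "integrable (vol S) (defect \<eta> \<zeta>)"
    by (rule integrable_smooth[OF smooth_defect[OF \<eta> \<zeta>] K(1)]) (rule defect_outside[OF K(1) supp])
  show "(LINT p|vol S. defect \<eta> \<zeta> p) = 0"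
  proof (rule integral_div_flux[where X = "flux S c \<eta> \<zeta>", OF smooth_flux[OF sm] K])
    show "defect \<eta> \<zeta> p = div_flux (flux S c \<eta> \<zeta>) p" if "p \<in> fst c" for p
      unfolding defect_def by (rule adjoint_pointwise[OF that \<eta> \<zeta>])
    show "flux S c \<eta> \<zeta> a p = 0" if "p \<notin> K" for a p
      using supp that by (simp add: flux_def pairing_zero_left supported_in_def)
    show "defect \<eta> \<zeta> p = 0" if "p \<notin> fst c" for p
      using defect_outside[OF K(1) supp] K(2) that by blast
  qed (rule measurable_smooth(1)[OF smooth_defect[OF \<eta> \<zeta>]])
qed

lemma defect_add:
  assumes "symmetric_spinor_field S 2 u" "symmetric_spinor_field S 2 v"
  shows "defect (\<lambda>xs p. u xs p + v xs p) \<zeta> p = defect u \<zeta> p + defect v \<zeta> p"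
proof -
  have "pairing S 4 (Phi S (\<lambda>xs p. u xs p + v xs p)) \<zeta> p
      = pairing S 4 (\<lambda>xs p. Phi S u xs p + Phi S v xs p) \<zeta> p"
    using Phi_linear[OF symmetric_smooth[OF assms(1)] symmetric_smooth[OF assms(2)], of _ 1 p]
    by (intro pairing_cong) simp_all
  then show ?thesis
    by (simp add: defect_def pairing_add_left)
qed

text \<open>Spinor fields are functions on all index lists, so decompositions of \<eta> give
  equality on lists of length 2 only; the defect sees nothing else.\<close>

lemma defect_cong:
  assumes "\<And>xs. length xs = 2 \<Longrightarrow> u xs = v xs"
  shows "defect u \<zeta> p = defect v \<zeta> p"
proof -
  have "Phi S u xs p = Phi S v xs p" if "length xs = 4" for xs
  proof -
    have s: "sen S u ys p = sen S v ys p" if ys: "length ys = 4" for ys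
    proof -
      obtain A B C D where "ys = [A, B, C, D]" using ys by (rule length_4E)
      then show ?thesis using assms by (simp add: cov_deriv_def)
    qed
    show ?thesis
      unfolding Phi_def symmetrise_def using that s by simp
  qed
  then show ?thesis
    unfolding defect_def using assms by (intro arg_cong2[of _ _ _ _ "(-)"] pairing_cong) simp_all
qed

text \<open>A partition of unity is needed only on the compact support: finitely many bumps with sum
  \<rho> > 0 on C cut \<eta>/\<rho> into pieces supported in single charts, and these pieces add up
  to \<eta>.\<close>

lemma integral_defect:
  assumes \<eta>: "symmetric_spinor_field S 2 \<eta>" and \<zeta>: "symmetric_spinor_field S 4 \<zeta>"
    and C: "compact C" "supported_in \<eta> 2 C"
  shows "(LINT p|vol S. defect \<eta> \<zeta> p) = 0"
proof -
  have "\<exists>(f::'a \<Rightarrow> real) K c. smooth_fun S f \<and> (\<forall>q. f q \<ge> 0) \<and> f p > 0 \<and> compact K \<and>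
      c \<in> atlas S \<and> K \<subseteq> fst c \<and> (\<forall>q. q \<notin> K \<longrightarrow> f q = 0)" for p
    using bump_exists[OF open_UNIV UNIV_I chart_at, of p] chart_at(1)[of p] by blast
  then have "\<forall>p. \<exists>(f::'a \<Rightarrow> real) K c. smooth_fun S f \<and> (\<forall>q. f q \<ge> 0) \<and> f p > 0 \<and> compact K \<and>
      c \<in> atlas S \<and> K \<subseteq> fst c \<and> (\<forall>q. q \<notin> K \<longrightarrow> f q = 0)" by blast
  then obtain f :: "'a \<Rightarrow> 'a \<Rightarrow> real" and K c where fK: "\<forall>p. smooth_fun S (f p) \<and> (\<forall>q. f p q \<ge> 0) \<and>
      f p p > 0 \<and> compact (K p) \<and> c p \<in> atlas S \<and> K p \<subseteq> fst (c p) \<and> (\<forall>q. q \<notin> K p \<longrightarrow> f p q = 0)"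
    unfolding choice_iff by (elim exE)
  have f: "smooth_fun S (f p)" "f p q \<ge> 0" "f p p > 0" for p q
    using fK by auto
  have K: "compact (K p)" "c p \<in> atlas S" "K p \<subseteq> fst (c p)" "q \<notin> K p \<Longrightarrow> f p q = 0" for p q
    using fK by auto
  have "open {q. f p q > 0}" for p
    using smooth_fun_continuous[OF f(1)] by (intro open_Collect_less continuous_on_const)
  moreover have "C \<subseteq> (\<Union>p\<in>C. {q. f p q > 0})" using f(3) by auto
  ultimately obtain T where T: "T \<subseteq> C" "finite T" "C \<subseteq> (\<Union>p\<in>T. {q. f p q > 0})"
    using compactE_image[OF C(1), of C "\<lambda>p. {q. f p q > 0}"] by metis
  define \<rho> where "\<rho> q = (\<Sum>p\<in>T. f p q)" for q
  have \<rho>: "smooth_fun S \<rho>" unfolding \<rho>_def by (intro smooth_fun_sum f)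
  have \<rho>_pos: "\<rho> q > 0" if q: "q \<in> C" for q
  proof -
    obtain p where "p \<in> T" "f p q > 0" using T(3) q by blast
    then show ?thesis unfolding \<rho>_def by (intro sum_pos2[OF T(2)]) (auto simp: f(2))
  qed
  \<comment> \<open>Dividing \<eta> instead of the bumps keeps everything smooth: where \<rho> is
    positive the quotient is smooth, and all other points lie in the open complement of C, where
    \<eta> is zero. The value of \<open>inverse 0\<close> is therefore harmless.\<close>
  define \<eta>' where "\<eta>' xs q = of_real (inverse (\<rho> q)) * \<eta> xs q" for xs q
  have \<eta>': "symmetric_spinor_field S 2 \<eta>'"
    unfolding symmetric_spinor_field_def smooth_spinor_field_def
  proof (intro conjI allI impI ballI)
    fix xs :: "2 list" and c assume xs: "length xs = 2" and "c \<in> atlas S"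
    then interpret chart_of S c by (simp add: chart_of_atlas)
    have r: "smooth_in_chart c \<rho>" using \<rho> c_atlas by (simp add: smooth_fun_def)
    have e: "smooth_in_chart c (\<eta> xs)" by (rule smooth_spinor_chart[OF symmetric_smooth[OF \<eta>] xs])
    show "smooth_in_chart c (\<eta>' xs)"
    proof (rule smooth_local)
      fix p assume "p \<in> fst c"
      show "\<exists>W g. open W \<and> p \<in> W \<and> smooth_on (snd c ` (W \<inter> fst c)) (g \<circ> chart_inv c) \<and> (\<forall>q\<in>W. \<eta>' xs q = g q)"
      proof (cases "\<rho> p > 0")
        case True
        let ?W = "{q. \<rho> q > 0}"
        have W: "open ?W"
          using smooth_fun_continuous[OF \<rho>] by (intro open_Collect_less continuous_on_const)
        have "smooth_on (snd c ` (?W \<inter> fst c)) (\<lambda>x. of_real (inverse ((\<rho> \<circ> chart_inv c) x)) * (\<eta> xs \<circ> chart_inv c) x)"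
          using smooth_restrict[OF r, of ?W] smooth_restrict[OF e, of ?W]
          by (intro smooth_on_mult smooth_on_of_real smooth_on_inverse open_image[OF W]) (auto simp: o_def)
        then have "smooth_on (snd c ` (?W \<inter> fst c)) (\<eta>' xs \<circ> chart_inv c)"
          by (simp add: \<eta>'_def o_def)
        then show ?thesis using W True by blast
      next
        case False
        then have "p \<in> - C" using \<rho>_pos by auto
        moreover have "open (- C)" using C(1) by (simp add: compact_imp_closed open_Compl)
        moreover have "\<forall>q\<in>- C. \<eta>' xs q = 0" using C(2) xs by (simp add: \<eta>'_def supported_in_def)
        ultimately show ?thesis
          by (intro exI[of _ "- C"] exI[of _ "\<lambda>_. 0"]) (simp add: o_def)
      qed
    qed
  next
    fix xs ys :: "2 list" assume "length xs = 2 \<and> mset ys = mset xs"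
    then have "\<eta> ys = \<eta> xs" using symmetric_mset[OF \<eta>] by blast
    then show "\<eta>' ys = \<eta>' xs" by (simp add: \<eta>'_def[abs_def])
  qed
  define F where "F p xs q = complex_of_real (f p q) * \<eta>' xs q" for p xs q
  have F: "symmetric_spinor_field S 2 (F p)" for p
    unfolding F_def by (intro symmetric_scale smooth_fun_of_real f \<eta>')
  have FK: "supported_in (F p) 2 (K p)" for p
    using K(4) by (simp add: F_def supported_in_def)
  have "symmetric_spinor_field S 2 (\<lambda>xs q. \<Sum>p\<in>T'. F p xs q) \<and>
      integrable (vol S) (defect (\<lambda>xs q. \<Sum>p\<in>T'. F p xs q) \<zeta>) \<and>
      (LINT q|vol S. defect (\<lambda>xs q. \<Sum>p\<in>T'. F p xs q) \<zeta> q) = 0" if "finite T'" for T'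
    using that
  proof (induction T' rule: finite_induct)
    case empty
    have "symmetric_spinor_field S 2 (\<lambda>xs q. 0)"
      using symmetric_scale[OF smooth_fun_const[of 0] \<eta>] by simp
    moreover have "defect (\<lambda>xs q. 0) \<zeta> = (\<lambda>q. 0)"
      using defect_outside[of "{}" "\<lambda>xs q. 0" _ \<zeta>] by (auto simp: supported_in_def)
    ultimately show ?case by simp
  next
    case (insert p T')
    have I: "integrable (vol S) (defect (F p) \<zeta>)" "(LINT q|vol S. defect (F p) \<zeta> q) = 0"
      using integral_defect_local[OF K(2,1,3) FK F \<zeta>] by auto
    have "(\<lambda>xs q. \<Sum>p\<in>insert p T'. F p xs q) = (\<lambda>xs q. F p xs q + (\<Sum>p\<in>T'. F p xs q))"
      using insert by simp
    moreover have "defect (\<lambda>xs q. F p xs q + (\<Sum>p\<in>T'. F p xs q)) \<zeta> =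
        (\<lambda>q. defect (F p) \<zeta> q + defect (\<lambda>xs q. \<Sum>p\<in>T'. F p xs q) \<zeta> q)"
      using insert F by (intro ext defect_add) auto
    ultimately show ?case
      using insert I symmetric_add[OF F] by simp
  qed
  moreover have "defect \<eta> \<zeta> q = defect (\<lambda>xs q. \<Sum>p\<in>T. F p xs q) \<zeta> q" for q
  proof (rule defect_cong)
    fix xs :: "2 list" assume xs: "length xs = 2"
    show "\<eta> xs = (\<lambda>q. \<Sum>p\<in>T. F p xs q)"
    proof
      fix q
      have "(\<Sum>p\<in>T. F p xs q) = of_real (\<rho> q) * \<eta>' xs q"
        by (simp add: F_def \<rho>_def sum_distrib_right)
      also have "\<dots> = \<eta> xs q"
        using \<rho>_pos[of q] C(2) xs by (cases "q \<in> C") (auto simp: \<eta>'_def supported_in_def)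
      finally show "\<eta> xs q = (\<Sum>p\<in>T. F p xs q)" ..
    qed
  qed
  ultimately show ?thesis using T(2) by simp
qed

lemma integral_adjoint:
  assumes \<eta>: "symmetric_spinor_field S 2 \<eta>" and \<zeta>: "symmetric_spinor_field S 4 \<zeta>"
    and C: "compact C" "supported_in \<eta> 2 C"
  shows "(LINT p|vol S. pairing S 4 (Phi S \<eta>) \<zeta> p) = (LINT p|vol S. pairing S 2 \<eta> (Phi_adj S \<zeta>) p)"
proof -
  have "integrable (vol S) (pairing S 4 (Phi S \<eta>) \<zeta>)"
    by (rule integrable_smooth[OF smooth_pairing C(1)])
      (auto intro!: symmetric_smooth Phi_symmetric \<eta> \<zeta> pairing_zero_left
        Phi_zero_outside[OF compact_imp_closed[OF C(1)] C(2)])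
  moreover have "integrable (vol S) (pairing S 2 \<eta> (Phi_adj S \<zeta>))"
    by (rule integrable_smooth[OF smooth_pairing C(1)])
      (use C(2) in \<open>auto intro!: symmetric_smooth Phi_adj_symmetric \<eta> \<zeta> pairing_zero_left simp: supported_in_def\<close>)
  ultimately show ?thesis
    using integral_defect[OF \<eta> \<zeta> C] by (simp add: defect_def)
qed

end

section \<open>The variation of the functional\<close>

lemma has_vector_derivative_quadratic:
  fixes a b k :: complex
  assumes "\<And>t. h t = a + of_real t * b + of_real (t\<^sup>2) * k"
  shows "(h has_vector_derivative 0) (at 0) \<longleftrightarrow> b = 0"
proof -
  have "((\<lambda>t. a + of_real t * b + of_real (t\<^sup>2) * k) has_vector_derivative b) (at 0)"
    by (auto intro!: derivative_eq_intros has_vector_derivative_real_field)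
  then have "(h has_vector_derivative b) (at 0)"
    using assms by presburger
  then show ?thesis
    using vector_derivative_unique_at by blast
qed

context vacuum_spin
begin

lemma pairing_cnj: "cnj (pairing S n u v p) = pairing S n v u p"
proof -
  have "cnj (pairing S n u v p) = (\<Sum>xs | length xs = n. \<Sum>zs | length zs = n.
      v zs p * (\<Prod>k<n. herm_form S p (zs ! k) (xs ! k)) * cnj (u xs p))"
    by (simp add: pairing_eq herm_form_cnj mult_ac)
  also have "\<dots> = pairing S n v u p"
    unfolding pairing_eq by (rule sum.swap)
  finally show ?thesis .
qed

text \<open>The functional pairs the symmetrised derivative with the full one. The first factor is
  already symmetric, so the symmetriser can be moved to the second.\<close>

lemma J_density_eq:
  assumes "symmetric_spinor_field S 2 \<kappa>"
  shows "J_density S \<kappa> p = pairing S 4 (Phi S \<kappa>) (Phi S \<kappa>) p"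
proof -
  have "pairing S 4 (Phi S \<kappa>) (Phi S \<kappa>) p = pairing S 4 (symmetrise (Phi S \<kappa>)) (sen S \<kappa>) p"
    by (subst pairing_symmetrise) (simp only: Phi_def)
  also have "\<dots> = pairing S 4 (Phi S \<kappa>) (sen S \<kappa>) p"
    by (rule pairing_cong) (simp_all add: symmetrise_symmetric_field[OF Phi_symmetric[OF assms]])
  finally show ?thesis by (simp add: J_density_pairing)
qed

lemma vary_symmetric:
  assumes "symmetric_spinor_field S 2 \<kappa>" "symmetric_spinor_field S 2 \<eta>"
  shows "symmetric_spinor_field S 2 (vary \<kappa> \<eta> t)"
  unfolding vary_def by (intro symmetric_add symmetric_scale smooth_fun_const assms)

text \<open>The density is exactly quadratic in t. As t is real and the pairing Hermitian, the two
  cross terms are conjugate to each other and combine to twice a real part.\<close>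

lemma J_density_vary:
  assumes \<kappa>: "symmetric_spinor_field S 2 \<kappa>" and \<eta>: "symmetric_spinor_field S 2 \<eta>"
  shows "J_density S (vary \<kappa> \<eta> t) p = J_density S \<kappa> p
    + of_real t * of_real (2 * Re (pairing S 4 (Phi S \<eta>) (Phi S \<kappa>) p))
    + of_real (t\<^sup>2) * J_density S \<eta> p"
proof -
  have "J_density S (vary \<kappa> \<eta> t) p = pairing S 4 (Phi S (vary \<kappa> \<eta> t)) (Phi S (vary \<kappa> \<eta> t)) p"
    by (rule J_density_eq[OF vary_symmetric[OF \<kappa> \<eta>]])
  also have "\<dots> = pairing S 4 (\<lambda>xs p. Phi S \<kappa> xs p + of_real t * Phi S \<eta> xs p)
      (\<lambda>xs p. Phi S \<kappa> xs p + of_real t * Phi S \<eta> xs p) p"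
    unfolding vary_def
    by (rule pairing_cong) (rule Phi_linear[OF symmetric_smooth[OF \<kappa>] symmetric_smooth[OF \<eta>]], assumption)+
  also have "\<dots> = J_density S \<kappa> p + of_real t * (pairing S 4 (Phi S \<eta>) (Phi S \<kappa>) p
      + cnj (pairing S 4 (Phi S \<eta>) (Phi S \<kappa>) p)) + of_real (t\<^sup>2) * J_density S \<eta> p"
    by (simp add: pairing_add_left pairing_add_right pairing_scale_left pairing_scale_right pairing_cnj
        J_density_eq[OF \<kappa>] J_density_eq[OF \<eta>] power2_eq_square algebra_simps)
  finally show ?thesis by (simp add: complex_add_cnj)
qed

lemma smooth_J_density:
  assumes "symmetric_spinor_field S 2 \<kappa>" shows "smooth_fun S (J_density S \<kappa>)"
  unfolding J_density_eq[OF assms, abs_def]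
  by (intro smooth_pairing symmetric_smooth Phi_symmetric assms)

text \<open>Half the derivative of $J$ at \<open>\<kappa>\<close> along \<open>\<eta>\<close>.\<close>

definition first_variation :: "'a spinor_field \<Rightarrow> 'a spinor_field \<Rightarrow> real" where
  "first_variation \<kappa> \<eta> = Re (LINT p|vol S. pairing S 2 \<eta> (approx_killing S \<kappa>) p)"

context
  fixes \<kappa> \<eta> :: "'a spinor_field" and C :: "'a set"
  assumes \<kappa>: "symmetric_spinor_field S 2 \<kappa>" and \<eta>: "symmetric_spinor_field S 2 \<eta>"
    and C: "compact C" "supported_in \<eta> 2 C"
begin

lemma Phi_variation_outside: "p \<notin> C \<Longrightarrow> length xs = 4 \<Longrightarrow> Phi S \<eta> xs p = 0"
  by (rule Phi_zero_outside[OF compact_imp_closed[OF C(1)] C(2)])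

text \<open>The linear coefficient in t. It vanishes off C, so its integrals over C and over the
  manifold agree, and the adjunction applies to the latter.\<close>

lemma cross_term:
  defines "r \<equiv> \<lambda>p. complex_of_real (2 * Re (pairing S 4 (Phi S \<eta>) (Phi S \<kappa>) p))"
  shows "integrable (vol S) r" "(LINT p:C|vol S. r p) = (LINT p|vol S. r p)"
    "(LINT p|vol S. r p) = of_real (2 * first_variation \<kappa> \<eta>)"
proof -
  let ?b = "pairing S 4 (Phi S \<eta>) (Phi S \<kappa>)"
  have 0: "?b p = 0" if "p \<notin> C" for p
    using Phi_variation_outside[OF that] by (rule pairing_zero_left)
  have b: "integrable (vol S) ?b"
    by (rule integrable_smooth[OF smooth_pairing C(1)])
      (auto intro!: symmetric_smooth Phi_symmetric \<kappa> \<eta> 0)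
  then show "integrable (vol S) r" unfolding r_def by simp
  have "(\<lambda>p. indicat_real C p *\<^sub>R r p) = r" using 0 by (auto simp: indicator_def r_def)
  then show "(LINT p:C|vol S. r p) = (LINT p|vol S. r p)"
    unfolding set_lebesgue_integral_def by simp
  have "(LINT p|vol S. r p) = of_real (2 * Re (LINT p|vol S. ?b p))"
    unfolding r_def using b by simp
  also have "(LINT p|vol S. ?b p) = (LINT p|vol S. pairing S 2 \<eta> (approx_killing S \<kappa>) p)"
    unfolding approx_killing_def by (rule integral_adjoint[OF \<eta> Phi_symmetric[OF \<kappa>] C])
  finally show "(LINT p|vol S. r p) = of_real (2 * first_variation \<kappa> \<eta>)"
    by (simp add: first_variation_def)
qed

lemma J_density_variation_outside: "p \<notin> C \<Longrightarrow> J_density S \<eta> p = 0"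
  unfolding J_density_eq[OF \<eta>] by (rule pairing_zero_left) (rule Phi_variation_outside)

text \<open>On the compact C all three coefficients of the quadratic are integrable, whatever
  \<kappa> does at infinity.\<close>

lemma J_on_stationary_iff:
  "((\<lambda>t. J_on S C (vary \<kappa> \<eta> t)) has_vector_derivative 0) (at 0) \<longleftrightarrow> first_variation \<kappa> \<eta> = 0"
proof -
  define r where "r p = complex_of_real (2 * Re (pairing S 4 (Phi S \<eta>) (Phi S \<kappa>) p))" for p
  note cross = cross_term[folded r_def]
  have si: "set_integrable (vol S) C (J_density S \<kappa>)" "set_integrable (vol S) C (J_density S \<eta>)"
    by (intro set_integrable_smooth smooth_J_density \<kappa> \<eta> C)+
  have C': "C \<in> sets (vol S)"
    using C(1) chart_of.sets_vol[OF chart_of_atlas[OF chart_at(1)]] by (simp add: borel_compact)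
  have sr: "set_integrable (vol S) C r"
    unfolding set_integrable_def by (rule integrable_mult_indicator[OF C' cross(1)])
  have "J_on S C (vary \<kappa> \<eta> t) = (LINT p:C|vol S. J_density S \<kappa> p)
      + of_real t * (LINT p:C|vol S. r p) + of_real (t\<^sup>2) * (LINT p:C|vol S. J_density S \<eta> p)" for t
    unfolding J_on_def J_density_vary[OF \<kappa> \<eta>] r_def[symmetric]
    using si sr by simp
  then show ?thesis
    unfolding cross(2,3) by (simp add: has_vector_derivative_quadratic)
qed

text \<open>Finiteness of J at \<kappa> is used for the constant term of the quadratic; the other
  two coefficients vanish off C.\<close>

lemma J_stationary_iff:
  assumes fin: "J_finite S \<kappa>"
  shows "((\<lambda>t. J S (vary \<kappa> \<eta> t)) has_vector_derivative 0) (at 0) \<longleftrightarrow> first_variation \<kappa> \<eta> = 0"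
proof -
  define r where "r p = complex_of_real (2 * Re (pairing S 4 (Phi S \<eta>) (Phi S \<kappa>) p))" for p
  note cross = cross_term[folded r_def]
  have i: "integrable (vol S) (J_density S \<kappa>)" "integrable (vol S) (J_density S \<eta>)"
    using fin integrable_smooth(1)[OF smooth_J_density[OF \<eta>] C(1) J_density_variation_outside]
    by (auto simp: J_finite_def)
  have "J S (vary \<kappa> \<eta> t) = (LINT p|vol S. J_density S \<kappa> p)
      + of_real t * (LINT p|vol S. r p) + of_real (t\<^sup>2) * (LINT p|vol S. J_density S \<eta> p)" for t
    unfolding J_def J_density_vary[OF \<kappa> \<eta>] r_def[symmetric]
    using i cross(1) by simp
  then show ?thesis
    unfolding cross(3) by (simp add: has_vector_derivative_quadratic)
qed

end

subsection \<open>The fundamental lemma of the calculus of variations\<close>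

text \<open>The density is strictly positive, so a null open set would have a nonempty open
  coordinate image of Lebesgue measure zero.\<close>

lemma emeasure_vol_open_pos:
  assumes "open W" "p \<in> W" shows "emeasure (vol S) W \<noteq> 0"
proof
  assume W0: "emeasure (vol S) W = 0"
  interpret chart_of S "chart_at S p" by (rule chart_of_atlas[OF chart_at(1)])
  let ?c = "chart_at S p"
  let ?V = "snd ?c ` (W \<inter> fst ?c)"
  have V: "open ?V" by (rule open_image[OF assms(1)])
  have "emeasure (vol S) (W \<inter> fst ?c) \<le> emeasure (vol S) W"
    using assms(1) by (intro emeasure_mono) (auto simp: sets_vol)
  then have "emeasure (vol S) (W \<inter> fst ?c) = 0" using W0 by simp
  then have 0: "(\<integral>\<^sup>+x\<in>?V. ennreal (dens (chart_inv ?c x)) \<partial>lborel) = 0"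
    using emeasure_vol_chart[of "W \<inter> fst ?c"] assms(1) open_dom by auto
  have e: "ennreal (dens (chart_inv ?c x)) * indicator ?V x
      = ennreal (indicator U x * dens (chart_inv ?c x)) * indicator ?V x" for x
    by (auto simp: indicator_def)
  have "AE x in lborel. ennreal (indicator U x * dens (chart_inv ?c x)) * indicator ?V x = 0"
    using 0 V unfolding e
    by (subst (asm) nn_integral_0_iff_AE) (auto intro!: borel_measurable_times_ennreal borel_measurable_indicator)
  then have "AE x in lborel. x \<notin> ?V"
    by eventually_elim (use dens_pos in \<open>force simp: indicator_def split: if_splits\<close>)
  then have "?V \<in> null_sets lborel"
    using V by (simp add: AE_iff_null_sets)
  then have "negligible ?V"
    by (simp add: negligible_iff_null_sets null_sets_completionI)
  moreover have "?V \<noteq> {}" using assms(2) chart_at(2) by auto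
  ultimately show False using V open_not_negligible by blast
qed

text \<open>Raising and hatting contracts each index with \<open>herm_form\<close>, whose inverse is
  the normal spinor; contracting with tau recovers the conjugate of v.\<close>

lemma raise_hat_eq_0:
  assumes "\<And>A B. raise 2 (hat S v) [A, B] p = 0" shows "v [F, H] p = 0"
proof -
  let ?M = "herm_form S p" and ?n = "normal S p"
  have r: "raise 2 (hat S v) [A, B] p = (\<Sum>E\<in>UNIV. \<Sum>G\<in>UNIV. ?M A E * ?M B G * cnj (v [E, G] p))" for A B
    by (subst raise_hat) (simp_all add: sum_index_lists_2 prod_lessThan_2)
  have "0 = (\<Sum>A\<in>UNIV. \<Sum>B\<in>UNIV. ?n A F * ?n B H * raise 2 (hat S v) [A, B] p)"
    by (simp add: assms)
  also have "\<dots> = (\<Sum>E\<in>UNIV. \<Sum>G\<in>UNIV. (\<Sum>A\<in>UNIV. ?n A F * ?M A E) * (\<Sum>B\<in>UNIV. ?n B H * ?M B G) * cnj (v [E, G] p))"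
    unfolding r by (simp add: sum_2 algebra_simps)
  also have "\<dots> = cnj (v [F, H] p)"
    unfolding herm_form_inverse using exhaust_2[of F] exhaust_2[of H] by (auto simp: sum_2)
  finally show ?thesis by simp
qed

lemma first_variation_eq_0_iff:
  assumes \<kappa>: "symmetric_spinor_field S 2 \<kappa>"
  shows "(\<forall>\<eta> C. symmetric_spinor_field S 2 \<eta> \<and> compact C \<and> supported_in \<eta> 2 C \<longrightarrow> first_variation \<kappa> \<eta> = 0)
    \<longleftrightarrow> (\<forall>C D p. approx_killing S \<kappa> [C, D] p = 0)"
proof
  assume "\<forall>C D p. approx_killing S \<kappa> [C, D] p = 0"
  then have "pairing S 2 \<eta> (approx_killing S \<kappa>) p = 0" for \<eta> p
    by (intro pairing_zero_right) (auto elim!: length_2E)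
  then show "\<forall>\<eta> C. symmetric_spinor_field S 2 \<eta> \<and> compact C \<and> supported_in \<eta> 2 C \<longrightarrow> first_variation \<kappa> \<eta> = 0"
    by (simp add: first_variation_def)
next
  assume stat: "\<forall>\<eta> C. symmetric_spinor_field S 2 \<eta> \<and> compact C \<and> supported_in \<eta> 2 C \<longrightarrow> first_variation \<kappa> \<eta> = 0"
  define L where "L = approx_killing S \<kappa>"
  have L: "symmetric_spinor_field S 2 L"
    unfolding L_def approx_killing_def by (rule Phi_adj_symmetric[OF Phi_symmetric[OF \<kappa>]])
  define W where "W = raise 2 (hat S L)"
  have smW: "smooth_fun S (W xs)" if "length xs = 2" for xs
    unfolding smooth_fun_def W_def
  proof
    fix c assume "c \<in> atlas S"
    then interpret chart_of S c by (rule chart_of_atlas)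
    show "smooth_in_chart c (raise 2 (hat S L) xs)"
      by (rule raise_hat_smooth[OF that smooth_spinor_chart[OF symmetric_smooth[OF L]]])
  qed
  have "W [A, B] p0 = 0" for A B p0
  proof (rule ccontr)
    assume nz: "W [A, B] p0 \<noteq> 0"
    \<comment> \<open>The conjugate of the offending value makes the pairing at p0 a sum of squared
      moduli, so the real part alone detects it.\<close>
    define e where "e xs = cnj (W xs p0)" for xs
    define g where "g p = Re (\<Sum>xs | length xs = 2. e xs * W xs p)" for p
    have "smooth_fun S (\<lambda>p. \<Sum>xs | length xs = 2. e xs * W xs p)"
    proof (rule smooth_fun_sum)
      fix xs assume "xs \<in> {xs :: 2 list. length xs = 2}"
      then show "smooth_fun S (\<lambda>p. e xs * W xs p)"
        using smW[of xs] unfolding smooth_fun_def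
        by (auto intro!: chart_of.smooth_mult chart_of.smooth_const chart_of_atlas)
    qed
    then have cg: "continuous_on UNIV g"
      unfolding g_def by (intro continuous_intros smooth_fun_continuous)
    have "g p0 > 0"
    proof -
      have "g p0 = (\<Sum>xs | length xs = 2. (cmod (W xs p0))\<^sup>2)"
        by (simp add: g_def e_def cmod_power2 flip: power2_eq_square)
      also have "\<dots> > 0"
        by (rule sum_pos2[of _ "[A, B]"]) (use nz in auto)
      finally show ?thesis .
    qed
    \<comment> \<open>By continuity g stays positive near p0. A bump supported in W0 then makes the
      integrand f g nonnegative on the whole manifold.\<close>
    define W0 where "W0 = {p. g p > 0}"
    have W0: "open W0" "p0 \<in> W0"
      unfolding W0_def using cg \<open>g p0 > 0\<close> by (auto intro!: open_Collect_less continuous_on_const)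
    obtain f :: "'a \<Rightarrow> real" and K where f: "smooth_fun S f" "\<forall>q. f q \<ge> 0" "f p0 > 0" "compact K"
      "K \<subseteq> W0 \<inter> fst (chart_at S p0)" "\<forall>q. q \<notin> K \<longrightarrow> f q = 0"
      using bump_exists[OF W0 chart_at] by blast
    define \<eta> where "\<eta> xs p = complex_of_real (f p) * e xs" for xs p
    \<comment> \<open>Constant components in the global dyad define a smooth field. Its symmetry is
      inherited from that of L at p0, so it is an admissible direction.\<close>
    have "symmetric_spinor_field S 2 (\<lambda>xs p. e xs)"
      unfolding symmetric_spinor_field_def smooth_spinor_field_def
    proof (intro conjI allI impI ballI)
      show "smooth_in_chart c (\<lambda>p. e xs)" if "c \<in> atlas S" for c xs
        using chart_of.smooth_const[OF chart_of_atlas[OF that]] .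
      fix xs ys :: "2 list" assume *: "length xs = 2 \<and> mset ys = mset xs"
      then have "W ys p0 = W xs p0"
        unfolding W_def by (intro raise_hat_mset) (auto intro: fun_cong[OF symmetric_mset[OF L]])
      then show "(\<lambda>p. e ys) = (\<lambda>p. e xs)" by (simp add: e_def)
    qed
    then have \<eta>: "symmetric_spinor_field S 2 \<eta>"
      unfolding \<eta>_def by (intro symmetric_scale smooth_fun_of_real f(1))
    have supp: "supported_in \<eta> 2 K"
      using f(6) by (simp add: \<eta>_def supported_in_def)
    have pr: "Re (pairing S 2 \<eta> L p) = f p * g p" for p
      by (simp add: pairing_def \<eta>_def g_def W_def mult.assoc flip: sum_distrib_left)
    have int: "integrable (vol S) (pairing S 2 \<eta> L)"
      by (rule integrable_smooth(1)[OF smooth_pairing f(4)])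
        (use supp in \<open>auto intro!: symmetric_smooth \<eta> L pairing_zero_left simp: supported_in_def\<close>)
    have "first_variation \<kappa> \<eta> = 0"
      using stat \<eta> supp f(4) by blast
    then have int0: "(LINT p|vol S. f p * g p) = 0"
      using int by (simp add: first_variation_def L_def[symmetric] flip: pr)
    have int': "integrable (vol S) (\<lambda>p. f p * g p)"
      using integrable_Re[OF int] by (simp add: pr)
    have nn: "f p * g p \<ge> 0" for p
    proof (cases "p \<in> K")
      case True
      then have "g p > 0" using f(5) by (auto simp: W0_def)
      then show ?thesis using f(2) by simp
    qed (use f(6) in simp)
    have ae: "AE p in vol S. f p * g p = 0"
      using integral_nonneg_eq_0_iff_AE[OF int'] nn int0 by simp
    have op: "open {p. f p * g p > 0}"
      using smooth_fun_continuous[OF f(1)] cg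
      by (intro open_Collect_less continuous_on_const continuous_on_mult)
    \<comment> \<open>A nonnegative function with integral 0 vanishes almost everywhere, so this
      open set is null although it contains p0.\<close>
    have "emeasure (vol S) {p. f p * g p > 0} = 0"
    proof -
      interpret chart_of S "chart_at S p0" by (rule chart_of_atlas[OF chart_at(1)])
      have "AE p in vol S. p \<notin> {p. f p * g p > 0}" using ae by eventually_elim auto
      moreover have "{p. f p * g p > 0} \<in> sets (vol S)" using op by (simp add: sets_vol)
      ultimately show ?thesis using AE_iff_null_sets null_setsD1 by blast
    qed
    moreover have "p0 \<in> {p. f p * g p > 0}" using f(3) \<open>g p0 > 0\<close> by simp
    ultimately show False using emeasure_vol_open_pos[OF op] by blast
  qed
  then show "\<forall>C D p. approx_killing S \<kappa> [C, D] p = 0"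
    using raise_hat_eq_0[of L] by (simp add: W_def L_def)
qed

end

theorem lemma12:
  fixes S :: "'a::{second_countable_topology, t2_space} spin_data"
    and \<kappa> :: "'a spinor_field"
  assumes "vacuum_spin_data S"
    and "symmetric_spinor_field S 2 \<kappa>"
  shows "(locally_stationary S \<kappa> \<longleftrightarrow>
            (\<forall>C D p. approx_killing S \<kappa> [C, D] p = 0)) \<and>
         (J_finite S \<kappa> \<longrightarrow>
            (stationary S \<kappa> \<longleftrightarrow>
              (\<forall>C D p. approx_killing S \<kappa> [C, D] p = 0)))"
proof -
  interpret vacuum_spin S by unfold_locales (rule assms(1))
  show ?thesis
    unfolding locally_stationary_def stationary_def first_variation_eq_0_iff[OF assms(2), symmetric]
    using J_on_stationary_iff[OF assms(2)] J_stationary_iff[OF assms(2)] by blast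
qed

end
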